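(* Let $f\colon\mathbb{R}^n\to\mathbb{R}\cup\{\infty\}$ be a symmetric function and let $\mathcal{M}\subset\mathbb{R}^n$ be a symmetric $C^2$-manifold containing a point $\bar x$. Suppose that $f$ is locally Lipschitz continuous around $\bar x$ and that the restriction $f|_{\mathcal{M}}$ is $C^2$-smooth near $\bar x$. Fix a matrix $\bar X\in\mathbf{S}^n$ satisfying $\bar x=\lambda(\bar X)$. If $f$ is $(a)$-regular along $\mathcal{M}$ near $\bar x$, then $f\circ\lambda$ is $(a)$-regular along $\lambda^{-1}(\mathcal{M})$ near $\bar X$. The analogous statement holds for strong $(a)$-regularity and for $(b_\diamond)$-regularity, for each $\diamond\in\{\le,=,\ge\}$. If $\mathcal{M}$ is in addition $C^3$-smooth, then the analogous statement holds for strong $(b_\diamond)$-regularity.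
   Context: $\mathbf{S}^n$ is the space of symmetric $n\times n$ matrices with the trace inner product and Frobenius norm; $\lambda\colon\mathbf{S}^n\to\mathbb{R}^n$ maps $X$ to its eigenvalues in nonincreasing order. A function $f$ on $\mathbb{R}^n$ is symmetric if $f(\pi x)=f(x)$ for all coordinate permutations $\pi$; a set in $\mathbb{R}^n$ is symmetric if it is invariant under coordinate permutations. $\mathbf{B}$ is the closed unit ball. The Fréchet normal cone $\hat N_Q(x)$ to $Q$ at $x\in Q$ is the set of $v$ with $\langle v,y-x\rangle\le o(\|y-x\|)$ as $y\to x$ in $Q$; the limiting normal cone $N_Q(x)$ consists of limits of $v_i\in\hat N_Q(x_i)$ with $x_i\to x$ in $Q$. $\Delta(U,V)=\sup\{\mathrm{dist}(u,V):u\in U,\|u\|=1\}$ for closed cones $U,V$. Regularity of a set $\mathcal{X}$ along a set $\mathcal{Y}$: (a): for any $x_i\in\mathcal{X}$ converging to $y\in\mathcal{Y}$ and $v_i\in N_{\mathcal{X}}(x_i)$, every limit point of $v_i$ lies in $N_{\mathcal{Y}}(y)$. $(b_\le)$, $(b_\ge)$, $(b_=)$: for all $x\in\mathcal{X}$, $y\in\mathcal{Y}$, $v\in N_{\mathcal{X}}(x)\cap\mathbf{B}$ one has, respectively, $\langle v,y-x\rangle\le o(\|y-x\|)$, $\ge o(\|y-x\|)$, $=o(\|y-x\|)$, where $o(\cdot)$ is a univariate error with $o(t)/t\to0$ as $t\searrow0$. strong (a): there is $C>0$ with $\Delta(N_{\mathcal{X}}(x),N_{\mathcal{Y}}(y))\le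 C\|x-y\|$ for all $x\in\mathcal{X}$, $y\in\mathcal{Y}$. strong $(b_\le)$, $(b_\ge)$, $(b_=)$: there is $C>0$ such that for all such $x,y,v$ one has, respectively, $\langle v,y-x\rangle\le C\|x-y\|^2$, $\langle v,y-x\rangle\ge-C\|x-y\|^2$, $|\langle v,y-x\rangle|\le C\|x-y\|^2$. Each property holds near $\bar z\in\mathcal{Y}$ if it holds for $\mathcal{X}\cap U$ along $\mathcal{Y}\cap U$ for some neighborhood $U$ of $\bar z$. A function $f$ has one of these properties along $\mathcal{M}\subseteq\mathrm{dom} f$ near $\bar x\in\mathcal{M}$ if $\mathrm{epi} f$ has it along $\mathrm{gph} f|_{\mathcal{M}}=\{(x,f(x)):x\in\mathcal{M}\}$ near $(\bar x,f(\bar x))$. *)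

theory Defs
  imports "HOL-Analysis.Analysis"
begin

typedef 'n symmat = "{A :: real ^ 'n::finite ^ 'n. transpose A = A}"
proof
  show "0 \<in> {A :: real ^ 'n ^ 'n. transpose A = A}"
    by (simp add: transpose_def vec_eq_iff)
qed

lemma transpose_Rep_symmat: "transpose (Rep_symmat X) = Rep_symmat X"
  using Rep_symmat [of X] by simp

lemma trace_mult_symmat:
  "trace (Rep_symmat X ** Rep_symmat Y) = Rep_symmat X \<bullet> Rep_symmat Y"
proof -
  have "Rep_symmat Y $ j $ i = Rep_symmat Y $ i $ j" for i j
    using transpose_Rep_symmat [of Y] by (simp add: transpose_def vec_eq_iff)
  then show ?thesis
    by (simp add: trace_def matrix_matrix_mult_def inner_vec_def)
qed

instantiation symmat :: (finite) real_vector
begin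

definition "0 = Abs_symmat 0"
definition "X + Y = Abs_symmat (Rep_symmat X + Rep_symmat Y)"
definition "X - Y = Abs_symmat (Rep_symmat X - Rep_symmat Y)"
definition "- X = Abs_symmat (- Rep_symmat X)"
definition "c *\<^sub>R X = Abs_symmat (c *\<^sub>R Rep_symmat X)"

lemma Rep_symmat_simps:
  "Rep_symmat (0 :: 'a symmat) = 0"
  "Rep_symmat (X + Y) = Rep_symmat X + Rep_symmat Y"
  "Rep_symmat (X - Y) = Rep_symmat X - Rep_symmat Y"
  "Rep_symmat (- X) = - Rep_symmat X"
  "Rep_symmat (c *\<^sub>R X) = c *\<^sub>R Rep_symmat X"
  using transpose_Rep_symmat [of X] transpose_Rep_symmat [of Y]
  by (simp_all add: zero_symmat_def plus_symmat_def minus_symmat_def uminus_symmat_def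
      scaleR_symmat_def Abs_symmat_inverse transpose_def vec_eq_iff)

instance
  by standard
    (simp_all add: Rep_symmat_inject [symmetric] Rep_symmat_simps algebra_simps)

end

instantiation symmat :: (finite) real_inner
begin

definition "X \<bullet> Y = trace (Rep_symmat X ** Rep_symmat Y)"
definition "norm (X :: 'a symmat) = norm (Rep_symmat X)"
definition "dist (X :: 'a symmat) Y = norm (X - Y)"
definition "sgn (X :: 'a symmat) = inverse (norm X) *\<^sub>R X"
definition [code del]:
  "(uniformity :: ('a symmat \<times> 'a symmat) filter) =
    (INF e\<in>{0<..}. principal {(x, y). dist x y < e})"
definition [code del]:
  "open (S :: 'a symmat set) \<longleftrightarrow>
    (\<forall>x\<in>S. \<forall>\<^sub>F (x', y) in uniformity. x' = x \<longrightarrow> y \<in> S)"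

instance
proof
  fix X Y Z :: "'a symmat" and c :: real and S :: "'a symmat set"
  have inn: "X \<bullet> Y = Rep_symmat X \<bullet> Rep_symmat Y" for X Y :: "'a symmat"
    by (simp add: inner_symmat_def trace_mult_symmat)
  show "dist X Y = norm (X - Y)"
    by (rule dist_symmat_def)
  show "sgn X = inverse (norm X) *\<^sub>R X"
    by (rule sgn_symmat_def)
  show "(uniformity :: ('a symmat \<times> 'a symmat) filter) =
      (INF e\<in>{0<..}. principal {(x, y). dist x y < e})"
    by (rule uniformity_symmat_def)
  show "open S \<longleftrightarrow> (\<forall>x\<in>S. \<forall>\<^sub>F (x', y) in uniformity. x' = x \<longrightarrow> y \<in> S)"
    by (rule open_symmat_def)
  show "X \<bullet> Y = Y \<bullet> X"
    by (simp add: inn inner_commute)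
  show "(X + Y) \<bullet> Z = X \<bullet> Z + Y \<bullet> Z" "(c *\<^sub>R X) \<bullet> Y = c * (X \<bullet> Y)"
      "0 \<le> X \<bullet> X" "norm X = sqrt (X \<bullet> X)"
    by (simp_all add: inn Rep_symmat_simps inner_add_left norm_symmat_def norm_eq_sqrt_inner)
  show "X \<bullet> X = 0 \<longleftrightarrow> X = 0"
    by (simp add: inn Rep_symmat_simps Rep_symmat_inject [symmetric])
qed

end

lemma exists_orthonormal_basis_symmat:
  "\<exists>B :: 'n::finite symmat set. B \<noteq> {} \<and> finite B \<and>
     (\<forall>u\<in>B. \<forall>v\<in>B. u \<bullet> v = (if u = v then 1 else 0)) \<and>
     (\<forall>X. (\<forall>u\<in>B. X \<bullet> u = 0) \<longleftrightarrow> X = 0)"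
proof -
  let ?S = "{A :: real ^ 'n ^ 'n. transpose A = A}"
  have S: "subspace ?S"
    by (auto simp: subspace_def transpose_def vec_eq_iff)
  obtain B where B: "B \<subseteq> ?S" "pairwise orthogonal B" "\<And>x. x \<in> B \<Longrightarrow> norm x = 1"
      "independent B" "card B = dim ?S" "span B = ?S"
    by (rule orthonormal_basis_subspace [OF S]) (rule that)
  have inj: "inj_on Abs_symmat B"
    by (rule inj_onI) (use B(1) in \<open>auto simp: Abs_symmat_inject subset_iff\<close>)
  have Rep: "Rep_symmat (Abs_symmat b) = b" if "b \<in> B" for b
    using that B(1) by (auto intro: Abs_symmat_inverse)
  have inn: "X \<bullet> Y = Rep_symmat X \<bullet> Rep_symmat Y" for X Y :: "'n symmat"
    by (simp add: inner_symmat_def trace_mult_symmat)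
  have "mat 1 \<in> span B"
    unfolding B(6) by simp
  moreover have "mat 1 \<noteq> (0 :: real ^ 'n ^ 'n)"
    by (simp add: mat_def vec_eq_iff)
  ultimately have "B \<noteq> {}"
    by auto
  show ?thesis
  proof (intro exI [of _ "Abs_symmat ` B"] conjI ballI allI iffI)
    show "Abs_symmat ` B \<noteq> {}" "finite (Abs_symmat ` B)"
      using \<open>B \<noteq> {}\<close> independent_imp_finite [OF B(4)] by simp_all
    show "u \<bullet> v = (if u = v then 1 else 0)"
      if uv: "u \<in> Abs_symmat ` B" "v \<in> Abs_symmat ` B" for u v
    proof -
      obtain a b where ab: "a \<in> B" "b \<in> B" "u = Abs_symmat a" "v = Abs_symmat b"
        using uv by blast
      have "a \<bullet> b = (if a = b then 1 else 0)"
      proof (cases "a = b")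
        case True
        then show ?thesis
          using B(3) [OF ab(1)] by (simp add: norm_eq_1)
      next
        case False
        then show ?thesis
          using pairwiseD [OF B(2) ab(1,2)] by (simp add: orthogonal_def)
      qed
      moreover have "u = v \<longleftrightarrow> a = b"
        using inj_on_eq_iff [OF inj ab(1,2)] ab(3,4) by simp
      ultimately show ?thesis
        by (simp add: inn ab(3,4) Rep [OF ab(1)] Rep [OF ab(2)])
    qed
    show "X = 0" if X: "\<forall>u\<in>Abs_symmat ` B. X \<bullet> u = 0" for X
    proof -
      have "orthogonal (Rep_symmat X) b" if "b \<in> B" for b
        using bspec [OF X imageI [OF that]] by (simp add: inn Rep [OF that] orthogonal_def)
      moreover have "Rep_symmat X \<in> span B"
        using Rep_symmat [of X] B(6) by simp
      ultimately have "orthogonal (Rep_symmat X) (Rep_symmat X)"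
        using orthogonal_to_span by blast
      then show ?thesis
        by (simp add: orthogonal_def Rep_symmat_inject [symmetric] Rep_symmat_simps)
    qed
    show "X \<bullet> u = 0" if "X = 0" for X u :: "'n symmat"
      using that by simp
  qed
qed

instantiation symmat :: (finite) euclidean_space
begin

definition "(Basis :: 'a symmat set) = (SOME B. B \<noteq> {} \<and> finite B \<and>
   (\<forall>u\<in>B. \<forall>v\<in>B. u \<bullet> v = (if u = v then 1 else 0)) \<and>
   (\<forall>X. (\<forall>u\<in>B. X \<bullet> u = 0) \<longleftrightarrow> X = 0))"

instance
proof
  note B = someI_ex [OF exists_orthonormal_basis_symmat, where 'n1 = 'a,
      folded Basis_symmat_def]
  show "(Basis :: 'a symmat set) \<noteq> {}"
    by (rule B [THEN conjunct1])
  show "finite (Basis :: 'a symmat set)"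
    by (rule B [THEN conjunct2, THEN conjunct1])
  show "u \<bullet> v = (if u = v then 1 else 0)" if "u \<in> Basis" "v \<in> Basis" for u v :: "'a symmat"
    by (rule B [THEN conjunct2, THEN conjunct2, THEN conjunct1, rule_format, OF that])
  show "(\<forall>u\<in>Basis. X \<bullet> u = 0) \<longleftrightarrow> X = 0" for X :: "'a symmat"
    by (rule B [THEN conjunct2, THEN conjunct2, THEN conjunct2, THEN spec])
qed

end

text \<open>
  The index type carries a linear order so that \<open>nonincreasing\<close> makes sense. Eigenvalues
  are repeated according to their multiplicity in the characteristic polynomial;
  since symmetric matrices have real spectrum, exactly one vector fits the description.
\<close>

definition eigvals :: "('n::{finite, linorder}) symmat \<Rightarrow> real ^ 'n::{finite, linorder}" where
  "eigvals X = (THE l. (\<forall>i j. i \<le> j \<longrightarrow> l $ j \<le> l $ i) \<and>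
     (\<forall>t. det (mat t - Rep_symmat X) = (\<Prod>i\<in>UNIV. t - l $ i)))"

definition symmetric_fun :: "(real ^ 'n::finite \<Rightarrow> 'b) \<Rightarrow> bool" where
  "symmetric_fun f \<longleftrightarrow> (\<forall>\<pi>. bij \<pi> \<longrightarrow> (\<forall>x. f (\<chi> i. x $ \<pi> i) = f x))"

definition symmetric_set :: "(real ^ 'n::finite) set \<Rightarrow> bool" where
  "symmetric_set S \<longleftrightarrow> (\<forall>\<pi>. bij \<pi> \<longrightarrow> (\<lambda>x. \<chi> i. x $ \<pi> i) ` S = S)"

text \<open>The set \<open>U\<close> is meant to be open.\<close>

primrec Ck_on :: "nat \<Rightarrow> ('a::euclidean_space \<Rightarrow> real) \<Rightarrow> 'a set \<Rightarrow> bool" where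
  "Ck_on 0 f U \<longleftrightarrow> continuous_on U f"
| "Ck_on (Suc k) f U \<longleftrightarrow> (\<forall>x\<in>U. f differentiable (at x)) \<and>
     (\<forall>v. Ck_on k (\<lambda>x. frechet_derivative f (at x) v) U)"

text \<open>
  Around each of its points, a \<open>C\<^sup>k\<close>-manifold of dimension \<open>r\<close> is the zero set of a \<open>C\<^sup>k\<close>
  map into \<open>\<real>\<^sup>m\<close>, \<open>m = DIM('a) - r\<close>, whose derivative is surjective. Since \<open>m\<close> is not a type,
  the map is given by its components \<open>F i\<close>, \<open>i < m\<close>.
\<close>

definition Ck_manifold :: "nat \<Rightarrow> 'a::euclidean_space set \<Rightarrow> bool" where
  "Ck_manifold k M \<longleftrightarrow> (\<exists>r m. r + m = DIM('a) \<and>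
     (\<forall>x\<in>M. \<exists>U (F :: nat \<Rightarrow> 'a \<Rightarrow> real). open U \<and> x \<in> U \<and>
        (\<forall>i<m. Ck_on k (F i) U) \<and>
        (\<forall>y\<in>U. \<forall>c. \<exists>h. \<forall>i<m. frechet_derivative (F i) (at y) h = c i) \<and>
        M \<inter> U = {y \<in> U. \<forall>i<m. F i y = 0}))"

definition Ck_restriction_near ::
    "nat \<Rightarrow> ('a::euclidean_space \<Rightarrow> ereal) \<Rightarrow> 'a set \<Rightarrow> 'a \<Rightarrow> bool" where
  "Ck_restriction_near k f M x \<longleftrightarrow>
     (\<exists>U g. open U \<and> x \<in> U \<and> Ck_on k g U \<and> (\<forall>y \<in> M \<inter> U. f y = ereal (g y)))"

definition locally_lipschitz_around :: "('a::euclidean_space \<Rightarrow> ereal) \<Rightarrow> 'a \<Rightarrow> bool" where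
  "locally_lipschitz_around f x \<longleftrightarrow>
     (\<exists>U L. open U \<and> x \<in> U \<and> (\<forall>y\<in>U. \<bar>f y\<bar> \<noteq> \<infinity>) \<and>
        L-lipschitz_on U (\<lambda>y. real_of_ereal (f y)))"

text \<open>Both cones are meant for base points \<open>x \<in> Q\<close>.\<close>

definition frechet_normal_cone :: "'a::euclidean_space set \<Rightarrow> 'a \<Rightarrow> 'a set" where
  "frechet_normal_cone Q x = {v. \<forall>\<epsilon>>0. \<exists>\<delta>>0. \<forall>y\<in>Q.
     norm (y - x) < \<delta> \<longrightarrow> v \<bullet> (y - x) \<le> \<epsilon> * norm (y - x)}"

definition limiting_normal_cone :: "'a::euclidean_space set \<Rightarrow> 'a \<Rightarrow> 'a set" where
  "limiting_normal_cone Q x = {v. \<exists>(xs :: nat \<Rightarrow> 'a) vs.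
     (\<forall>i. xs i \<in> Q \<and> vs i \<in> frechet_normal_cone Q (xs i)) \<and>
     xs \<longlonglongrightarrow> x \<and> vs \<longlonglongrightarrow> v}"

text \<open>With values in \<^typ>\<open>ennreal\<close>, the supremum is \<open>0\<close> if \<open>U\<close> has no unit vectors.\<close>

definition cone_gap :: "'a::euclidean_space set \<Rightarrow> 'a set \<Rightarrow> ennreal" where
  "cone_gap U V = (SUP u \<in> {u \<in> U. norm u = 1}. ennreal (infdist u V))"

definition reg_a :: "'a::euclidean_space set \<Rightarrow> 'a set \<Rightarrow> bool" where
  "reg_a X Y \<longleftrightarrow> (\<forall>(xs :: nat \<Rightarrow> 'a) vs. \<forall>y\<in>Y. \<forall>v.
     (\<forall>i. xs i \<in> X \<and> vs i \<in> limiting_normal_cone X (xs i)) \<and> xs \<longlonglongrightarrow> y \<and>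
     (\<exists>r. strict_mono r \<and> (vs \<circ> r) \<longlonglongrightarrow> v) \<longrightarrow> v \<in> limiting_normal_cone Y y)"

definition reg_b_le :: "'a::euclidean_space set \<Rightarrow> 'a set \<Rightarrow> bool" where
  "reg_b_le X Y \<longleftrightarrow> (\<exists>err :: real \<Rightarrow> real. ((\<lambda>t. err t / t) \<longlongrightarrow> 0) (at_right 0) \<and>
     (\<forall>x\<in>X. \<forall>y\<in>Y. \<forall>v \<in> limiting_normal_cone X x \<inter> cball 0 1.
        v \<bullet> (y - x) \<le> err (norm (y - x))))"

definition reg_b_ge :: "'a::euclidean_space set \<Rightarrow> 'a set \<Rightarrow> bool" where
  "reg_b_ge X Y \<longleftrightarrow> (\<exists>err :: real \<Rightarrow> real. ((\<lambda>t. err t / t) \<longlongrightarrow> 0) (at_right 0) \<and>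
     (\<forall>x\<in>X. \<forall>y\<in>Y. \<forall>v \<in> limiting_normal_cone X x \<inter> cball 0 1.
        v \<bullet> (y - x) \<ge> err (norm (y - x))))"

text \<open>
  An equality \<open>\<langle>v, y - x\<rangle> = o(\<parallel>y - x\<parallel>)\<close> bounds the absolute value; it does not say that the
  left-hand side is a function of \<open>\<parallel>y - x\<parallel>\<close>.
\<close>

definition reg_b_eq :: "'a::euclidean_space set \<Rightarrow> 'a set \<Rightarrow> bool" where
  "reg_b_eq X Y \<longleftrightarrow> (\<exists>err :: real \<Rightarrow> real. ((\<lambda>t. err t / t) \<longlongrightarrow> 0) (at_right 0) \<and>
     (\<forall>x\<in>X. \<forall>y\<in>Y. \<forall>v \<in> limiting_normal_cone X x \<inter> cball 0 1.
        \<bar>v \<bullet> (y - x)\<bar> \<le> err (norm (y - x))))"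

definition strong_reg_a :: "'a::euclidean_space set \<Rightarrow> 'a set \<Rightarrow> bool" where
  "strong_reg_a X Y \<longleftrightarrow> (\<exists>C>0. \<forall>x\<in>X. \<forall>y\<in>Y.
     cone_gap (limiting_normal_cone X x) (limiting_normal_cone Y y) \<le> ennreal (C * norm (x - y)))"

definition strong_reg_b_le :: "'a::euclidean_space set \<Rightarrow> 'a set \<Rightarrow> bool" where
  "strong_reg_b_le X Y \<longleftrightarrow> (\<exists>C>0. \<forall>x\<in>X. \<forall>y\<in>Y.
     \<forall>v \<in> limiting_normal_cone X x \<inter> cball 0 1. v \<bullet> (y - x) \<le> C * (norm (x - y))\<^sup>2)"

definition strong_reg_b_ge :: "'a::euclidean_space set \<Rightarrow> 'a set \<Rightarrow> bool" where
  "strong_reg_b_ge X Y \<longleftrightarrow> (\<exists>C>0. \<forall>x\<in>X. \<forall>y\<in>Y.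
     \<forall>v \<in> limiting_normal_cone X x \<inter> cball 0 1. v \<bullet> (y - x) \<ge> - C * (norm (x - y))\<^sup>2)"

definition strong_reg_b_eq :: "'a::euclidean_space set \<Rightarrow> 'a set \<Rightarrow> bool" where
  "strong_reg_b_eq X Y \<longleftrightarrow> (\<exists>C>0. \<forall>x\<in>X. \<forall>y\<in>Y.
     \<forall>v \<in> limiting_normal_cone X x \<inter> cball 0 1. \<bar>v \<bullet> (y - x)\<bar> \<le> C * (norm (x - y))\<^sup>2)"

definition holds_near ::
    "('a::euclidean_space set \<Rightarrow> 'a set \<Rightarrow> bool) \<Rightarrow> 'a set \<Rightarrow> 'a set \<Rightarrow> 'a \<Rightarrow> bool" where
  "holds_near P X Y z \<longleftrightarrow> (\<exists>U. open U \<and> z \<in> U \<and> P (X \<inter> U) (Y \<inter> U))"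

definition epi :: "('a \<Rightarrow> ereal) \<Rightarrow> ('a \<times> real) set" where
  "epi f = {(x, r). f x \<le> ereal r}"

text \<open>
  Points of \<open>M\<close> outside the domain of \<open>f\<close> do not contribute; for \<open>M\<close> contained in the domain
  this is the graph of the restriction of \<open>f\<close> to \<open>M\<close>.
\<close>

definition gph_on :: "('a \<Rightarrow> ereal) \<Rightarrow> 'a set \<Rightarrow> ('a \<times> real) set" where
  "gph_on f M = {(x, r). x \<in> M \<and> f x = ereal r}"

definition fun_regular ::
    "(('a \<times> real) set \<Rightarrow> ('a \<times> real) set \<Rightarrow> bool) \<Rightarrow>
     ('a::euclidean_space \<Rightarrow> ereal) \<Rightarrow> 'a set \<Rightarrow> 'a \<Rightarrow> bool" where
  "fun_regular P f M x \<longleftrightarrow> holds_near P (epi f) (gph_on f M) (x, real_of_ereal (f x))"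

end

theory Submission
  imports Defs
begin

text \<open>
  Write \<open>X = \<Sum>i. x\<^sub>i u\<^sub>i u\<^sub>i\<^sup>T\<close> and \<open>Y = \<Sum>j. y\<^sub>j w\<^sub>j w\<^sub>j\<^sup>T\<close> in orthonormal frames. Then
  \<open>\<parallel>X - Y\<parallel>\<^sup>2 = \<Sum>i j. (u\<^sub>i \<bullet> w\<^sub>j)\<^sup>2 (x\<^sub>i - y\<^sub>j)\<^sup>2\<close>, and likewise for the pairing of \<open>Y - X\<close> with a matrix
  diagonal in the frame \<open>u\<close>. The weights are doubly stochastic, so by the theorem of Birkhoff and von
  Neumann every linear or quadratic bound valid for all permutations of \<open>y\<close> passes to matrices.
  As a normal of a spectral set is diagonal in a frame that diagonalizes its base point, this
  transfers the conditions (b), their strong forms, and (a).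

  For strong (a), let \<open>v\<close> be normal to the graph \<open>G\<close> of \<open>f\<close> over \<open>M\<close> at a point over \<open>y\<close>. As \<open>G\<close> is a
  \<open>C\<^sup>2\<close>-manifold, \<open>\<langle>v, p - q\<rangle>\<close> is of second order for \<open>p\<close>, \<open>q\<close> in \<open>G\<close>. Taking for \<open>p\<close>, \<open>q\<close> a point and
  its image under a transposition bounds the divided differences of \<open>v\<close> with respect to \<open>y\<close>, except
  within blocks of coordinates that agree on all of \<open>G\<close> near the base point. Bounded divided
  differences make the diagonal matrix of \<open>v\<close> depend Lipschitz continuously on the frame; on the
  exceptional blocks the normal space contains all zero-sum vectors, which leaves enough
  freedom to choose a nearby normal.
\<close>

section \<open>Doubly stochastic matrices\<close>

text \<open>Where eigenvalues coincide, a frame cannot be chosen continuously. No step makes such a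
  choice: estimates hold for arbitrary pairs of frames, eigenvalues are matched by a permutation
  instead of being sorted, and limits of frames come from compactness of the orthogonal matrices.
  Averaging with doubly stochastic weights preserves only inequalities that are linear in the
  weights, and distances enter these through their squares. An error
  \<open>\<epsilon> * norm\<close> is therefore first replaced by a quadratic one, by the inequality
  of arithmetic and geometric means at the scale of the final distance. Permutations that carry a
  point far away obey no hypothesis at all; a large quadratic term pays for them. For strong (a),
  two nearby matrices differ in spectrum and in frame. The spectrum is changed first, with the frame
  kept, which is the situation of the hypothesis on vectors; then the frame is changed with the
  spectrum kept. The second move is where the smoothness of the graph enters: it excludes a
  Lipschitz constant that blows up as eigenvalues merge.\<close>

lemma hall_marriage:
  fixes N :: "'a \<Rightarrow> 'b set"
  assumes "finite A" "\<And>a. a \<in> A \<Longrightarrow> finite (N a)"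
    and "\<And>J. J \<subseteq> A \<Longrightarrow> card J \<le> card (\<Union> (N ` J))"
  shows "\<exists>g. inj_on g A \<and> (\<forall>a\<in>A. g a \<in> N a)"
  using assms
proof (induction "card A" arbitrary: A N rule: less_induct)
  case less
  show ?case
  proof (cases "A = {}")
    case False
    then obtain a where a: "a \<in> A" by blast
    \<comment> \<open>If some nonempty proper \<open>J\<close> has no neighbours to spare,
      \<open>J\<close> and its complement are matched separately, the latter outside the neighbours
      of \<open>J\<close>. Otherwise every such set has a spare neighbour, so \<open>a\<close> may
      take any \<open>b\<close>.\<close>
    show ?thesis
    proof (cases "\<exists>J. J \<subset> A \<and> J \<noteq> {} \<and> card (\<Union> (N ` J)) \<le> card J")
      case True
      then obtain J where J: "J \<subset> A" "J \<noteq> {}" "card (\<Union> (N ` J)) \<le> card J" by blast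
      have finJ: "finite J" "J \<subseteq> A" using J(1) less.prems(1) finite_subset by auto
      have finNJ: "finite (\<Union> (N ` J))" using finJ less.prems(2) by auto
      have "card J < card A" using J(1) less.prems(1) by (simp add: psubset_card_mono)
      then have "\<exists>g. inj_on g J \<and> (\<forall>a\<in>J. g a \<in> N a)"
        by (rule less.hyps) (use finJ less.prems in auto)
      then obtain g where g: "inj_on g J" "\<And>a. a \<in> J \<Longrightarrow> g a \<in> N a" by blast
      define N' where "N' = (\<lambda>a. N a - \<Union> (N ` J))"
      have "card (A - J) < card A"
        using J finJ less.prems(1) by (intro psubset_card_mono) auto
      then have "\<exists>h. inj_on h (A - J) \<and> (\<forall>a\<in>A - J. h a \<in> N' a)"
      proof (rule less.hyps)
        show "card K \<le> card (\<Union> (N' ` K))" if K: "K \<subseteq> A - J" for K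
        proof -
          have finK: "finite K" using K less.prems(1) finite_subset by fast
          have finNK: "finite (\<Union> (N' ` K))" unfolding N'_def using K finK less.prems(2) by auto
          have "card K + card J = card (K \<union> J)"
            using K finK finJ by (subst card_Un_disjoint) auto
          also have "\<dots> \<le> card (\<Union> (N ` (K \<union> J)))"
            using K finJ by (intro less.prems(3)) auto
          also have "\<Union> (N ` (K \<union> J)) = \<Union> (N' ` K) \<union> \<Union> (N ` J)"
            unfolding N'_def by auto
          also have "card \<dots> \<le> card (\<Union> (N' ` K)) + card (\<Union> (N ` J))" by (rule card_Un_le)
          finally show ?thesis using J(3) by linarith
        qed
      qed (use less.prems in \<open>auto simp: N'_def\<close>)
      then obtain h where h: "inj_on h (A - J)" "\<And>a. a \<in> A - J \<Longrightarrow> h a \<in> N' a" by blast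
      define k where "k = (\<lambda>a. if a \<in> J then g a else h a)"
      have "inj_on k A"
      proof (rule inj_onI)
        fix x y assume xy: "x \<in> A" "y \<in> A" "k x = k y"
        have "g a \<noteq> h c" if "a \<in> J" "c \<in> A - J" for a c
          using g(2) [OF that(1)] h(2) [OF that(2)] that(1) unfolding N'_def by auto
        then show "x = y"
          using xy inj_onD [OF g(1), of x y] inj_onD [OF h(1), of x y]
          unfolding k_def by (auto split: if_splits) (metis Diff_iff)+
      qed
      moreover have "\<forall>a\<in>A. k a \<in> N a"
        using g(2) h(2) unfolding k_def N'_def by auto
      ultimately show ?thesis by blast
    next
      case False
      have "card {a} \<le> card (N a)" using less.prems(3) [of "{a}"] a by simp
      then obtain b where b: "b \<in> N a" by fastforce
      define N' where "N' = (\<lambda>c. N c - {b})"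
      have "card (A - {a}) < card A"
        using a less.prems(1) by (intro psubset_card_mono) auto
      then have "\<exists>h. inj_on h (A - {a}) \<and> (\<forall>c\<in>A - {a}. h c \<in> N' c)"
      proof (rule less.hyps)
        show "card K \<le> card (\<Union> (N' ` K))" if K: "K \<subseteq> A - {a}" for K
        proof (cases "K = {}")
          case nonempty: False
          have finK: "finite K" using K less.prems(1) finite_subset by fast
          have finNK: "finite (\<Union> (N ` K))" using K finK less.prems(2) by auto
          have "K \<subset> A" using K a by blast
          then have "card K < card (\<Union> (N ` K))" using False nonempty by (meson not_le)
          moreover have "\<Union> (N' ` K) = \<Union> (N ` K) - {b}" unfolding N'_def by auto
          moreover have "card (\<Union> (N ` K)) \<le> card (\<Union> (N ` K) - {b}) + 1"
            using diff_card_le_card_Diff [of "{b}" "\<Union> (N ` K)"] by simp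
          ultimately show ?thesis by simp
        qed simp
      qed (use less.prems in \<open>auto simp: N'_def\<close>)
      then obtain h where h: "inj_on h (A - {a})" "\<And>c. c \<in> A - {a} \<Longrightarrow> h c \<in> N' c" by blast
      define k where "k = h(a := b)"
      have "inj_on k A"
      proof (rule inj_onI)
        fix x y assume xy: "x \<in> A" "y \<in> A" "k x = k y"
        show "x = y"
          using xy inj_onD [OF h(1), of x y] h(2)
          unfolding k_def N'_def by (auto split: if_splits)
      qed
      moreover have "\<forall>c\<in>A. k c \<in> N c"
        using b h(2) unfolding k_def N'_def by auto
      ultimately show ?thesis by blast
    qed
  qed simp
qed

text \<open>Counting mass twice verifies Hall's condition: the rows in \<open>J\<close> carry mass
  \<open>\<sigma> * card J\<close>, all of it in columns where these rows have positive entries, and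
  each column holds only \<open>\<sigma>\<close>.\<close>

lemma positive_permutation:
  fixes S :: "'n::finite \<Rightarrow> 'n \<Rightarrow> real"
  assumes nonneg: "\<And>i j. 0 \<le> S i j" and "0 < \<sigma>"
    and row: "\<And>i. (\<Sum>j\<in>UNIV. S i j) = \<sigma>" and col: "\<And>j. (\<Sum>i\<in>UNIV. S i j) = \<sigma>"
  shows "\<exists>\<pi>. bij \<pi> \<and> (\<forall>i. 0 < S i (\<pi> i))"
proof -
  define N where "N = (\<lambda>i. {j. 0 < S i j})"
  have "card J \<le> card (\<Union> (N ` J))" for J
  proof -
    have zero: "S i j = 0" if "i \<in> J" "j \<notin> \<Union> (N ` J)" for i j
      using that nonneg [of i j] unfolding N_def by force
    have "\<sigma> * card J = (\<Sum>i\<in>J. \<Sum>j\<in>UNIV. S i j)" by (simp add: row)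
    also have "\<dots> = (\<Sum>i\<in>J. \<Sum>j\<in>\<Union> (N ` J). S i j)"
      by (intro sum.cong refl sum.mono_neutral_right) (use zero in auto)
    also have "\<dots> = (\<Sum>j\<in>\<Union> (N ` J). \<Sum>i\<in>J. S i j)" by (rule sum.swap)
    also have "\<dots> \<le> (\<Sum>j\<in>\<Union> (N ` J). \<Sum>i\<in>UNIV. S i j)"
      by (intro sum_mono sum_mono2) (use nonneg in auto)
    also have "\<dots> = \<sigma> * card (\<Union> (N ` J))" by (simp add: col)
    finally show ?thesis using \<open>0 < \<sigma>\<close> by simp
  qed
  then obtain \<pi> where "inj \<pi>" "\<And>i. \<pi> i \<in> N i"
    using hall_marriage [of UNIV N] by auto
  then have "bij \<pi> \<and> (\<forall>i. 0 < S i (\<pi> i))"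
    using finite_UNIV_inj_surj [of \<pi>] by (auto simp: bij_def N_def)
  then show ?thesis by blast
qed

text \<open>Birkhoff's theorem as an inequality: multiples of permutation matrices are split off
  until nothing is left. The free total \<open>\<sigma>\<close> keeps the remainder within the scope
  of the induction, which runs over the number of nonzero entries.\<close>

lemma doubly_stochastic_ge:
  fixes S c :: "'n::finite \<Rightarrow> 'n \<Rightarrow> real"
  assumes nonneg: "\<And>i j. 0 \<le> S i j"
    and row: "\<And>i. (\<Sum>j\<in>UNIV. S i j) = \<sigma>" and col: "\<And>j. (\<Sum>i\<in>UNIV. S i j) = \<sigma>"
    and perm: "\<And>\<pi>. bij \<pi> \<Longrightarrow> \<alpha> \<le> (\<Sum>i\<in>UNIV. c i (\<pi> i))"
  shows "\<sigma> * \<alpha> \<le> (\<Sum>i\<in>UNIV. \<Sum>j\<in>UNIV. S i j * c i j)"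
  using nonneg row col
proof (induction "card {p. S (fst p) (snd p) \<noteq> 0}" arbitrary: S \<sigma> rule: less_induct)
  case less
  have "0 \<le> \<sigma>"
    using less.prems(1) less.prems(2) [of undefined] sum_nonneg [of UNIV "S undefined"] by simp
  show ?case
  proof (cases "\<sigma> = 0")
    case True
    then have "S i j = 0" for i j
      using less.prems(1) less.prems(2) [of i] sum_nonneg_eq_0_iff [of UNIV "S i"] by simp
    then show ?thesis using True by simp
  next
    case False
    with \<open>0 \<le> \<sigma>\<close> have "0 < \<sigma>" by simp
    obtain \<pi> where \<pi>: "bij \<pi>" "\<And>i. 0 < S i (\<pi> i)"
      using positive_permutation [OF less.prems(1) \<open>0 < \<sigma>\<close> less.prems(2,3)] by blast
    \<comment> \<open>The largest multiple of the permutation matrix that leaves all entries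
      nonnegative; it makes the entry at \<open>k\<close> vanish.\<close>
    define e where "e = Min (range (\<lambda>i. S i (\<pi> i)))"
    have e_le: "e \<le> S i (\<pi> i)" for i unfolding e_def by (intro Min_le) auto
    have "e \<in> range (\<lambda>i. S i (\<pi> i))" unfolding e_def by (intro Min_in) auto
    then obtain k where k: "e = S k (\<pi> k)" by blast
    then have "0 < e" using \<pi> by simp
    define S' where "S' = (\<lambda>i j. S i j - (if j = \<pi> i then e else 0))"
    have "card {p. S' (fst p) (snd p) \<noteq> 0} < card {p. S (fst p) (snd p) \<noteq> 0}"
    proof (intro psubset_card_mono psubsetI)
      show "{p. S' (fst p) (snd p) \<noteq> 0} \<subseteq> {p. S (fst p) (snd p) \<noteq> 0}"
      proof
        fix p assume "p \<in> {p. S' (fst p) (snd p) \<noteq> 0}"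
        then show "p \<in> {p. S (fst p) (snd p) \<noteq> 0}"
          using \<pi>(2) [of "fst p"] unfolding S'_def by (auto split: if_splits)
      qed
      have "S' k (\<pi> k) = 0" "S k (\<pi> k) \<noteq> 0" using \<pi>(2) [of k] k unfolding S'_def by auto
      then have "(k, \<pi> k) \<in> {p. S (fst p) (snd p) \<noteq> 0} - {p. S' (fst p) (snd p) \<noteq> 0}" by simp
      then show "{p. S' (fst p) (snd p) \<noteq> 0} \<noteq> {p. S (fst p) (snd p) \<noteq> 0}" by blast
    qed simp
    then have "(\<sigma> - e) * \<alpha> \<le> (\<Sum>i\<in>UNIV. \<Sum>j\<in>UNIV. S' i j * c i j)"
    proof (rule less.hyps)
      show "0 \<le> S' i j" for i j using less.prems(1) e_le unfolding S'_def by auto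
      show "(\<Sum>j\<in>UNIV. S' i j) = \<sigma> - e" for i
        unfolding S'_def by (simp add: sum_subtractf less.prems(2))
      show "(\<Sum>i\<in>UNIV. S' i j) = \<sigma> - e" for j
      proof -
        have "(\<Sum>i\<in>UNIV. if j = \<pi> i then e else 0) = (\<Sum>i\<in>UNIV. if j = i then e else 0)"
          using sum.reindex_bij_betw [OF \<pi>(1), of "\<lambda>i. if j = i then e else 0"] by simp
        then show ?thesis unfolding S'_def by (simp add: sum_subtractf less.prems(3))
      qed
    qed
    moreover have "(\<Sum>i\<in>UNIV. \<Sum>j\<in>UNIV. S' i j * c i j)
        = (\<Sum>i\<in>UNIV. \<Sum>j\<in>UNIV. S i j * c i j) - e * (\<Sum>i\<in>UNIV. c i (\<pi> i))"
    proof -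
      have "(\<Sum>j\<in>UNIV. S' i j * c i j) = (\<Sum>j\<in>UNIV. S i j * c i j) - e * c i (\<pi> i)" for i
        unfolding S'_def by (simp add: left_diff_distrib sum_subtractf if_distrib [of "\<lambda>x. x * _"] cong: if_cong)
      then show ?thesis by (simp add: sum_subtractf sum_distrib_left)
    qed
    moreover have "e * \<alpha> \<le> e * (\<Sum>i\<in>UNIV. c i (\<pi> i))"
      using perm [OF \<pi>(1)] \<open>0 < e\<close> by simp
    ultimately show ?thesis by (simp add: left_diff_distrib)
  qed
qed

section \<open>Diagonal matrices in orthonormal frames\<close>

lemma inner_symmat: "X \<bullet> Y = Rep_symmat X \<bullet> Rep_symmat Y"
  by (simp add: inner_symmat_def trace_mult_symmat)

lemma symmat_eqI: "(\<And>a b. Rep_symmat X $ a $ b = Rep_symmat Y $ a $ b) \<Longrightarrow> X = Y"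
  by (simp add: Rep_symmat_inject [symmetric] vec_eq_iff)

text \<open>The frame consists of the rows of \<open>U\<close>, so this is the transpose of
  \<open>U\<close> times the diagonal matrix of \<open>x\<close> times \<open>U\<close>.
  Orthogonality is not built in, so continuity in \<open>U\<close> makes sense on the whole matrix
  space.\<close>

definition spec :: "real ^ 'n::finite ^ 'n \<Rightarrow> real ^ 'n \<Rightarrow> 'n symmat" where
  "spec U x = Abs_symmat (\<chi> a b. \<Sum>i\<in>UNIV. x $ i * (U $ i $ a * U $ i $ b))"

lemma Rep_spec: "Rep_symmat (spec U x) = (\<chi> a b. \<Sum>i\<in>UNIV. x $ i * (U $ i $ a * U $ i $ b))"
  unfolding spec_def
  by (rule Abs_symmat_inverse) (simp add: transpose_def vec_eq_iff mult.commute)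

lemma spec_add: "spec U (x + y) = spec U x + spec U y"
  and spec_diff: "spec U (x - y) = spec U x - spec U y"
  and spec_zero: "spec U 0 = 0"
  by (rule symmat_eqI; simp add: Rep_spec Rep_symmat_simps algebra_simps sum.distrib sum_subtractf)+

text \<open>With \<open>u\<close> and \<open>w\<close> from an orthonormal frame, these are the
  entries of \<open>V\<close> in that frame.\<close>

definition qform :: "'n::finite symmat \<Rightarrow> real ^ 'n \<Rightarrow> real ^ 'n \<Rightarrow> real" where
  "qform V u w = u \<bullet> (Rep_symmat V *v w)"

lemma sum_swap3:
  "(\<Sum>a\<in>A. \<Sum>b\<in>B. \<Sum>i\<in>I. f a b i) = (\<Sum>i\<in>I. \<Sum>a\<in>A. \<Sum>b\<in>B. f a b i)"
  by (simp only: sum.swap [of _ I B] sum.swap [of _ I A])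

lemma qform_sum: "qform V u w = (\<Sum>a\<in>UNIV. \<Sum>b\<in>UNIV. Rep_symmat V $ a $ b * (u $ a * w $ b))"
  unfolding qform_def inner_vec_def matrix_vector_mult_def
  by (simp add: sum_distrib_left ac_simps)

lemma qform_commute: "qform V u w = qform V w u"
proof -
  have "Rep_symmat V $ a $ b = Rep_symmat V $ b $ a" for a b
    using transpose_Rep_symmat [of V] by (simp add: transpose_def vec_eq_iff)
  then show ?thesis
    unfolding qform_sum by (subst sum.swap) (simp add: ac_simps)
qed

lemma qform_spec: "qform (spec W y) u v = (\<Sum>j\<in>UNIV. y $ j * ((W $ j \<bullet> u) * (W $ j \<bullet> v)))"
proof -
  have "qform (spec W y) u v
      = (\<Sum>a\<in>UNIV. \<Sum>b\<in>UNIV. \<Sum>j\<in>UNIV. y $ j * ((W $ j $ a * u $ a) * (W $ j $ b * v $ b)))"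
    unfolding qform_sum Rep_spec by (simp add: sum_distrib_left sum_distrib_right ac_simps)
  also have "\<dots> = (\<Sum>j\<in>UNIV. \<Sum>a\<in>UNIV. \<Sum>b\<in>UNIV. y $ j * ((W $ j $ a * u $ a) * (W $ j $ b * v $ b)))"
    by (rule sum_swap3)
  finally show ?thesis
    by (simp add: inner_vec_def flip: sum_distrib_left sum_distrib_right)
qed

lemma inner_spec: "spec U x \<bullet> V = (\<Sum>i\<in>UNIV. x $ i * qform V (U $ i) (U $ i))"
proof -
  have "spec U x \<bullet> V
      = (\<Sum>a\<in>UNIV. \<Sum>b\<in>UNIV. \<Sum>i\<in>UNIV. x $ i * (Rep_symmat V $ a $ b * (U $ i $ a * U $ i $ b)))"
    unfolding inner_symmat Rep_spec
    by (simp add: inner_vec_def sum_distrib_left sum_distrib_right ac_simps)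
  also have "\<dots> = (\<Sum>i\<in>UNIV. \<Sum>a\<in>UNIV. \<Sum>b\<in>UNIV. x $ i * (Rep_symmat V $ a $ b * (U $ i $ a * U $ i $ b)))"
    by (rule sum_swap3)
  finally show ?thesis
    by (simp add: qform_sum sum_distrib_left)
qed

lemma inner_spec_spec:
  "spec U x \<bullet> spec W y = (\<Sum>i\<in>UNIV. \<Sum>j\<in>UNIV. (U $ i \<bullet> W $ j)\<^sup>2 * (x $ i * y $ j))"
  unfolding inner_spec qform_spec
  by (simp add: sum_distrib_left inner_commute power2_eq_square ac_simps)

lemma orthogonal_matrix_row_inner:
  fixes U :: "real ^ 'n ^ 'n::finite"
  assumes "orthogonal_matrix U"
  shows "U $ i \<bullet> U $ j = (if i = j then 1 else 0)"
  using assms unfolding orthogonal_matrix_orthonormal_rows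
  by (auto simp: row_def vec_nth_inverse orthogonal_def norm_eq_1)

lemma orthogonal_matrixI:
  fixes U :: "real ^ 'n ^ 'n::finite"
  assumes "\<And>i j. U $ i \<bullet> U $ j = (if i = j then 1 else 0)"
  shows "orthogonal_matrix U"
  using assms unfolding orthogonal_matrix_orthonormal_rows
  by (auto simp: row_def vec_nth_inverse orthogonal_def norm_eq_1)

lemma parseval:
  fixes U :: "real ^ 'n ^ 'n::finite"
  assumes "orthogonal_matrix U"
  shows "(\<Sum>j\<in>UNIV. (U $ j \<bullet> u) * (U $ j \<bullet> v)) = u \<bullet> v"
proof -
  have "orthogonal_transformation ((*v) U)"
    unfolding orthogonal_transformation_matrix using assms by simp
  then have "(U *v u) \<bullet> (U *v v) = u \<bullet> v"
    by (simp add: orthogonal_transformation_def)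
  then show ?thesis
    by (simp add: inner_vec_def matrix_vector_mult_def)
qed

lemma sum_row_squares:
  fixes U W :: "real ^ 'n ^ 'n::finite"
  assumes "orthogonal_matrix U" "orthogonal_matrix W"
  shows "(\<Sum>j\<in>UNIV. (U $ i \<bullet> W $ j)\<^sup>2) = 1" and "(\<Sum>i\<in>UNIV. (U $ i \<bullet> W $ j)\<^sup>2) = 1"
proof -
  show "(\<Sum>j\<in>UNIV. (U $ i \<bullet> W $ j)\<^sup>2) = 1"
    using parseval [OF assms(2), of "U $ i" "U $ i"] orthogonal_matrix_row_inner [OF assms(1), of i i]
    by (simp add: power2_eq_square inner_commute)
  show "(\<Sum>i\<in>UNIV. (U $ i \<bullet> W $ j)\<^sup>2) = 1"
    using parseval [OF assms(1), of "W $ j" "W $ j"] orthogonal_matrix_row_inner [OF assms(2), of j j]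
    by (simp add: power2_eq_square)
qed

text \<open>After expanding the squares, the row and column sums of the weights are 1, so the pure
  squares add up to the squared norms of the two matrices; the mixed term is
  \<open>inner_spec_spec\<close>.\<close>

lemma norm_spec_diff:
  assumes U: "orthogonal_matrix U" and W: "orthogonal_matrix W"
  shows "(norm (spec U x - spec W y))\<^sup>2
    = (\<Sum>i\<in>UNIV. \<Sum>j\<in>UNIV. (U $ i \<bullet> W $ j)\<^sup>2 * (x $ i - y $ j)\<^sup>2)"
proof -
  have same: "spec U x \<bullet> spec U x = (\<Sum>i\<in>UNIV. (x $ i)\<^sup>2)" if "orthogonal_matrix U" for U :: "real ^ 'n ^ 'n" and x
  proof -
    have "(\<Sum>j\<in>UNIV. (U $ i \<bullet> U $ j)\<^sup>2 * (x $ i * x $ j)) = (x $ i)\<^sup>2" for i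
      by (simp add: orthogonal_matrix_row_inner [OF that] if_distrib [of power2] if_distrib [of "\<lambda>t. t * _"] power2_eq_square cong: if_cong)
    then show ?thesis by (simp add: inner_spec_spec)
  qed
  have "(\<Sum>i\<in>UNIV. \<Sum>j\<in>UNIV. (U $ i \<bullet> W $ j)\<^sup>2 * (x $ i - y $ j)\<^sup>2)
      = (\<Sum>i\<in>UNIV. \<Sum>j\<in>UNIV. (U $ i \<bullet> W $ j)\<^sup>2 * (x $ i)\<^sup>2)
        + (\<Sum>i\<in>UNIV. \<Sum>j\<in>UNIV. (U $ i \<bullet> W $ j)\<^sup>2 * (y $ j)\<^sup>2) - 2 * (spec U x \<bullet> spec W y)"
    unfolding inner_spec_spec sum_distrib_left
    by (simp add: power2_diff algebra_simps sum.distrib sum_subtractf)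
  also have "(\<Sum>i\<in>UNIV. \<Sum>j\<in>UNIV. (U $ i \<bullet> W $ j)\<^sup>2 * (x $ i)\<^sup>2) = spec U x \<bullet> spec U x"
    by (simp add: same [OF U] sum_row_squares(1) [OF U W] flip: sum_distrib_right)
  also have "(\<Sum>i\<in>UNIV. \<Sum>j\<in>UNIV. (U $ i \<bullet> W $ j)\<^sup>2 * (y $ j)\<^sup>2) = spec W y \<bullet> spec W y"
    by (subst sum.swap) (simp add: same [OF W] sum_row_squares(2) [OF U W] flip: sum_distrib_right)
  finally show ?thesis
    unfolding power2_norm_eq_inner by (simp add: inner_diff inner_commute)
qed

lemma inner_spec_same:
  assumes "orthogonal_matrix U"
  shows "spec U x \<bullet> spec U y = x \<bullet> y"
proof -
  have "(\<Sum>j\<in>UNIV. (U $ i \<bullet> U $ j)\<^sup>2 * (x $ i * y $ j)) = x $ i * y $ i" for i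
    by (simp add: orthogonal_matrix_row_inner [OF assms] if_distrib [of power2] if_distrib [of "\<lambda>t. t * _"] cong: if_cong)
  then show ?thesis by (simp add: inner_spec_spec inner_vec_def)
qed

lemma norm_spec: "orthogonal_matrix U \<Longrightarrow> norm (spec U x) = norm x"
  by (simp add: norm_eq_sqrt_inner inner_spec_same)

lemma symmat_eq_qformI:
  assumes "\<And>u w. qform V u w = qform V' u w"
  shows "V = V'"
proof (rule symmat_eqI)
  have "Rep_symmat V $ a $ b = qform V (axis a 1) (axis b 1)" for V :: "'a symmat" and a b
    by (simp add: qform_def inner_axis' matrix_vector_mul_component inner_axis)
  then show "Rep_symmat V $ a $ b = Rep_symmat V' $ a $ b" for a b
    using assms by simp
qed

lemma qform_expand:
  assumes "orthogonal_matrix U"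
  shows "qform V u w = (\<Sum>i\<in>UNIV. (U $ i \<bullet> u) * qform V (U $ i) w)"
  unfolding qform_def using parseval [OF assms, of u "Rep_symmat V *v w"] by simp

lemma spec_of_offdiag_zero:
  assumes U: "orthogonal_matrix U" and off: "\<And>i j. i \<noteq> j \<Longrightarrow> qform V (U $ i) (U $ j) = 0"
  shows "V = spec U (\<chi> i. qform V (U $ i) (U $ i))"
proof (rule symmat_eq_qformI)
  fix u w
  have "qform V (U $ i) w = (U $ i \<bullet> w) * qform V (U $ i) (U $ i)" for i
  proof -
    have "qform V (U $ i) w = (\<Sum>j\<in>UNIV. (U $ j \<bullet> w) * qform V (U $ j) (U $ i))"
      by (subst qform_commute) (rule qform_expand [OF U])
    also have "\<dots> = (\<Sum>j\<in>UNIV. if j = i then (U $ i \<bullet> w) * qform V (U $ i) (U $ i) else 0)"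
      by (intro sum.cong refl) (auto simp: off)
    finally show ?thesis by simp
  qed
  then show "qform V u w = qform (spec U (\<chi> i. qform V (U $ i) (U $ i))) u w"
    unfolding qform_spec by (subst qform_expand [OF U]) (simp add: ac_simps)
qed

lemma qform_spec_same:
  "orthogonal_matrix U \<Longrightarrow> qform (spec U x) (U $ i) (U $ j) = (if i = j then x $ i else 0)"
  by (simp add: qform_spec orthogonal_matrix_row_inner if_distrib [of "\<lambda>t. _ * t"] cong: if_cong)

lemma qform_diff: "qform (V - V') u w = qform V u w - qform V' u w"
  by (simp add: qform_def Rep_symmat_simps matrix_vector_mult_diff_rdistrib inner_diff_right)

lemma abs_row_inner_le_1:
  fixes U W :: "real ^ 'n::finite ^ 'n"
  assumes "orthogonal_matrix U" "orthogonal_matrix W"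
  shows "\<bar>U $ i \<bullet> W $ j\<bar> \<le> 1"
  using Cauchy_Schwarz_ineq2 [of "U $ i" "W $ j"] orthogonal_matrix_row_inner [OF assms(1), of i i]
    orthogonal_matrix_row_inner [OF assms(2), of j j]
  by (simp add: norm_eq_sqrt_inner)

section \<open>Lifts and their quadratic estimates\<close>

definition lift :: "real ^ 'n::finite ^ 'n \<Rightarrow> (real ^ 'n) \<times> real \<Rightarrow> 'n symmat \<times> real" where
  "lift U p = (spec U (fst p), snd p)"

definition permute :: "('n \<Rightarrow> 'n) \<Rightarrow> (real ^ 'n::finite) \<times> real \<Rightarrow> (real ^ 'n) \<times> real" where
  "permute \<pi> p = ((\<chi> i. fst p $ \<pi> i), snd p)"

lemma lift_diff: "lift U (p - q) = lift U p - lift U q"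
  by (simp add: lift_def spec_diff)

lemma inner_lift_same: "orthogonal_matrix U \<Longrightarrow> lift U p \<bullet> lift U q = p \<bullet> q"
  by (cases p; cases q) (simp add: lift_def inner_spec_same)

lemma norm_lift: "orthogonal_matrix U \<Longrightarrow> norm (lift U p) = norm p"
  by (simp add: norm_eq_sqrt_inner inner_lift_same)

lemma norm_lift_diff_same: "orthogonal_matrix U \<Longrightarrow> norm (lift U p - lift U q) = norm (p - q)"
  by (simp add: norm_lift flip: lift_diff)

text \<open>
  The squares of the entries of an orthogonal matrix are doubly stochastic, and both sides of the
  bound are linear in them.
\<close>

lemma lift_quadratic_bound:
  fixes U W :: "real ^ 'n::finite ^ 'n"
  assumes U: "orthogonal_matrix U" and W: "orthogonal_matrix W"
    and perm: "\<And>\<pi>. bij \<pi> \<Longrightarrow>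
      v \<bullet> (permute \<pi> y - x) \<le> \<alpha> + \<gamma> * (norm (permute \<pi> y - x))\<^sup>2"
  shows "lift U v \<bullet> (lift W y - lift U x) \<le> \<alpha> + \<gamma> * (norm (lift W y - lift U x))\<^sup>2"
proof -
  obtain v1 v2 x1 x2 y1 y2 where [simp]: "v = (v1, v2)" "x = (x1, x2)" "y = (y1, y2)"
    by (cases v; cases x; cases y) auto
  define S where "S = (\<lambda>i j. (U $ i \<bullet> W $ j)\<^sup>2)"
  \<comment> \<open>Summed along a permutation, \<open>c\<close> gives the part of the inequality
    that depends on the vectors; averaged with \<open>S\<close>, it gives the same expression for
    the matrices. The heights and \<open>\<alpha>\<close>, common to both, go into
    \<open>\<beta>\<close>.\<close>
  define c where "c = (\<lambda>i j. \<gamma> * (x1 $ i - y1 $ j)\<^sup>2 - v1 $ i * (y1 $ j - x1 $ i))"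
  define \<beta> where "\<beta> = v2 * (y2 - x2) - \<alpha> - \<gamma> * (y2 - x2)\<^sup>2"
  have "1 * \<beta> \<le> (\<Sum>i\<in>UNIV. \<Sum>j\<in>UNIV. S i j * c i j)"
  proof (rule doubly_stochastic_ge)
    show "\<beta> \<le> (\<Sum>i\<in>UNIV. c i (\<pi> i))" if "bij \<pi>" for \<pi>
    proof -
      let ?q = "\<chi> i. y1 $ \<pi> i"
      have "(\<Sum>i\<in>UNIV. c i (\<pi> i)) = \<gamma> * (norm (?q - x1))\<^sup>2 - v1 \<bullet> (?q - x1)"
        unfolding power2_norm_eq_inner
        by (simp add: c_def inner_vec_def sum_subtractf sum.distrib sum_distrib_left power2_eq_square algebra_simps)
      moreover have "(norm (permute \<pi> y - x))\<^sup>2 = (norm (?q - x1))\<^sup>2 + (y2 - x2)\<^sup>2"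
        by (simp add: permute_def norm_Pair)
      moreover have "v \<bullet> (permute \<pi> y - x) = v1 \<bullet> (?q - x1) + v2 * (y2 - x2)"
        by (simp add: permute_def)
      ultimately show ?thesis
        using perm [OF that] unfolding \<beta>_def by (simp add: distrib_left)
    qed
  qed (simp_all add: S_def sum_row_squares [OF U W])
  also have "(\<Sum>i\<in>UNIV. \<Sum>j\<in>UNIV. S i j * c i j)
      = \<gamma> * (norm (spec U x1 - spec W y1))\<^sup>2 - (\<Sum>i\<in>UNIV. \<Sum>j\<in>UNIV. S i j * (v1 $ i * (y1 $ j - x1 $ i)))"
    unfolding norm_spec_diff [OF U W] S_def c_def
    by (simp add: algebra_simps sum_subtractf sum.distrib sum_distrib_left)
  also have "(\<Sum>i\<in>UNIV. \<Sum>j\<in>UNIV. S i j * (v1 $ i * (y1 $ j - x1 $ i)))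
      = spec U v1 \<bullet> (spec W y1 - spec U x1)"
  proof -
    have "(\<Sum>i\<in>UNIV. \<Sum>j\<in>UNIV. S i j * (v1 $ i * x1 $ i)) = v1 \<bullet> x1"
      by (simp add: S_def sum_row_squares(1) [OF U W] inner_vec_def [of v1] flip: sum_distrib_right)
    then show ?thesis
      by (simp add: inner_diff_right inner_spec_same [OF U] inner_spec_spec [of U v1 W] S_def
          right_diff_distrib sum_subtractf)
  qed
  finally have "\<beta> \<le> \<gamma> * (norm (spec W y1 - spec U x1))\<^sup>2 - spec U v1 \<bullet> (spec W y1 - spec U x1)"
    by (simp add: norm_minus_commute)
  moreover have "(norm (lift W y - lift U x))\<^sup>2 = (norm (spec W y1 - spec U x1))\<^sup>2 + (y2 - x2)\<^sup>2"
    by (simp add: lift_def norm_Pair)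
  moreover have "lift U v \<bullet> (lift W y - lift U x) = spec U v1 \<bullet> (spec W y1 - spec U x1) + v2 * (y2 - x2)"
    by (simp add: lift_def)
  ultimately show ?thesis
    unfolding \<beta>_def by (simp add: distrib_left)
qed

text \<open>An inequality of Hoffman-Wielandt type: the squared distance of the matrices is a doubly
  stochastic average, hence at least the minimum over permutations. This is the quadratic bound with
  \<open>v = 0\<close> and \<open>\<alpha>\<close> minus that minimum.\<close>

lemma matching_permutation:
  fixes U W :: "real ^ 'n::finite ^ 'n"
  assumes "orthogonal_matrix U" "orthogonal_matrix W"
  obtains \<pi> where "bij \<pi>" "norm (permute \<pi> y - x) \<le> norm (lift W y - lift U x)"
proof -
  let ?T = "norm (lift W y - lift U x)"
  let ?P = "(\<lambda>\<pi>. (norm (permute \<pi> y - x))\<^sup>2) ` {\<pi>. bij \<pi>}"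
  have fin: "finite ?P" by simp
  have "id \<in> {\<pi> :: 'n \<Rightarrow> 'n. bij \<pi>}" by simp
  then have ne: "?P \<noteq> {}" by blast
  have "0 \<bullet> (permute \<pi> y - x) \<le> - Min ?P + 1 * (norm (permute \<pi> y - x))\<^sup>2" if "bij \<pi>" for \<pi>
    using Min_le [OF fin] that by simp
  from lift_quadratic_bound [OF assms, of 0, OF this]
  have "Min ?P \<le> ?T\<^sup>2" by (simp add: lift_def spec_zero inner_zero_left flip: zero_prod_def)
  moreover obtain \<pi> where "bij \<pi>" "Min ?P = (norm (permute \<pi> y - x))\<^sup>2"
    using Min_in [OF fin ne] by blast
  ultimately show thesis
    using that by (simp add: power2_le_iff_abs_le)
qed

text \<open>Quadratic terms repair both defects of the hypothesis: its first-order error is not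
  linear in the weights, and distant permutations are not covered. All conditions (b) and the
  lifting of Frechet normals rest on this bound.\<close>

lemma permuted_near_bound:
  fixes U W :: "real ^ 'n::finite ^ 'n"
  assumes U: "orthogonal_matrix U" and W: "orthogonal_matrix W"
    and "0 < \<delta>" "0 \<le> \<epsilon>" "0 \<le> C" "norm v \<le> K"
    and near: "\<And>\<pi>. bij \<pi> \<Longrightarrow> norm (permute \<pi> y - x) < \<delta> \<Longrightarrow>
      v \<bullet> (permute \<pi> y - x) \<le> \<epsilon> * norm (permute \<pi> y - x) + C * (norm (permute \<pi> y - x))\<^sup>2"
  defines "T \<equiv> norm (lift W y - lift U x)"
  shows "lift U v \<bullet> (lift W y - lift U x) \<le> \<epsilon> * T + (C + K / \<delta>) * T\<^sup>2"
proof (cases "T = 0")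
  case True
  then show ?thesis unfolding T_def by simp
next
  case False
  then have "0 < T" unfolding T_def by simp
  have "0 \<le> K" using \<open>norm v \<le> K\<close> norm_ge_zero [of v] by linarith
  have "v \<bullet> (permute \<pi> y - x) \<le> \<epsilon> * T / 2 + (\<epsilon> / (2 * T) + C + K / \<delta>) * (norm (permute \<pi> y - x))\<^sup>2"
    if "bij \<pi>" for \<pi>
  proof -
    let ?t = "norm (permute \<pi> y - x)"
    \<comment> \<open>Arithmetic-geometric mean at the scale \<open>T\<close>: the square of
      \<open>?t\<close> averages to the square of \<open>T\<close>, so the two halves recombine to
      exactly \<open>\<epsilon> * T\<close>.\<close>
    have "2 * T * ?t \<le> T\<^sup>2 + ?t\<^sup>2"
      using zero_le_power2 [of "T - ?t"] by (simp add: power2_diff)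
    then have "?t \<le> T / 2 + ?t\<^sup>2 / (2 * T)"
      using \<open>0 < T\<close> by (simp add: field_simps power2_eq_square)
    then have amgm: "\<epsilon> * ?t \<le> \<epsilon> * T / 2 + \<epsilon> / (2 * T) * ?t\<^sup>2"
      using mult_left_mono [OF _ \<open>0 \<le> \<epsilon>\<close>] by (fastforce simp: algebra_simps)
    have K: "0 \<le> K / \<delta> * ?t\<^sup>2" using \<open>0 \<le> K\<close> \<open>0 < \<delta>\<close> by simp
    show ?thesis
    proof (cases "?t < \<delta>")
      case True
      with near [OF that] amgm K show ?thesis by (simp add: algebra_simps)
    next
      case False
      \<comment> \<open>For \<open>?t\<close> at least \<open>\<delta>\<close>, Cauchy-Schwarz is
        enough, because \<open>?t\<close> is then at most \<open>?t * ?t / \<delta>\<close>.\<close>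
      have "v \<bullet> (permute \<pi> y - x) \<le> norm v * ?t" by (rule norm_cauchy_schwarz)
      also have "\<dots> \<le> K * ?t" using \<open>norm v \<le> K\<close> by (intro mult_right_mono) auto
      also have "\<dots> \<le> K / \<delta> * ?t\<^sup>2"
      proof -
        have "?t * \<delta> \<le> ?t * ?t" using False by (intro mult_left_mono) auto
        then have "?t \<le> ?t\<^sup>2 / \<delta>" using \<open>0 < \<delta>\<close> by (simp add: field_simps power2_eq_square)
        then show ?thesis using mult_left_mono [OF _ \<open>0 \<le> K\<close>] by fastforce
      qed
      moreover have "0 \<le> \<epsilon> * T / 2" "0 \<le> \<epsilon> / (2 * T) * ?t\<^sup>2" "0 \<le> C * ?t\<^sup>2"
        using \<open>0 < T\<close> \<open>0 \<le> \<epsilon>\<close> \<open>0 \<le> C\<close> by auto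
      ultimately show ?thesis by (simp add: algebra_simps)
    qed
  qed
  from lift_quadratic_bound [OF U W this]
  have "lift U v \<bullet> (lift W y - lift U x) \<le> \<epsilon> * T / 2 + (\<epsilon> / (2 * T) + C + K / \<delta>) * T\<^sup>2"
    unfolding T_def .
  also have "\<dots> = \<epsilon> * T + (C + K / \<delta>) * T\<^sup>2"
    using \<open>0 < T\<close> by (simp add: field_simps power2_eq_square)
  finally show ?thesis .
qed

section \<open>Plane rotations of a frame\<close>

definition rotate_rows :: "'n \<Rightarrow> 'n \<Rightarrow> real \<Rightarrow> real ^ 'n::finite ^ 'n \<Rightarrow> real ^ 'n ^ 'n" where
  "rotate_rows i j \<theta> U = (\<chi> k. if k = i then cos \<theta> *\<^sub>R U $ i + sin \<theta> *\<^sub>R U $ j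
     else if k = j then cos \<theta> *\<^sub>R U $ j - sin \<theta> *\<^sub>R U $ i else U $ k)"

lemma orthogonal_rotate_rows:
  assumes U: "orthogonal_matrix U" and "i \<noteq> j"
  shows "orthogonal_matrix (rotate_rows i j \<theta> U)"
proof (rule orthogonal_matrixI)
  have "cos \<theta> * cos \<theta> + sin \<theta> * sin \<theta> = 1"
    using sin_cos_squared_add3 [of \<theta>] by simp
  then show "rotate_rows i j \<theta> U $ k \<bullet> rotate_rows i j \<theta> U $ l = (if k = l then 1 else 0)" for k l
    using \<open>i \<noteq> j\<close>
    by (auto simp: rotate_rows_def inner_add inner_diff orthogonal_matrix_row_inner [OF U])
qed

text \<open>Only rows \<open>i\<close> and \<open>j\<close> change. To first order in
  \<open>\<theta>\<close> the increment is
  \<open>2 * \<theta> * (x $ i - x $ j) * qform V (U $ i) (U $ j)\<close>, so rotations detect the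
  off-diagonal entries of \<open>V\<close>, weighted by eigenvalue gaps.\<close>

lemma inner_spec_rotate_rows:
  assumes "i \<noteq> j"
  shows "spec (rotate_rows i j \<theta> U) x \<bullet> V - spec U x \<bullet> V
    = (x $ i - x $ j) * ((sin \<theta>)\<^sup>2 * (qform V (U $ j) (U $ j) - qform V (U $ i) (U $ i))
        + 2 * cos \<theta> * sin \<theta> * qform V (U $ i) (U $ j))"
proof -
  let ?R = "rotate_rows i j \<theta> U"
  have "spec ?R x \<bullet> V - spec U x \<bullet> V
      = (\<Sum>k\<in>UNIV. x $ k * (qform V (?R $ k) (?R $ k) - qform V (U $ k) (U $ k)))"
    by (simp add: inner_spec sum_subtractf right_diff_distrib)
  also have "\<dots> = (\<Sum>k\<in>{i, j}. x $ k * (qform V (?R $ k) (?R $ k) - qform V (U $ k) (U $ k)))"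
    by (intro sum.mono_neutral_right) (auto simp: rotate_rows_def)
  also have "\<dots> = x $ i * (qform V (?R $ i) (?R $ i) - qform V (U $ i) (U $ i))
      + x $ j * (qform V (?R $ j) (?R $ j) - qform V (U $ j) (U $ j))"
    using assms by simp
  also have "qform V (?R $ i) (?R $ i) - qform V (U $ i) (U $ i)
      = (sin \<theta>)\<^sup>2 * (qform V (U $ j) (U $ j) - qform V (U $ i) (U $ i))
        + 2 * cos \<theta> * sin \<theta> * qform V (U $ i) (U $ j)"
  proof -
    have "(cos \<theta>)\<^sup>2 * qform V (U $ i) (U $ i) = qform V (U $ i) (U $ i) - (sin \<theta>)\<^sup>2 * qform V (U $ i) (U $ i)"
      by (simp add: cos_squared_eq left_diff_distrib)
    moreover have "qform V (U $ j) (U $ i) = qform V (U $ i) (U $ j)" by (rule qform_commute)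
    moreover have "qform V (?R $ i) (?R $ i) = (cos \<theta>)\<^sup>2 * qform V (U $ i) (U $ i)
        + cos \<theta> * sin \<theta> * qform V (U $ i) (U $ j) + cos \<theta> * sin \<theta> * qform V (U $ j) (U $ i)
        + (sin \<theta>)\<^sup>2 * qform V (U $ j) (U $ j)"
      using assms unfolding rotate_rows_def qform_def
      by (simp add: inner_add inner_diff matrix_vector_right_distrib matrix_vector_mult_scaleR power2_eq_square algebra_simps)
    ultimately show ?thesis by (simp add: algebra_simps)
  qed
  also have "qform V (?R $ j) (?R $ j) - qform V (U $ j) (U $ j)
      = - ((sin \<theta>)\<^sup>2 * (qform V (U $ j) (U $ j) - qform V (U $ i) (U $ i))
        + 2 * cos \<theta> * sin \<theta> * qform V (U $ i) (U $ j))"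
  proof -
    have "(cos \<theta>)\<^sup>2 * qform V (U $ j) (U $ j) = qform V (U $ j) (U $ j) - (sin \<theta>)\<^sup>2 * qform V (U $ j) (U $ j)"
      by (simp add: cos_squared_eq left_diff_distrib)
    moreover have "qform V (U $ j) (U $ i) = qform V (U $ i) (U $ j)" by (rule qform_commute)
    moreover have "qform V (?R $ j) (?R $ j) = (cos \<theta>)\<^sup>2 * qform V (U $ j) (U $ j)
        - cos \<theta> * sin \<theta> * qform V (U $ i) (U $ j) - cos \<theta> * sin \<theta> * qform V (U $ j) (U $ i)
        + (sin \<theta>)\<^sup>2 * qform V (U $ i) (U $ i)"
      using assms unfolding rotate_rows_def qform_def
      by (simp add: inner_add inner_diff matrix_vector_mult_diff_distrib matrix_vector_right_distrib matrix_vector_mult_scaleR power2_eq_square algebra_simps)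
    ultimately show ?thesis by (simp add: algebra_simps)
  qed
  finally show ?thesis by (simp add: algebra_simps)
qed

lemma norm_spec_rotate_rows_diff:
  assumes U: "orthogonal_matrix U" and "i \<noteq> j"
  shows "(norm (spec (rotate_rows i j \<theta> U) x - spec U x))\<^sup>2 = 2 * (sin \<theta>)\<^sup>2 * (x $ i - x $ j)\<^sup>2"
proof -
  let ?R = "spec (rotate_rows i j \<theta> U) x" and ?X = "spec U x"
  have q: "qform ?X (U $ k) (U $ l) = (if k = l then x $ k else 0)" for k l
    by (rule qform_spec_same [OF U])
  have "(norm (?R - ?X))\<^sup>2 = - 2 * (?R \<bullet> ?X - ?X \<bullet> ?X)"
    using inner_spec_same [OF orthogonal_rotate_rows [OF assms], of \<theta> x x] inner_spec_same [OF U, of x x]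
    by (simp add: power2_norm_eq_inner inner_diff inner_commute)
  also have "\<dots> = 2 * (sin \<theta>)\<^sup>2 * (x $ i - x $ j)\<^sup>2"
    using assms(2) by (simp add: inner_spec_rotate_rows q power2_eq_square algebra_simps)
  finally show ?thesis .
qed

lemma norm_spec_rotate_rows_diff_le:
  assumes U: "orthogonal_matrix U" and "i \<noteq> j"
  shows "norm (spec (rotate_rows i j \<theta> U) x - spec U x) \<le> 2 * \<bar>x $ i - x $ j\<bar> * \<bar>\<theta>\<bar>"
proof (rule power2_le_imp_le)
  have "(sin \<theta>)\<^sup>2 \<le> \<theta>\<^sup>2" using abs_sin_x_le_abs_x [of \<theta>] by (simp add: abs_le_square_iff)
  then have "2 * (sin \<theta>)\<^sup>2 \<le> 4 * \<theta>\<^sup>2" using zero_le_power2 [of \<theta>] by linarith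
  then have "2 * (sin \<theta>)\<^sup>2 * (x $ i - x $ j)\<^sup>2 \<le> 4 * \<theta>\<^sup>2 * (x $ i - x $ j)\<^sup>2"
    by (rule mult_right_mono) simp
  then show "(norm (spec (rotate_rows i j \<theta> U) x - spec U x))\<^sup>2 \<le> (2 * \<bar>x $ i - x $ j\<bar> * \<bar>\<theta>\<bar>)\<^sup>2"
    by (simp add: norm_spec_rotate_rows_diff [OF assms] power_mult_distrib ac_simps)
qed simp

text \<open>The increment has derivative \<open>D\<close> at 0. As \<open>\<theta>\<close> may take
  either sign, one-sided bounds force \<open>D = 0\<close>: moving in the direction of the sign of
  \<open>D\<close> gains more than half of \<open>\<bar>D\<bar> * \<bar>\<theta>\<bar>\<close>,
  against the bound for \<open>\<epsilon>\<close> equal to half of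
  \<open>\<bar>D\<bar>\<close>.\<close>

lemma rotation_stationary:
  assumes "i \<noteq> j"
    and le: "\<And>\<epsilon>. 0 < \<epsilon> \<Longrightarrow> \<exists>\<delta>>0. \<forall>\<theta>. \<bar>\<theta>\<bar> < \<delta> \<longrightarrow>
      spec (rotate_rows i j \<theta> U) x \<bullet> V - spec U x \<bullet> V \<le> \<epsilon> * \<bar>\<theta>\<bar>"
  shows "x $ i = x $ j \<or> qform V (U $ i) (U $ j) = 0"
proof (rule ccontr)
  assume neg: "\<not> ?thesis"
  define D where "D = 2 * (x $ i - x $ j) * qform V (U $ i) (U $ j)"
  have "D \<noteq> 0" using neg unfolding D_def by simp
  define h where "h = (\<lambda>\<theta>. spec (rotate_rows i j \<theta> U) x \<bullet> V - spec U x \<bullet> V)"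
  have "(h has_real_derivative D) (at 0)"
    unfolding h_def inner_spec_rotate_rows [OF \<open>i \<noteq> j\<close>] D_def
    by (auto intro!: derivative_eq_intros)
  moreover have "h 0 = 0" unfolding h_def inner_spec_rotate_rows [OF \<open>i \<noteq> j\<close>] by simp
  ultimately have lim: "(\<lambda>\<theta>. h \<theta> / \<theta>) \<midarrow>0\<rightarrow> D"
    by (simp add: has_field_derivative_iff)
  have "0 < \<bar>D\<bar> / 2" using \<open>D \<noteq> 0\<close> by simp
  from LIM_D [OF lim this] obtain s where
    "0 < s \<and> (\<forall>\<theta>. \<theta> \<noteq> 0 \<and> norm (\<theta> - 0) < s \<longrightarrow> norm (h \<theta> / \<theta> - D) < \<bar>D\<bar> / 2)"
    by blast
  then have s: "0 < s" "\<And>\<theta>. \<theta> \<noteq> 0 \<Longrightarrow> \<bar>\<theta>\<bar> < s \<Longrightarrow> \<bar>h \<theta> / \<theta> - D\<bar> < \<bar>D\<bar> / 2"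
    by simp_all
  obtain \<delta> where \<delta>: "0 < \<delta>" "\<And>\<theta>. \<bar>\<theta>\<bar> < \<delta> \<Longrightarrow> h \<theta> \<le> \<bar>D\<bar> / 2 * \<bar>\<theta>\<bar>"
    using le [of "\<bar>D\<bar> / 2"] \<open>D \<noteq> 0\<close> unfolding h_def by auto
  define \<theta> where "\<theta> = sgn D * (min s \<delta> / 2)"
  have \<theta>: "\<bar>\<theta>\<bar> = min s \<delta> / 2" "\<theta> \<noteq> 0" "\<theta> * D = \<bar>\<theta>\<bar> * \<bar>D\<bar>"
    using s(1) \<delta>(1) \<open>D \<noteq> 0\<close> by (auto simp: \<theta>_def abs_mult sgn_real_def)
  have "\<bar>h \<theta> - \<theta> * D\<bar> = \<bar>\<theta>\<bar> * \<bar>h \<theta> / \<theta> - D\<bar>"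
    using \<theta>(2) by (simp add: field_simps flip: abs_mult)
  also have "\<dots> < \<bar>\<theta>\<bar> * (\<bar>D\<bar> / 2)"
    using s(2) [OF \<theta>(2)] s(1) \<delta>(1) \<theta>(1,2) by (intro mult_strict_left_mono) auto
  finally have "\<bar>\<theta>\<bar> * (\<bar>D\<bar> / 2) < h \<theta>" using \<theta>(3) by linarith
  moreover have "h \<theta> \<le> \<bar>D\<bar> / 2 * \<bar>\<theta>\<bar>"
    by (rule \<delta>(2)) (use \<delta>(1) s(1) \<theta>(1) in linarith)
  ultimately show False by (simp add: mult.commute)
qed

section \<open>Diagonalization by maximizing over frames\<close>

lemma continuous_on_spec [continuous_intros]:
  fixes g :: "'a::t2_space \<Rightarrow> real ^ 'n::finite ^ 'n"
  assumes "continuous_on S g" "continuous_on S h"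
  shows "continuous_on S (\<lambda>z. spec (g z) (h z))"
proof -
  have "continuous_on S (\<lambda>z. spec (g z) (h z) \<bullet> b)" for b
    unfolding inner_spec qform_sum using assms
    by (intro continuous_intros)
  then show ?thesis
    by (subst continuous_on_componentwise) auto
qed

lemma compact_orthogonal_matrices: "compact {U :: real ^ 'n::finite ^ 'n. orthogonal_matrix U}"
proof -
  have "{U :: real ^ 'n ^ 'n. orthogonal_matrix U}
      = (\<Inter>i. \<Inter>j. {U. U $ i \<bullet> U $ j = (if i = j then 1 else 0)})"
    using orthogonal_matrix_row_inner orthogonal_matrixI by fastforce
  then have "closed {U :: real ^ 'n ^ 'n. orthogonal_matrix U}"
    by (auto intro!: closed_INT closed_Collect_eq continuous_intros)
  moreover have "bounded {U :: real ^ 'n ^ 'n. orthogonal_matrix U}"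
  proof (rule boundedI)
    fix U :: "real ^ 'n ^ 'n" assume "U \<in> {U. orthogonal_matrix U}"
    then have "norm (U $ i) = 1" for i
      using orthogonal_matrix_row_inner [of U i i] by (simp add: norm_eq_1)
    then show "norm U \<le> sqrt CARD('n)"
      by (simp add: norm_vec_def L2_set_def)
  qed
  ultimately show ?thesis by (simp add: compact_eq_bounded_closed)
qed

text \<open>
  Among the diagonalizing frames \<open>U\<close> of one matrix, choose one that maximizes the inner product of
  \<open>V\<close> with \<open>spec U \<mu>\<close> for some \<open>\<mu>\<close> with distinct entries: it is stationary under the rotations
  within the eigenspaces.
\<close>

lemma diagonalize_in_eigenspaces:
  fixes U0 :: "real ^ 'n::finite ^ 'n"
  assumes "orthogonal_matrix U0"
  obtains U where "orthogonal_matrix U" "spec U x = spec U0 x"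
    "\<And>i j. i \<noteq> j \<Longrightarrow> x $ i = x $ j \<Longrightarrow> qform V (U $ i) (U $ j) = 0"
proof -
  obtain m :: "'n \<Rightarrow> nat" where m: "inj m"
    using finite_imp_inj_to_nat_seg [of "UNIV :: 'n set"] by auto
  define \<mu> :: "real ^ 'n" where "\<mu> = (\<chi> i. real (m i))"
  have \<mu>: "\<mu> $ i \<noteq> \<mu> $ j" if "i \<noteq> j" for i j
    using that m by (simp add: \<mu>_def inj_eq)
  define F where "F = {U. orthogonal_matrix U \<and> spec U x = spec U0 x}"
  have "closed {U. spec U x = spec U0 x}"
    by (intro closed_Collect_eq continuous_intros)
  then have "compact F"
    using compact_Int_closed [OF compact_orthogonal_matrices] unfolding F_def Collect_conj_eq by blast
  moreover have "F \<noteq> {}" unfolding F_def using assms by blast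
  moreover have "continuous_on F (\<lambda>U. spec U \<mu> \<bullet> V)" by (intro continuous_intros)
  ultimately obtain U where U: "U \<in> F" "\<And>W. W \<in> F \<Longrightarrow> spec W \<mu> \<bullet> V \<le> spec U \<mu> \<bullet> V"
    using continuous_attains_sup [of F "\<lambda>U. spec U \<mu> \<bullet> V"] by auto
  then have orth: "orthogonal_matrix U" and "spec U x = spec U0 x" unfolding F_def by auto
  moreover have "qform V (U $ i) (U $ j) = 0" if "i \<noteq> j" "x $ i = x $ j" for i j
  proof -
    \<comment> \<open>With equal eigenvalues the distance bound for rotations is 0, so rotating does
      not leave the set of competing frames.\<close>
    have "rotate_rows i j \<theta> U \<in> F" for \<theta>
      using norm_spec_rotate_rows_diff_le [OF orth that(1), of \<theta> x] orthogonal_rotate_rows [OF orth that(1)]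
        \<open>spec U x = spec U0 x\<close> that(2) unfolding F_def by simp
    note max = U(2) [OF this]
    have "spec (rotate_rows i j \<theta> U) \<mu> \<bullet> V - spec U \<mu> \<bullet> V \<le> \<epsilon> * \<bar>\<theta>\<bar>" if "0 < \<epsilon>" for \<theta> \<epsilon>
      using max [of \<theta>] mult_nonneg_nonneg [of \<epsilon> "\<bar>\<theta>\<bar>"] that by linarith
    then have "\<mu> $ i = \<mu> $ j \<or> qform V (U $ i) (U $ j) = 0"
      by (intro rotation_stationary [OF that(1)]) (meson zero_less_one)
    with \<mu> [OF that(1)] show ?thesis by simp
  qed
  ultimately show thesis using that by blast
qed

text \<open>With \<open>x = 0\<close> every frame competes and the only eigenspace is the whole
  space, so the maximizing frame kills all off-diagonal entries of \<open>X\<close>.\<close>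

lemma spectral_theorem_symmat:
  obtains U x where "orthogonal_matrix U" "X = spec U x"
proof (rule diagonalize_in_eigenspaces [OF orthogonal_matrix_id, where V = X and x = 0])
  fix U :: "real ^ 'a ^ 'a"
  assume U: "orthogonal_matrix U"
    and "\<And>i j. i \<noteq> j \<Longrightarrow> (0 :: real ^ 'a) $ i = 0 $ j \<Longrightarrow> qform X (U $ i) (U $ j) = 0"
  then have "X = spec U (\<chi> i. qform X (U $ i) (U $ i))"
    by (intro spec_of_offdiag_zero) simp_all
  with U show thesis by (rule that)
qed

section \<open>Eigenvalues\<close>

lemma det_charpoly_spec:
  assumes U: "orthogonal_matrix U"
  shows "det (mat t - Rep_symmat (spec U x)) = (\<Prod>i\<in>UNIV. t - x $ i)"
proof -
  define D :: "real ^ 'a ^ 'a" where "D = (\<chi> i j. if i = j then t - x $ i else 0)"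
  have UU: "transpose U ** U = mat 1" using U unfolding orthogonal_matrix .
  have "(mat t :: real ^ 'a ^ 'a) $ a $ b = (\<Sum>i\<in>UNIV. t * (U $ i $ a * U $ i $ b))" for a b
  proof -
    have "(\<Sum>i\<in>UNIV. U $ i $ a * U $ i $ b) = (transpose U ** U) $ a $ b"
      by (simp add: matrix_matrix_mult_def transpose_def)
    then show ?thesis unfolding UU by (simp add: mat_def flip: sum_distrib_left)
  qed
  moreover have "(D ** U) $ i $ b = (t - x $ i) * U $ i $ b" for i b
    by (simp add: matrix_matrix_mult_def D_def if_distrib [of "\<lambda>t. t * _"] cong: if_cong)
  then have "(transpose U ** (D ** U)) $ a $ b = (\<Sum>i\<in>UNIV. (t - x $ i) * (U $ i $ a * U $ i $ b))" for a b
    unfolding matrix_matrix_mult_def [of "transpose U"] by (simp add: transpose_def ac_simps)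
  ultimately have "mat t - Rep_symmat (spec U x) = transpose U ** (D ** U)"
    by (simp add: vec_eq_iff Rep_spec sum_subtractf left_diff_distrib)
  then have "det (mat t - Rep_symmat (spec U x)) = det (transpose U ** U) * det D"
    by (simp add: det_mul)
  also have "\<dots> = (\<Prod>i\<in>UNIV. D $ i $ i)"
    unfolding UU by (subst det_diagonal) (auto simp: D_def)
  finally show ?thesis by (simp add: D_def)
qed

text \<open>The product determines the multiset of its roots, and a multiset has only one sorted
  enumeration. Values are negated because \<open>sorted\<close> means ascending order.\<close>

lemma nonincreasing_prod_inject:
  fixes l l' :: "'n::{finite, linorder} \<Rightarrow> real"
  assumes "\<And>i j. i \<le> j \<Longrightarrow> l j \<le> l i" "\<And>i j. i \<le> j \<Longrightarrow> l' j \<le> l' i"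
    and "\<And>t. (\<Prod>i\<in>UNIV. t - l i) = (\<Prod>i\<in>UNIV. t - l' i)"
  shows "l = l'"
proof -
  define js where "js = sorted_list_of_set (UNIV :: 'n set)"
  have "poly (\<Prod>i\<in>UNIV. [:- l i, 1:]) = poly (\<Prod>i\<in>UNIV. [:- l' i, 1:])"
    using assms(3) by (simp add: fun_eq_iff poly_prod)
  then have "(\<Prod>i\<in>UNIV. [:- l i, 1:]) = (\<Prod>i\<in>UNIV. [:- l' i, 1:])"
    by (simp add: poly_eq_poly_eq_iff)
  then have "proots (\<Prod>i\<in>UNIV. [:- l i, 1:]) = proots (\<Prod>i\<in>UNIV. [:- l' i, 1:])" by simp
  then have "image_mset l (mset_set UNIV) = image_mset l' (mset_set UNIV)"
    by (simp add: proots_prod sum_unfold_sum_mset)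
  then have "image_mset uminus (image_mset l (mset_set UNIV)) = image_mset uminus (image_mset l' (mset_set UNIV))"
    by simp
  moreover have "mset js = mset_set UNIV"
    using mset_set_set [of js] by (simp add: js_def)
  ultimately have mset: "mset (map (\<lambda>i. - l i) js) = mset (map (\<lambda>i. - l' i) js)"
    by (simp add: multiset.map_comp comp_def)
  have sorted: "sorted (map (\<lambda>i. - l i) js)" if "\<And>i j. i \<le> j \<Longrightarrow> l j \<le> l i" for l :: "'n \<Rightarrow> real"
    unfolding sorted_wrt_map using that sorted_sorted_list_of_set [of "UNIV :: 'n set"]
    by (simp add: js_def sorted_wrt_mono_rel [of _ "(\<le>)"])
  have "map (\<lambda>i. - l i) js = map (\<lambda>i. - l' i) js"
    using properties_for_sort [OF mset sorted] properties_for_sort [OF refl sorted]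
      assms(1,2) by metis
  then show ?thesis by (auto simp: js_def)
qed

text \<open>Rearrangement: \<open>m\<close> is strictly decreasing, so a permutation that maximizes
  the weighted sum must sort, since exchanging two values in the wrong order would increase the
  sum.\<close>

lemma exists_sorting_permutation:
  fixes x :: "'n::{finite, linorder} \<Rightarrow> real"
  obtains \<pi> :: "'n \<Rightarrow> 'n" where "bij \<pi>" "\<And>i j. i \<le> j \<Longrightarrow> x (\<pi> j) \<le> x (\<pi> i)"
proof -
  define m where "m = (\<lambda>i :: 'n. - real (card {..<i}))"
  have m: "m j < m i" if "i < j" for i j
    using that unfolding m_def by (auto intro!: psubset_card_mono)
  define \<Phi> where "\<Phi> = (\<lambda>\<pi>. \<Sum>i\<in>UNIV. m i * x (\<pi> i))"
  have "finite (\<Phi> ` {\<pi>. bij \<pi>})" by simp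
  moreover have "id \<in> {\<pi> :: 'n \<Rightarrow> 'n. bij \<pi>}" by simp
  then have "\<Phi> ` {\<pi>. bij \<pi>} \<noteq> {}" by blast
  ultimately have "Max (\<Phi> ` {\<pi>. bij \<pi>}) \<in> \<Phi> ` {\<pi>. bij \<pi>}" by (rule Max_in)
  then obtain \<pi> where \<pi>: "bij \<pi>" "Max (\<Phi> ` {\<pi>. bij \<pi>}) = \<Phi> \<pi>" by blast
  have max: "\<Phi> \<rho> \<le> \<Phi> \<pi>" if "bij \<rho>" for \<rho>
    unfolding \<pi>(2) [symmetric] using that by (intro Max_ge) auto
  have sorted: "x (\<pi> j) \<le> x (\<pi> i)" if "i \<le> j" for i j
  proof (rule ccontr)
    assume neg: "\<not> x (\<pi> j) \<le> x (\<pi> i)"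
    with that have "i < j" by (cases "i = j") auto
    define \<rho> where "\<rho> = \<pi> \<circ> Transposition.transpose i j"
    have "bij \<rho>" unfolding \<rho>_def using \<pi>(1) by (intro bij_comp) auto
    have "\<Phi> \<rho> - \<Phi> \<pi> = (\<Sum>k\<in>UNIV. m k * (x (\<rho> k) - x (\<pi> k)))"
      unfolding \<Phi>_def by (simp add: right_diff_distrib sum_subtractf)
    also have "\<dots> = (\<Sum>k\<in>{i, j}. m k * (x (\<rho> k) - x (\<pi> k)))"
      by (intro sum.mono_neutral_right) (auto simp: \<rho>_def Transposition.transpose_def)
    also have "\<dots> = (m i - m j) * (x (\<pi> j) - x (\<pi> i))"
      using \<open>i < j\<close> by (simp add: \<rho>_def algebra_simps)
    also have "\<dots> > 0" using m [OF \<open>i < j\<close>] neg by simp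
    finally show False using max [OF \<open>bij \<rho>\<close>] by simp
  qed
  show thesis by (rule that [OF \<pi>(1) sorted])
qed

lemma spec_permute:
  assumes "bij \<pi>"
  shows "spec (\<chi> i. U $ \<pi> i) (\<chi> i. x $ \<pi> i) = spec U x"
proof (rule symmat_eqI)
  show "Rep_symmat (spec (\<chi> i. U $ \<pi> i) (\<chi> i. x $ \<pi> i)) $ a $ b = Rep_symmat (spec U x) $ a $ b" for a b
    using sum.reindex_bij_betw [OF assms, of "\<lambda>i. x $ i * (U $ i $ a * U $ i $ b)"]
    by (simp add: Rep_spec)
qed

lemma orthogonal_permute_rows:
  assumes "bij \<pi>" "orthogonal_matrix U"
  shows "orthogonal_matrix ((\<chi> i. U $ \<pi> i) :: real ^ 'n ^ 'n::finite)"
  using assms by (intro orthogonal_matrixI) (simp add: orthogonal_matrix_row_inner bij_is_inj inj_eq)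

text \<open>Justifies the definite description in \<open>eigvals\<close>: sorting \<open>x\<close>
  gives existence, \<open>nonincreasing_prod_inject\<close> uniqueness.\<close>

lemma eigvals_spec:
  fixes U :: "real ^ 'n::{finite, linorder} ^ 'n::{finite, linorder}"
  assumes U: "orthogonal_matrix U"
  obtains \<pi> where "bij \<pi>" "eigvals (spec U x) = (\<chi> i. x $ \<pi> i)"
proof -
  obtain \<pi> :: "'n \<Rightarrow> 'n" where \<pi>: "bij \<pi>" "\<And>i j. i \<le> j \<Longrightarrow> x $ \<pi> j \<le> x $ \<pi> i"
    by (rule exists_sorting_permutation [of "($) x"]) (rule that)
  have "eigvals (spec U x) = (\<chi> i. x $ \<pi> i)"
    unfolding eigvals_def
  proof (rule the_equality)
    have prod: "(\<Prod>i\<in>UNIV. t - (\<chi> i. x $ \<pi> i) $ i) = (\<Prod>i\<in>UNIV. t - x $ i)" for t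
      using prod.reindex_bij_betw [OF \<pi>(1), of "\<lambda>i. t - x $ i"] by simp
    then show "(\<forall>i j. i \<le> j \<longrightarrow> (\<chi> i. x $ \<pi> i) $ j \<le> (\<chi> i. x $ \<pi> i) $ i) \<and>
        (\<forall>t. det (mat t - Rep_symmat (spec U x)) = (\<Prod>i\<in>UNIV. t - (\<chi> i. x $ \<pi> i) $ i))"
      using \<pi>(2) by (simp add: det_charpoly_spec [OF U])
    fix l :: "real ^ 'n::{finite, linorder}" assume l: "(\<forall>i j. i \<le> j \<longrightarrow> l $ j \<le> l $ i) \<and>
      (\<forall>t. det (mat t - Rep_symmat (spec U x)) = (\<Prod>i\<in>UNIV. t - l $ i))"
    have "($) l = ($) (\<chi> i. x $ \<pi> i)"
    proof (rule nonincreasing_prod_inject)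
      show "(\<Prod>i\<in>UNIV. t - l $ i) = (\<Prod>i\<in>UNIV. t - (\<chi> i. x $ \<pi> i) $ i)" for t
        unfolding prod using l by (simp add: det_charpoly_spec [OF U])
    qed (use l \<pi>(2) in auto)
    then show "l = (\<chi> i. x $ \<pi> i)" by (simp add: vec_eq_iff fun_eq_iff)
  qed
  with \<pi>(1) that show thesis by blast
qed

lemma spec_eigvals:
  obtains U where "orthogonal_matrix U" "X = spec U (eigvals X)"
proof -
  obtain U x where U: "orthogonal_matrix U" "X = spec U x" by (rule spectral_theorem_symmat)
  obtain \<pi> where \<pi>: "bij \<pi>" "eigvals (spec U x) = (\<chi> i. x $ \<pi> i)" by (rule eigvals_spec [OF U(1)])
  show thesis
    by (rule that [OF orthogonal_permute_rows [OF \<pi>(1) U(1)]]) (simp add: U(2) \<pi>(2) spec_permute [OF \<pi>(1)])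
qed

section \<open>Spectral sets\<close>

definition permutation_invariant :: "((real ^ 'n::finite) \<times> real) set \<Rightarrow> bool" where
  "permutation_invariant Q \<longleftrightarrow> (\<forall>\<pi>. bij \<pi> \<longrightarrow> (\<forall>p\<in>Q. permute \<pi> p \<in> Q))"

definition spectral_set :: "((real ^ 'n::{finite, linorder}) \<times> real) set \<Rightarrow> ('n symmat \<times> real) set" where
  "spectral_set Q = {P. (eigvals (fst P), snd P) \<in> Q}"

lemma permutation_invariantD: "permutation_invariant Q \<Longrightarrow> bij \<pi> \<Longrightarrow> p \<in> Q \<Longrightarrow> permute \<pi> p \<in> Q"
  unfolding permutation_invariant_def by blast

text \<open>Sorting only permutes the coordinates, which \<open>Q\<close> does not notice. Spectral
  sets can therefore be described by arbitrary frames and unordered eigenvalues.\<close>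

lemma lift_mem_spectral_set:
  assumes Q: "permutation_invariant Q" and U: "orthogonal_matrix U"
  shows "lift U p \<in> spectral_set Q \<longleftrightarrow> p \<in> Q"
proof -
  obtain \<pi> where \<pi>: "bij \<pi>" "eigvals (spec U (fst p)) = (\<chi> i. fst p $ \<pi> i)" by (rule eigvals_spec [OF U])
  have "lift U p \<in> spectral_set Q \<longleftrightarrow> permute \<pi> p \<in> Q"
    by (simp add: spectral_set_def lift_def permute_def \<pi>(2))
  also have "\<dots> \<longleftrightarrow> p \<in> Q"
  proof
    have "permute (inv \<pi>) (permute \<pi> p) = p"
      using \<pi>(1) by (simp add: permute_def bij_is_surj surj_f_inv_f)
    then show "permute \<pi> p \<in> Q \<Longrightarrow> p \<in> Q"
      using permutation_invariantD [OF Q bij_imp_bij_inv [OF \<pi>(1)], of "permute \<pi> p"] by simp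
  qed (rule permutation_invariantD [OF Q \<pi>(1)])
  finally show ?thesis .
qed

text \<open>The matching permutation is applied to the eigenvalues and to the rows of the frame
  together, which leaves \<open>P\<close> unchanged. The eigenvalues come out close to
  \<open>x\<close> although \<open>W\<close> need not be close to \<open>U\<close>.\<close>

lemma exists_lift_near:
  fixes P :: "'n::finite symmat \<times> real"
  assumes U: "orthogonal_matrix U"
  obtains W y where "orthogonal_matrix W" "P = lift W y" "norm (y - x) \<le> norm (P - lift U x)"
proof -
  obtain W z where W: "orthogonal_matrix W" "fst P = spec W z" by (rule spectral_theorem_symmat)
  have P: "P = lift W (z, snd P)" by (simp add: lift_def flip: W(2))
  obtain \<pi> where \<pi>: "bij \<pi>" "norm (permute \<pi> (z, snd P) - x) \<le> norm (lift W (z, snd P) - lift U x)"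
    by (rule matching_permutation [OF U W(1)])
  show thesis
  proof (rule that [OF orthogonal_permute_rows [OF \<pi>(1) W(1)]])
    show "P = lift (\<chi> i. W $ \<pi> i) (permute \<pi> (z, snd P))"
      by (subst P) (simp add: lift_def permute_def spec_permute [OF \<pi>(1)])
    show "norm (permute \<pi> (z, snd P) - x) \<le> norm (P - lift U x)"
      using \<pi>(2) by (simp flip: P)
  qed
qed

section \<open>Normal cones of spectral sets\<close>

lemma frechet_normal_coneD:
  assumes "v \<in> frechet_normal_cone Q x" "0 < \<epsilon>"
  obtains \<delta> where "0 < \<delta>"
    "\<And>y. y \<in> Q \<Longrightarrow> norm (y - x) < \<delta> \<Longrightarrow> v \<bullet> (y - x) \<le> \<epsilon> * norm (y - x)"
  using assms unfolding frechet_normal_cone_def by blast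

lemma frechet_normal_coneI:
  assumes "\<And>\<epsilon>. 0 < \<epsilon> \<Longrightarrow> \<exists>\<delta>>0. \<forall>y\<in>Q. norm (y - x) < \<delta> \<longrightarrow> v \<bullet> (y - x) \<le> \<epsilon> * norm (y - x)"
  shows "v \<in> frechet_normal_cone Q x"
  using assms unfolding frechet_normal_cone_def by blast

lemma frechet_normal_cone_quadraticI:
  assumes "0 < r" "\<And>y. y \<in> Q \<Longrightarrow> norm (y - x) < r \<Longrightarrow> v \<bullet> (y - x) \<le> C * (norm (y - x))\<^sup>2"
  shows "v \<in> frechet_normal_cone Q x"
proof (rule frechet_normal_coneI)
  fix \<epsilon> :: real assume "0 < \<epsilon>"
  define \<delta> where "\<delta> = min r (\<epsilon> / (\<bar>C\<bar> + 1))"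
  have "v \<bullet> (y - x) \<le> \<epsilon> * norm (y - x)" if "y \<in> Q" "norm (y - x) < \<delta>" for y
  proof -
    have "v \<bullet> (y - x) \<le> C * (norm (y - x))\<^sup>2" using assms(2) that by (simp add: \<delta>_def)
    also have "\<dots> \<le> (\<bar>C\<bar> + 1) * norm (y - x) * norm (y - x)"
      by (simp add: power2_eq_square mult_right_mono flip: mult.assoc)
    also have "\<dots> \<le> \<epsilon> * norm (y - x)"
      using that(2) by (intro mult_right_mono) (simp_all add: \<delta>_def field_simps)
    finally show ?thesis .
  qed
  moreover have "0 < \<delta>" using \<open>0 < r\<close> \<open>0 < \<epsilon>\<close> by (simp add: \<delta>_def)
  ultimately show "\<exists>\<delta>>0. \<forall>y\<in>Q. norm (y - x) < \<delta> \<longrightarrow> v \<bullet> (y - x) \<le> \<epsilon> * norm (y - x)"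
    by blast
qed

lemma frechet_normal_cone_Int_open:
  assumes "open U" "x \<in> U"
  shows "frechet_normal_cone (Q \<inter> U) x = frechet_normal_cone Q x"
proof
  show "frechet_normal_cone Q x \<subseteq> frechet_normal_cone (Q \<inter> U) x"
    unfolding frechet_normal_cone_def by blast
  obtain r where r: "0 < r" "ball x r \<subseteq> U" using assms openE by blast
  show "frechet_normal_cone (Q \<inter> U) x \<subseteq> frechet_normal_cone Q x"
  proof (intro subsetI frechet_normal_coneI)
    fix v \<epsilon> assume v: "v \<in> frechet_normal_cone (Q \<inter> U) x" and "0 < (\<epsilon> :: real)"
    then obtain d where d: "0 < d" "\<And>y. y \<in> Q \<inter> U \<Longrightarrow> norm (y - x) < d \<Longrightarrow> v \<bullet> (y - x) \<le> \<epsilon> * norm (y - x)"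
      using frechet_normal_coneD by metis
    have "v \<bullet> (y - x) \<le> \<epsilon> * norm (y - x)" if "y \<in> Q" "norm (y - x) < min d r" for y
    proof -
      have "y \<in> U" using that r(2) by (auto simp: dist_norm norm_minus_commute subset_eq)
      with d(2) [of y] that show ?thesis by simp
    qed
    then show "\<exists>\<delta>>0. \<forall>y\<in>Q. norm (y - x) < \<delta> \<longrightarrow> v \<bullet> (y - x) \<le> \<epsilon> * norm (y - x)"
      using d(1) r(1) by (intro exI [of _ "min d r"]) auto
  qed
qed

lemma limiting_normal_coneE:
  assumes "v \<in> limiting_normal_cone Q x"
  obtains xs vs where "\<And>i. xs i \<in> Q" "\<And>i. vs i \<in> frechet_normal_cone Q (xs i)"
    "xs \<longlonglongrightarrow> x" "vs \<longlonglongrightarrow> v"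
  using assms unfolding limiting_normal_cone_def by blast

lemma limiting_normal_coneI:
  assumes "\<And>i. xs i \<in> Q" "\<And>i. vs i \<in> frechet_normal_cone Q (xs i)" "xs \<longlonglongrightarrow> x" "vs \<longlonglongrightarrow> v"
  shows "v \<in> limiting_normal_cone Q x"
  using assms unfolding limiting_normal_cone_def by blast

lemma limiting_normal_cone_Int_open:
  assumes "open U" "x \<in> U"
  shows "limiting_normal_cone (Q \<inter> U) x = limiting_normal_cone Q x"
proof (intro equalityI subsetI)
  fix v assume "v \<in> limiting_normal_cone (Q \<inter> U) x"
  then obtain xs vs where *: "\<And>i. xs i \<in> Q \<inter> U" "\<And>i. vs i \<in> frechet_normal_cone (Q \<inter> U) (xs i)"
    "xs \<longlonglongrightarrow> x" "vs \<longlonglongrightarrow> v" by (rule limiting_normal_coneE) (rule that)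
  then show "v \<in> limiting_normal_cone Q x"
    using frechet_normal_cone_Int_open [OF assms(1)] by (intro limiting_normal_coneI [of xs Q vs]) auto
next
  fix v assume "v \<in> limiting_normal_cone Q x"
  then obtain xs vs where *: "\<And>i. xs i \<in> Q" "\<And>i. vs i \<in> frechet_normal_cone Q (xs i)"
    "xs \<longlonglongrightarrow> x" "vs \<longlonglongrightarrow> v" by (rule limiting_normal_coneE) (rule that)
  obtain k where k: "\<And>i. i \<ge> k \<Longrightarrow> xs i \<in> U"
    using topological_tendstoD [OF *(3) assms] unfolding eventually_sequentially by blast
  show "v \<in> limiting_normal_cone (Q \<inter> U) x"
  proof (rule limiting_normal_coneI [of "\<lambda>i. xs (i + k)" _ "\<lambda>i. vs (i + k)"])
    show "xs (i + k) \<in> Q \<inter> U" "vs (i + k) \<in> frechet_normal_cone (Q \<inter> U) (xs (i + k))" for i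
      using * k frechet_normal_cone_Int_open [OF assms(1)] by auto
  qed (use * in \<open>auto intro: LIMSEQ_ignore_initial_segment\<close>)
qed

lemma frechet_subset_limiting: "x \<in> Q \<Longrightarrow> frechet_normal_cone Q x \<subseteq> limiting_normal_cone Q x"
  by (auto intro!: limiting_normal_coneI [of "\<lambda>_. x" _ "\<lambda>_. _"])

lemma zero_in_limiting_normal_cone: "x \<in> Q \<Longrightarrow> 0 \<in> limiting_normal_cone Q x"
  using frechet_subset_limiting [of x Q] frechet_normal_cone_quadraticI [of 1 Q x 0 0] by auto

lemma tendsto_spec:
  fixes g :: "'b \<Rightarrow> real ^ 'n::finite ^ 'n"
  assumes "(g \<longlongrightarrow> U) F" "(h \<longlongrightarrow> x) F"
  shows "((\<lambda>z. spec (g z) (h z)) \<longlongrightarrow> spec U x) F"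
proof -
  have "continuous_on UNIV (\<lambda>p :: (real ^ 'n ^ 'n) \<times> (real ^ 'n). spec (fst p) (snd p))"
    by (intro continuous_intros)
  from continuous_on_tendsto_compose [OF this tendsto_Pair [OF assms]] show ?thesis by simp
qed

lemma tendsto_lift:
  assumes "(g \<longlongrightarrow> U) F" "(h \<longlongrightarrow> p) F"
  shows "((\<lambda>z. lift (g z) (h z)) \<longlongrightarrow> lift U p) F"
  unfolding lift_def by (intro tendsto_intros tendsto_spec assms)

lemma lift_frechet_normal:
  fixes Q :: "((real ^ 'n::{finite, linorder}) \<times> real) set"
  assumes Q: "permutation_invariant Q" and U: "orthogonal_matrix U" and v: "v \<in> frechet_normal_cone Q x"
  shows "lift U v \<in> frechet_normal_cone (spectral_set Q) (lift U x)"
proof (rule frechet_normal_coneI)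
  fix \<epsilon> :: real assume "0 < \<epsilon>"
  then have "0 < \<epsilon> / 2" by simp
  obtain d where d: "0 < d" "\<And>y. y \<in> Q \<Longrightarrow> norm (y - x) < d \<Longrightarrow> v \<bullet> (y - x) \<le> \<epsilon> / 2 * norm (y - x)"
    by (rule frechet_normal_coneD [OF v \<open>0 < \<epsilon> / 2\<close>]) (rule that)
  define r where "r = \<epsilon> / (2 * (norm v / d + 1))"
  have half: "c * (\<epsilon> / (2 * c)) = \<epsilon> / 2" if "0 < c" for c using that by simp
  have den: "0 < norm v / d + 1" using d(1) by (simp add: add_nonneg_pos)
  have "lift U v \<bullet> (P - lift U x) \<le> \<epsilon> * norm (P - lift U x)"
    if P: "P \<in> spectral_set Q" "norm (P - lift U x) < r" for P
  proof -
    obtain W y where W: "orthogonal_matrix W" "P = lift W y" by (rule exists_lift_near [OF U])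
    then have "y \<in> Q" using P(1) lift_mem_spectral_set [OF Q] by blast
    let ?T = "norm (P - lift U x)"
    have "lift U v \<bullet> (P - lift U x) \<le> \<epsilon> / 2 * ?T + (0 + norm v / d) * ?T\<^sup>2"
      unfolding W(2)
    proof (rule permuted_near_bound [OF U W(1) d(1)])
      show "v \<bullet> (permute \<pi> y - x) \<le> \<epsilon> / 2 * norm (permute \<pi> y - x) + 0 * (norm (permute \<pi> y - x))\<^sup>2"
        if "bij \<pi>" "norm (permute \<pi> y - x) < d" for \<pi>
        using d(2) [OF permutation_invariantD [OF Q that(1) \<open>y \<in> Q\<close>] that(2)] by simp
    qed (use \<open>0 < \<epsilon>\<close> in auto)
    also have "\<dots> \<le> \<epsilon> / 2 * ?T + (norm v / d + 1) * ?T * ?T"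
      by (simp add: power2_eq_square algebra_simps)
    also have "\<dots> \<le> \<epsilon> / 2 * ?T + \<epsilon> / 2 * ?T"
    proof -
      have "(norm v / d + 1) * ?T \<le> (norm v / d + 1) * r"
        using P(2) den by (intro mult_left_mono) auto
      also have "\<dots> = \<epsilon> / 2"
        using half [OF den] unfolding r_def .
      finally show ?thesis by (intro add_left_mono mult_right_mono) auto
    qed
    finally show ?thesis by simp
  qed
  moreover have "0 < r" unfolding r_def using den \<open>0 < \<epsilon>\<close> by (intro divide_pos_pos mult_pos_pos) simp_all
  ultimately show "\<exists>\<delta>>0. \<forall>P\<in>spectral_set Q. norm (P - lift U x) < \<delta> \<longrightarrow>
      lift U v \<bullet> (P - lift U x) \<le> \<epsilon> * norm (P - lift U x)"
    by blast
qed

lemma lift_limiting_normal: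
  assumes Q: "permutation_invariant Q" and U: "orthogonal_matrix U" and v: "v \<in> limiting_normal_cone Q x"
  shows "lift U v \<in> limiting_normal_cone (spectral_set Q) (lift U x)"
proof -
  obtain xs vs where *: "\<And>i. xs i \<in> Q" "\<And>i. vs i \<in> frechet_normal_cone Q (xs i)"
    "xs \<longlonglongrightarrow> x" "vs \<longlonglongrightarrow> v" by (rule limiting_normal_coneE [OF v]) (rule that)
  show ?thesis
    by (rule limiting_normal_coneI [of "\<lambda>i. lift U (xs i)" _ "\<lambda>i. lift U (vs i)"])
      (simp_all add: * lift_mem_spectral_set [OF Q U] lift_frechet_normal [OF Q U] tendsto_lift)
qed

text \<open>
  A normal to a spectral set commutes with its base point: it is orthogonal to the rotations of the
  base point, which stay in the set.
\<close>

lemma frechet_normal_spectral_set: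
  fixes Q :: "((real ^ 'n::{finite, linorder}) \<times> real) set"
  assumes Q: "permutation_invariant Q" and U0: "orthogonal_matrix U0" and "x \<in> Q"
    and w: "w \<in> frechet_normal_cone (spectral_set Q) (lift U0 x)"
  obtains U v where "orthogonal_matrix U" "lift U x = lift U0 x" "w = lift U v"
    "v \<in> frechet_normal_cone Q x"
proof -
  \<comment> \<open>Rotating two eigenvectors of one eigenvalue does not move the base point and
    gives no information on \<open>w\<close>. The corresponding entries of \<open>w\<close> are
    removed beforehand by the choice of \<open>U\<close>; rotations then handle the pairs with
    distinct eigenvalues.\<close>
  obtain U where U: "orthogonal_matrix U" "spec U (fst x) = spec U0 (fst x)"
    and eq: "\<And>i j. i \<noteq> j \<Longrightarrow> fst x $ i = fst x $ j \<Longrightarrow> qform (fst w) (U $ i) (U $ j) = 0"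
    by (rule diagonalize_in_eigenspaces [OF U0, of "fst x" "fst w"]) (rule that)
  have Ux: "lift U x = lift U0 x" using U(2) by (simp add: lift_def)
  have "fst x $ i = fst x $ j \<or> qform (fst w) (U $ i) (U $ j) = 0" if "i \<noteq> j" for i j
  proof (rule rotation_stationary [OF that])
    fix \<epsilon> :: real assume "0 < \<epsilon>"
    define L where "L = 2 * \<bar>fst x $ i - fst x $ j\<bar> + 1"
    have "0 < L" unfolding L_def by (intro add_nonneg_pos) auto
    then have "0 < \<epsilon> / L" using \<open>0 < \<epsilon>\<close> by simp
    then obtain d where d: "0 < d" "\<And>P. P \<in> spectral_set Q \<Longrightarrow> norm (P - lift U0 x) < d \<Longrightarrow>
        w \<bullet> (P - lift U0 x) \<le> \<epsilon> / L * norm (P - lift U0 x)"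
      by (rule frechet_normal_coneD [OF w]) (rule that)
    have "spec (rotate_rows i j \<theta> U) (fst x) \<bullet> fst w - spec U (fst x) \<bullet> fst w \<le> \<epsilon> * \<bar>\<theta>\<bar>"
      if "\<bar>\<theta>\<bar> < d / L" for \<theta>
    proof -
      let ?P = "lift (rotate_rows i j \<theta> U) x"
      have P: "norm (?P - lift U0 x) = norm (spec (rotate_rows i j \<theta> U) (fst x) - spec U (fst x))"
        by (simp add: lift_def norm_Pair U(2))
      also have "\<dots> \<le> 2 * \<bar>fst x $ i - fst x $ j\<bar> * \<bar>\<theta>\<bar>"
        by (rule norm_spec_rotate_rows_diff_le [OF U(1) \<open>i \<noteq> j\<close>])
      also have "\<dots> \<le> L * \<bar>\<theta>\<bar>" by (intro mult_right_mono) (auto simp: L_def)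
      finally have le: "norm (?P - lift U0 x) \<le> L * \<bar>\<theta>\<bar>" .
      have "L * \<bar>\<theta>\<bar> < d" using that \<open>0 < L\<close> by (simp add: field_simps)
      moreover have "?P \<in> spectral_set Q"
        using lift_mem_spectral_set [OF Q orthogonal_rotate_rows [OF U(1) \<open>i \<noteq> j\<close>]] \<open>x \<in> Q\<close> by blast
      ultimately have "w \<bullet> (?P - lift U0 x) \<le> \<epsilon> / L * norm (?P - lift U0 x)"
        using le by (intro d(2)) auto
      also have "\<dots> \<le> \<epsilon> / L * (L * \<bar>\<theta>\<bar>)"
        using le \<open>0 < \<epsilon> / L\<close> by (intro mult_left_mono) auto
      also have "\<dots> = \<epsilon> * \<bar>\<theta>\<bar>" using \<open>0 < L\<close> by simp
      also have "w \<bullet> (?P - lift U0 x) = spec (rotate_rows i j \<theta> U) (fst x) \<bullet> fst w - spec U (fst x) \<bullet> fst w"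
        by (simp add: lift_def U(2) inner_prod_def inner_diff inner_commute)
      finally show ?thesis .
    qed
    moreover have "0 < d / L" using d(1) \<open>0 < L\<close> by simp
    ultimately show "\<exists>\<delta>>0. \<forall>\<theta>. \<bar>\<theta>\<bar> < \<delta> \<longrightarrow>
        spec (rotate_rows i j \<theta> U) (fst x) \<bullet> fst w - spec U (fst x) \<bullet> fst w \<le> \<epsilon> * \<bar>\<theta>\<bar>"
      by blast
  qed
  with eq have off: "qform (fst w) (U $ i) (U $ j) = 0" if "i \<noteq> j" for i j
    using that by blast
  define v where "v = (\<chi> i. qform (fst w) (U $ i) (U $ i), snd w)"
  have "fst w = spec U (\<chi> i. qform (fst w) (U $ i) (U $ i))"
    by (rule spec_of_offdiag_zero [OF U(1) off])
  then have wv: "w = lift U v" by (simp add: v_def lift_def prod_eq_iff)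
  \<comment> \<open>Inside the single frame \<open>U\<close> the lift is isometric, so testing
    \<open>w\<close> against lifts of points of \<open>Q\<close> gives the inequality for
    \<open>v\<close>.\<close>
  have "v \<in> frechet_normal_cone Q x"
  proof (rule frechet_normal_coneI)
    fix \<epsilon> :: real assume "0 < \<epsilon>"
    then obtain d where d: "0 < d" "\<And>P. P \<in> spectral_set Q \<Longrightarrow> norm (P - lift U0 x) < d \<Longrightarrow>
        w \<bullet> (P - lift U0 x) \<le> \<epsilon> * norm (P - lift U0 x)"
      by (rule frechet_normal_coneD [OF w]) (rule that)
    have "v \<bullet> (y - x) \<le> \<epsilon> * norm (y - x)" if "y \<in> Q" "norm (y - x) < d" for y
      using d(2) [of "lift U y"] lift_mem_spectral_set [OF Q U(1)] that
      by (simp add: wv norm_lift_diff_same [OF U(1)] inner_lift_same [OF U(1)] flip: Ux lift_diff)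
         (simp add: norm_lift [OF U(1)])
    then show "\<exists>\<delta>>0. \<forall>y\<in>Q. norm (y - x) < \<delta> \<longrightarrow> v \<bullet> (y - x) \<le> \<epsilon> * norm (y - x)"
      using d(1) by blast
  qed
  with U(1) Ux wv show thesis by (rule that)
qed

lemma convergent_lift_subsequence:
  fixes Us :: "nat \<Rightarrow> real ^ 'n::finite ^ 'n"
  assumes orth: "\<And>i. orthogonal_matrix (Us i)" and lim: "(\<lambda>i. lift (Us i) (vs i)) \<longlonglongrightarrow> w"
  obtains U v r where "strict_mono r" "orthogonal_matrix U" "(Us \<circ> r) \<longlonglongrightarrow> U" "(vs \<circ> r) \<longlonglongrightarrow> v" "w = lift U v"
proof -
  obtain B where "\<forall>P\<in>range (\<lambda>i. lift (Us i) (vs i)). norm P \<le> B"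
    using convergent_imp_bounded [OF lim] unfolding bounded_iff by blast
  then have vB: "vs i \<in> cball 0 B" for i using norm_lift [OF orth] by auto
  have "compact ({U :: real ^ 'n ^ 'n. orthogonal_matrix U} \<times> cball (0 :: (real ^ 'n) \<times> real) B)"
    by (intro compact_Times compact_orthogonal_matrices compact_cball)
  then obtain l r where l: "l \<in> {U. orthogonal_matrix U} \<times> cball 0 B" "strict_mono (r :: nat \<Rightarrow> nat)"
      "((\<lambda>i. (Us i, vs i)) \<circ> r) \<longlonglongrightarrow> l"
    unfolding compact_def using orth vB by (metis (no_types, lifting) SigmaI mem_Collect_eq)
  have U: "(Us \<circ> r) \<longlonglongrightarrow> fst l" and v: "(vs \<circ> r) \<longlonglongrightarrow> snd l"
    using tendsto_fst [OF l(3)] tendsto_snd [OF l(3)] by (simp_all add: comp_def)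
  have "(\<lambda>i. lift ((Us \<circ> r) i) ((vs \<circ> r) i)) \<longlonglongrightarrow> lift (fst l) (snd l)"
    by (intro tendsto_lift U v)
  moreover have "(\<lambda>i. lift ((Us \<circ> r) i) ((vs \<circ> r) i)) \<longlonglongrightarrow> w"
    using LIMSEQ_subseq_LIMSEQ [OF lim l(2)] by (simp add: comp_def)
  ultimately have "w = lift (fst l) (snd l)" by (rule LIMSEQ_unique [symmetric])
  with l(1,2) U v that show thesis by auto
qed

text \<open>The frames of the approximating Frechet normals converge only along a subsequence,
  possibly to a frame other than \<open>U0\<close>; the limit still diagonalizes the base point
  because the matched vectors \<open>ys\<close> converge to \<open>x\<close>.\<close>

lemma limiting_normal_spectral_set:
  fixes Q :: "((real ^ 'n::{finite, linorder}) \<times> real) set"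
  assumes Q: "permutation_invariant Q" and U0: "orthogonal_matrix U0"
    and w: "w \<in> limiting_normal_cone (spectral_set Q) (lift U0 x)"
  obtains U v where "orthogonal_matrix U" "lift U x = lift U0 x" "w = lift U v"
    "v \<in> limiting_normal_cone Q x"
proof -
  obtain Ps ws where *: "\<And>i. Ps i \<in> spectral_set Q" "\<And>i. ws i \<in> frechet_normal_cone (spectral_set Q) (Ps i)"
    "Ps \<longlonglongrightarrow> lift U0 x" "ws \<longlonglongrightarrow> w" by (rule limiting_normal_coneE [OF w]) (rule that)
  have "\<exists>U v y. orthogonal_matrix U \<and> Ps i = lift U y \<and> ws i = lift U v \<and> y \<in> Q \<and>
      v \<in> frechet_normal_cone Q y \<and> norm (y - x) \<le> norm (Ps i - lift U0 x)" for i
  proof -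
    obtain W y where W: "orthogonal_matrix W" "Ps i = lift W y" "norm (y - x) \<le> norm (Ps i - lift U0 x)"
      by (rule exists_lift_near [OF U0])
    have "y \<in> Q" using *(1) [of i] lift_mem_spectral_set [OF Q W(1)] W(2) by simp
    obtain U v where "orthogonal_matrix U" "lift U y = lift W y" "ws i = lift U v" "v \<in> frechet_normal_cone Q y"
      using frechet_normal_spectral_set [OF Q W(1) \<open>y \<in> Q\<close> *(2) [of i, unfolded W(2)]] .
    then show ?thesis using W \<open>y \<in> Q\<close> by metis
  qed
  then obtain Us vs ys where s: "\<And>i. orthogonal_matrix (Us i)" "\<And>i. Ps i = lift (Us i) (ys i)"
      "\<And>i. ws i = lift (Us i) (vs i)" "\<And>i. ys i \<in> Q" "\<And>i. vs i \<in> frechet_normal_cone Q (ys i)"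
      "\<And>i. norm (ys i - x) \<le> norm (Ps i - lift U0 x)"
    by metis
  have ys: "ys \<longlonglongrightarrow> x"
  proof (rule Lim_null_comparison [THEN LIM_zero_cancel])
    show "(\<lambda>i. norm (Ps i - lift U0 x)) \<longlonglongrightarrow> 0"
      using tendsto_norm [OF LIM_zero [OF *(3)]] by simp
  qed (simp add: s(6))
  obtain U v r where U: "strict_mono r" "orthogonal_matrix U" "(Us \<circ> r) \<longlonglongrightarrow> U" "(vs \<circ> r) \<longlonglongrightarrow> v" "w = lift U v"
    by (rule convergent_lift_subsequence [OF s(1)]) (use *(4) in \<open>simp add: s(3) [abs_def]\<close>)
  have ysr: "(ys \<circ> r) \<longlonglongrightarrow> x" by (rule LIMSEQ_subseq_LIMSEQ [OF ys U(1)])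
  have "(\<lambda>i. lift ((Us \<circ> r) i) ((ys \<circ> r) i)) \<longlonglongrightarrow> lift U x"
    by (intro tendsto_lift U ysr)
  moreover have "(\<lambda>i. lift ((Us \<circ> r) i) ((ys \<circ> r) i)) \<longlonglongrightarrow> lift U0 x"
    using LIMSEQ_subseq_LIMSEQ [OF *(3) U(1)] by (simp add: comp_def flip: s(2))
  ultimately have "lift U x = lift U0 x" by (rule LIMSEQ_unique)
  moreover have "v \<in> limiting_normal_cone Q x"
    by (rule limiting_normal_coneI [OF _ _ ysr U(4)]) (simp_all add: s)
  ultimately show thesis using that U by blast
qed

section \<open>Transfer of conditions (a) and (b)\<close>

lemma lift_scaleR: "lift U (c *\<^sub>R p) = c *\<^sub>R lift U p"
  by (rule prod_eqI) (simp_all add: lift_def, rule symmat_eqI,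
    simp add: Rep_spec Rep_symmat_simps sum_distrib_left mult.assoc)

text \<open>The set \<open>\<Sigma>\<close> of signs is \<open>{1}\<close>, \<open>{- 1}\<close> and \<open>{1, - 1}\<close> for \<open>(b\<^sub>\<le>)\<close>, \<open>(b\<^sub>\<ge>)\<close> and \<open>(b\<^sub>=)\<close>.\<close>

definition signed_b :: "real set \<Rightarrow> 'a::euclidean_space set \<Rightarrow> 'a set \<Rightarrow> bool" where
  "signed_b \<Sigma> X Y \<longleftrightarrow> (\<forall>\<epsilon>>0. \<exists>\<delta>>0. \<forall>\<sigma>\<in>\<Sigma>. \<forall>x\<in>X. \<forall>y\<in>Y. \<forall>v \<in> limiting_normal_cone X x \<inter> cball 0 1.
     norm (y - x) < \<delta> \<longrightarrow> \<sigma> * (v \<bullet> (y - x)) \<le> \<epsilon> * norm (y - x))"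

definition strong_signed_b :: "real set \<Rightarrow> 'a::euclidean_space set \<Rightarrow> 'a set \<Rightarrow> bool" where
  "strong_signed_b \<Sigma> X Y \<longleftrightarrow> (\<exists>C>0. \<forall>\<sigma>\<in>\<Sigma>. \<forall>x\<in>X. \<forall>y\<in>Y.
     \<forall>v \<in> limiting_normal_cone X x \<inter> cball 0 1. \<sigma> * (v \<bullet> (y - x)) \<le> C * (norm (x - y))\<^sup>2)"

text \<open>\<open>err t\<close> is the supremum of the left-hand sides over all pairs at distance
  exactly \<open>t\<close>, which turns the uniform epsilon-delta condition into a bound by a
  function of the distance alone.\<close>

lemma signed_b_iff:
  fixes X Y :: "'a::euclidean_space set"
  assumes \<Sigma>: "\<Sigma> \<subseteq> {1, - 1}"
  shows "signed_b \<Sigma> X Y \<longleftrightarrow> (\<exists>err :: real \<Rightarrow> real. ((\<lambda>t. err t / t) \<longlongrightarrow> 0) (at_right 0) \<and>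
     (\<forall>\<sigma>\<in>\<Sigma>. \<forall>x\<in>X. \<forall>y\<in>Y. \<forall>v \<in> limiting_normal_cone X x \<inter> cball 0 1.
        \<sigma> * (v \<bullet> (y - x)) \<le> err (norm (y - x))))"
  (is "_ \<longleftrightarrow> (\<exists>err. ?lim err \<and> ?bound err)")
proof
  assume b: "signed_b \<Sigma> X Y"
  \<comment> \<open>The element 0 makes the set nonempty and its supremum nonnegative;
    Cauchy-Schwarz bounds the set by the distance, as the normals lie in the unit ball.\<close>
  define A where "A = (\<lambda>t. insert 0 {\<sigma> * (v \<bullet> (y - x)) |\<sigma> x y v. \<sigma> \<in> \<Sigma> \<and> x \<in> X \<and> y \<in> Y \<and>
    v \<in> limiting_normal_cone X x \<inter> cball 0 1 \<and> norm (y - x) = t})"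
  have A_le: "a \<le> \<bar>t\<bar>" if "a \<in> A t" for a t
  proof (cases "a = 0")
    case False
    with that obtain \<sigma> and x y v :: 'a where *: "a = \<sigma> * (v \<bullet> (y - x))" "\<sigma> \<in> \<Sigma>"
      "v \<in> cball 0 1" "norm (y - x) = t" unfolding A_def by blast
    have "a \<le> \<bar>v \<bullet> (y - x)\<bar>" using \<Sigma> *(1,2) by auto
    also have "\<dots> \<le> norm v * norm (y - x)" by (rule Cauchy_Schwarz_ineq2)
    also have "\<dots> \<le> 1 * norm (y - x)" using *(3) by (intro mult_right_mono) auto
    finally show ?thesis using *(4) by simp
  qed simp
  then have bdd: "bdd_above (A t)" for t by (auto simp: bdd_above_def)
  define err where "err = (\<lambda>t. Sup (A t))"
  have "\<forall>\<^sub>F t in at_right 0. dist (err t / t) 0 < e" if "0 < e" for e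
  proof -
    have "0 < e / 2" using that by simp
    then obtain d where d: "0 < d" "\<And>\<sigma> x y v. \<lbrakk>\<sigma> \<in> \<Sigma>; x \<in> X; y \<in> Y; v \<in> limiting_normal_cone X x \<inter> cball 0 1;
        norm (y - x) < d\<rbrakk> \<Longrightarrow> \<sigma> * (v \<bullet> (y - x)) \<le> e / 2 * norm (y - x)"
      using b unfolding signed_b_def by meson
    have "dist (err t / t) 0 < e" if "0 < t" "t < d" for t
    proof -
      have "a \<le> e / 2 * t" if "a \<in> A t" for a
        using that d(2) \<open>0 < t\<close> \<open>t < d\<close> \<open>0 < e / 2\<close> unfolding A_def by auto
      then have "err t \<le> e / 2 * t"
        unfolding err_def by (intro cSup_least) (auto simp: A_def)
      also have "\<dots> < e * t" using \<open>0 < e / 2\<close> \<open>0 < t\<close> by simp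
      moreover have "0 \<le> err t" unfolding err_def by (intro cSup_upper bdd) (simp add: A_def)
      ultimately show ?thesis using \<open>0 < t\<close> by (simp add: field_simps)
    qed
    then show ?thesis using d(1) unfolding eventually_at_right_field by auto
  qed
  then have "?lim err" by (rule tendstoI)
  moreover have "?bound err"
    unfolding err_def by (intro ballI cSup_upper bdd) (auto simp: A_def)
  ultimately show "\<exists>err. ?lim err \<and> ?bound err" by blast
next
  assume "\<exists>err. ?lim err \<and> ?bound err"
  then obtain err where err: "?lim err" "?bound err" by blast
  show "signed_b \<Sigma> X Y"
    unfolding signed_b_def
  proof (intro allI impI)
    fix \<epsilon> :: real assume "0 < \<epsilon>"
    then obtain d where d: "0 < d" "\<And>t. 0 < t \<Longrightarrow> t < d \<Longrightarrow> \<bar>err t / t\<bar> < \<epsilon>"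
      using tendstoD [OF err(1)] unfolding eventually_at_right_field by (auto simp: dist_real_def)
    have "\<sigma> * (v \<bullet> (y - x)) \<le> \<epsilon> * norm (y - x)"
      if "\<sigma> \<in> \<Sigma>" "x \<in> X" "y \<in> Y" "v \<in> limiting_normal_cone X x \<inter> cball 0 1" "norm (y - x) < d" for \<sigma> x y v
    \<comment> \<open>The limit from the right does not restrict \<open>err 0\<close>, but for
      \<open>y = x\<close> the left-hand side is 0.\<close>
    proof (cases "y = x")
      case False
      have "\<sigma> * (v \<bullet> (y - x)) \<le> err (norm (y - x))" using err(2) that by blast
      also have "\<dots> \<le> \<epsilon> * norm (y - x)"
        using d(2) [of "norm (y - x)"] that(5) False by (simp add: abs_less_iff field_simps)
      finally show ?thesis .
    qed simp
    then show "\<exists>\<delta>>0. \<forall>\<sigma>\<in>\<Sigma>. \<forall>x\<in>X. \<forall>y\<in>Y. \<forall>v \<in> limiting_normal_cone X x \<inter> cball 0 1.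
        norm (y - x) < \<delta> \<longrightarrow> \<sigma> * (v \<bullet> (y - x)) \<le> \<epsilon> * norm (y - x)"
      using d(1) by blast
  qed
qed

lemma reg_b_signed:
  fixes X Y :: "'a::euclidean_space set"
  shows "reg_b_le X Y = signed_b {1} X Y" and "reg_b_ge X Y = signed_b {- 1} X Y"
    and "reg_b_eq X Y = signed_b {1, - 1} X Y"
proof -
  show "reg_b_le X Y = signed_b {1} X Y" by (simp add: reg_b_le_def signed_b_iff)
  show "reg_b_eq X Y = signed_b {1, - 1} X Y"
    unfolding reg_b_eq_def signed_b_iff [OF subset_refl] by (simp add: abs_le_iff ball_conj_distrib)
  show "reg_b_ge X Y = signed_b {- 1} X Y"
  proof
    assume "reg_b_ge X Y"
    then obtain err where *: "((\<lambda>t. err t / t) \<longlongrightarrow> 0) (at_right 0)"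
      "\<forall>x\<in>X. \<forall>y\<in>Y. \<forall>v \<in> limiting_normal_cone X x \<inter> cball 0 1. v \<bullet> (y - x) \<ge> err (norm (y - x))"
      unfolding reg_b_ge_def by blast
    show "signed_b {- 1} X Y"
      using tendsto_minus [OF *(1)] *(2) by (subst signed_b_iff) (auto intro!: exI [of _ "\<lambda>t. - err t"])
  next
    assume "signed_b {- 1} X Y"
    then obtain err where *: "((\<lambda>t. err t / t) \<longlongrightarrow> 0) (at_right 0)"
      "\<forall>x\<in>X. \<forall>y\<in>Y. \<forall>v \<in> limiting_normal_cone X x \<inter> cball 0 1. - (v \<bullet> (y - x)) \<le> err (norm (y - x))"
      using signed_b_iff [of "{- 1}" X Y] by auto
    show "reg_b_ge X Y"
      unfolding reg_b_ge_def
      using tendsto_minus [OF *(1)] *(2) by (intro exI [of _ "\<lambda>t. - err t"]) (simp add: minus_le_iff)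
  qed
qed

lemma strong_reg_b_signed:
  fixes X Y :: "'a::euclidean_space set"
  shows "strong_reg_b_le X Y = strong_signed_b {1} X Y"
    and "strong_reg_b_ge X Y = strong_signed_b {- 1} X Y"
    and "strong_reg_b_eq X Y = strong_signed_b {1, - 1} X Y"
  by (simp_all add: strong_reg_b_le_def strong_reg_b_ge_def strong_reg_b_eq_def strong_signed_b_def
      abs_le_iff ball_conj_distrib minus_le_iff)

text \<open>The factor 3 leaves room for points within \<open>2 * \<rho>\<close> of a point that is
  itself within \<open>\<rho>\<close> of \<open>z\<close>.\<close>

lemma open_contains_ball_3:
  fixes z :: "'a::euclidean_space"
  assumes "open U" "z \<in> U"
  obtains \<rho> where "0 < \<rho>" "\<And>x. norm (x - z) < 3 * \<rho> \<Longrightarrow> x \<in> U"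
proof -
  obtain r where r: "0 < r" "ball z r \<subseteq> U" using assms openE by blast
  show thesis
    by (rule that [of "r / 3"]) (use r in \<open>auto simp: dist_norm norm_minus_commute subset_eq\<close>)
qed

lemma norm_diff_less_triangle: "norm (x - y) < a \<Longrightarrow> norm (y - z) < b \<Longrightarrow> norm (x - z) < a + b"
  for x y z :: "'a::real_normed_vector"
  using norm_triangle_lt [of "x - y" "y - z"] by simp

lemma spectral_normal_near:
  fixes Q :: "((real ^ 'n::{finite, linorder}) \<times> real) set"
  assumes Q: "permutation_invariant Q" and U0: "orthogonal_matrix U0"
    and P: "P \<in> spectral_set Q \<inter> ball (lift U0 z) \<rho>"
    and w: "w \<in> limiting_normal_cone (spectral_set Q \<inter> ball (lift U0 z) \<rho>) P"
  obtains U x v where "orthogonal_matrix U" "P = lift U x" "w = lift U v" "x \<in> Q"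
    "v \<in> limiting_normal_cone Q x" "norm (x - z) < \<rho>"
proof -
  obtain W x where W: "orthogonal_matrix W" "P = lift W x" "norm (x - z) \<le> norm (P - lift U0 z)"
    by (rule exists_lift_near [OF U0])
  have "w \<in> limiting_normal_cone (spectral_set Q) (lift W x)"
    using w P limiting_normal_cone_Int_open [OF open_ball] W(2) by fastforce
  then obtain U v where U: "orthogonal_matrix U" "lift U x = lift W x" "w = lift U v"
    "v \<in> limiting_normal_cone Q x" by (rule limiting_normal_spectral_set [OF Q W(1)])
  moreover have "x \<in> Q" using P W(2) lift_mem_spectral_set [OF Q W(1)] by blast
  moreover have "norm (x - z) < \<rho>"
    using W(3) P by (auto simp: dist_norm norm_minus_commute)
  ultimately show thesis using that W(2) by metis
qed

lemma spectral_point_near: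
  fixes Q :: "((real ^ 'n::{finite, linorder}) \<times> real) set"
  assumes Q: "permutation_invariant Q" and U0: "orthogonal_matrix U0"
    and P: "P \<in> spectral_set Q \<inter> ball (lift U0 z) \<rho>"
  obtains U x where "orthogonal_matrix U" "P = lift U x" "x \<in> Q" "norm (x - z) < \<rho>"
  using spectral_normal_near [OF assms zero_in_limiting_normal_cone [OF P]] by metis

lemma signed_b_transfer:
  fixes Q G :: "((real ^ 'n::{finite, linorder}) \<times> real) set"
  assumes \<Sigma>: "\<Sigma> \<subseteq> {1, - 1}" and Q: "permutation_invariant Q" and G: "permutation_invariant G"
    and U0: "orthogonal_matrix U0" and b: "holds_near (signed_b \<Sigma>) Q G z"
  shows "holds_near (signed_b \<Sigma>) (spectral_set Q) (spectral_set G) (lift U0 z)"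
proof -
  obtain N where N: "open N" "z \<in> N" "signed_b \<Sigma> (Q \<inter> N) (G \<inter> N)"
    using b unfolding holds_near_def by blast
  obtain \<rho> where \<rho>: "0 < \<rho>" "\<And>x. norm (x - z) < 3 * \<rho> \<Longrightarrow> x \<in> N"
    by (rule open_contains_ball_3 [OF N(1,2)]) (rule that)
  let ?N = "ball (lift U0 z) \<rho>"
  have "signed_b \<Sigma> (spectral_set Q \<inter> ?N) (spectral_set G \<inter> ?N)"
    unfolding signed_b_def
  proof (intro allI impI)
    fix \<epsilon> :: real assume "0 < \<epsilon>"
    then have "0 < \<epsilon> / 2" by simp
    then obtain \<delta> where \<delta>: "0 < \<delta>" "\<And>\<sigma> x y v. \<lbrakk>\<sigma> \<in> \<Sigma>; x \<in> Q \<inter> N; y \<in> G \<inter> N;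
        v \<in> limiting_normal_cone (Q \<inter> N) x \<inter> cball 0 1; norm (y - x) < \<delta>\<rbrakk> \<Longrightarrow>
        \<sigma> * (v \<bullet> (y - x)) \<le> \<epsilon> / 2 * norm (y - x)"
      using N(3) unfolding signed_b_def by meson
    \<comment> \<open>Permuted points within \<open>d\<close> of \<open>x\<close> satisfy the
      hypothesis and remain in \<open>N\<close>; all others are charged to the term with factor
      \<open>1 / d\<close>. The restriction to \<open>norm (R - P) < \<epsilon> * d / 2\<close>
      makes that term at most \<open>\<epsilon> / 2\<close> times the distance.\<close>
    define d where "d = min \<delta> \<rho>"
    have "0 < d" using \<delta>(1) \<rho>(1) by (simp add: d_def)
    have "\<sigma> * (w \<bullet> (R - P)) \<le> \<epsilon> * norm (R - P)"
      if \<sigma>: "\<sigma> \<in> \<Sigma>" and P: "P \<in> spectral_set Q \<inter> ?N" and R: "R \<in> spectral_set G \<inter> ?N"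
        and w: "w \<in> limiting_normal_cone (spectral_set Q \<inter> ?N) P \<inter> cball 0 1"
        and less: "norm (R - P) < \<epsilon> * d / 2" for \<sigma> P R w
    proof -
      obtain U x v where U: "orthogonal_matrix U" "P = lift U x" "w = lift U v" "x \<in> Q"
        "v \<in> limiting_normal_cone Q x" "norm (x - z) < \<rho>"
        using spectral_normal_near [OF Q U0 P] w by blast
      obtain W y where W: "orthogonal_matrix W" "R = lift W y" "y \<in> G"
        by (rule spectral_point_near [OF G U0 R])
      have "x \<in> N" using U(6) \<rho> by simp
      have v1: "norm v \<le> 1" using w U(3) by (simp add: norm_lift [OF U(1)])
      have abs: "\<bar>\<sigma>\<bar> = 1" using \<sigma> \<Sigma> by auto
      let ?T = "norm (R - P)"
      have "lift U (\<sigma> *\<^sub>R v) \<bullet> (lift W y - lift U x)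
          \<le> \<epsilon> / 2 * norm (lift W y - lift U x) + (0 + 1 / d) * (norm (lift W y - lift U x))\<^sup>2"
      proof (rule permuted_near_bound [OF U(1) W(1) \<open>0 < d\<close>])
        fix \<pi> :: "'n \<Rightarrow> 'n" assume \<pi>: "bij \<pi>" "norm (permute \<pi> y - x) < d"
        have "norm (permute \<pi> y - z) < \<rho> + \<rho>"
          using \<pi>(2) by (intro norm_diff_less_triangle [OF _ U(6)]) (simp add: d_def)
        then have "permute \<pi> y \<in> N" using \<rho> by simp
        moreover have "permute \<pi> y \<in> G" by (rule permutation_invariantD [OF G \<pi>(1) W(3)])
        ultimately show "\<sigma> *\<^sub>R v \<bullet> (permute \<pi> y - x)
            \<le> \<epsilon> / 2 * norm (permute \<pi> y - x) + 0 * (norm (permute \<pi> y - x))\<^sup>2"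
          using \<delta>(2) [OF \<sigma>, of x "permute \<pi> y" v] \<open>x \<in> N\<close> U(4,5) v1 \<pi>(2)
          by (simp add: d_def limiting_normal_cone_Int_open [OF N(1)])
      qed (use \<open>0 < \<epsilon>\<close> v1 abs in auto)
      then have "\<sigma> * (w \<bullet> (R - P)) \<le> \<epsilon> / 2 * ?T + ?T\<^sup>2 / d"
        by (simp add: U(2,3) W(2) lift_scaleR)
      also have "?T\<^sup>2 / d \<le> \<epsilon> / 2 * ?T"
      proof -
        have "?T * ?T \<le> (\<epsilon> * d / 2) * ?T" using less by (intro mult_right_mono) auto
        then show ?thesis using \<open>0 < d\<close> by (simp add: field_simps power2_eq_square)
      qed
      finally show ?thesis by simp
    qed
    moreover have "0 < \<epsilon> * d / 2" using \<open>0 < \<epsilon>\<close> \<open>0 < d\<close> by simp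
    ultimately show "\<exists>\<delta>>0. \<forall>\<sigma>\<in>\<Sigma>. \<forall>x\<in>spectral_set Q \<inter> ?N. \<forall>y\<in>spectral_set G \<inter> ?N.
        \<forall>v \<in> limiting_normal_cone (spectral_set Q \<inter> ?N) x \<inter> cball 0 1.
        norm (y - x) < \<delta> \<longrightarrow> \<sigma> * (v \<bullet> (y - x)) \<le> \<epsilon> * norm (y - x)"
      by blast
  qed
  then show ?thesis
    unfolding holds_near_def using \<rho>(1) by (intro exI [of _ ?N]) simp
qed

text \<open>The error is quadratic from the start, so the bound holds at all distances inside the
  neighbourhood; permutations that move \<open>y\<close> farther than \<open>\<rho>\<close> from
  \<open>x\<close> add \<open>1 / \<rho>\<close> to the constant.\<close>

lemma strong_signed_b_transfer:
  fixes Q G :: "((real ^ 'n::{finite, linorder}) \<times> real) set"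
  assumes \<Sigma>: "\<Sigma> \<subseteq> {1, - 1}" and Q: "permutation_invariant Q" and G: "permutation_invariant G"
    and U0: "orthogonal_matrix U0" and b: "holds_near (strong_signed_b \<Sigma>) Q G z"
  shows "holds_near (strong_signed_b \<Sigma>) (spectral_set Q) (spectral_set G) (lift U0 z)"
proof -
  obtain N where N: "open N" "z \<in> N" "strong_signed_b \<Sigma> (Q \<inter> N) (G \<inter> N)"
    using b unfolding holds_near_def by blast
  obtain \<rho> where \<rho>: "0 < \<rho>" "\<And>x. norm (x - z) < 3 * \<rho> \<Longrightarrow> x \<in> N"
    by (rule open_contains_ball_3 [OF N(1,2)]) (rule that)
  obtain C where C: "0 < C" "\<And>\<sigma> x y v. \<lbrakk>\<sigma> \<in> \<Sigma>; x \<in> Q \<inter> N; y \<in> G \<inter> N;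
      v \<in> limiting_normal_cone (Q \<inter> N) x \<inter> cball 0 1\<rbrakk> \<Longrightarrow> \<sigma> * (v \<bullet> (y - x)) \<le> C * (norm (x - y))\<^sup>2"
    using N(3) unfolding strong_signed_b_def by meson
  let ?N = "ball (lift U0 z) \<rho>"
  have "\<sigma> * (w \<bullet> (R - P)) \<le> (C + 1 / \<rho>) * (norm (P - R))\<^sup>2"
    if \<sigma>: "\<sigma> \<in> \<Sigma>" and P: "P \<in> spectral_set Q \<inter> ?N" and R: "R \<in> spectral_set G \<inter> ?N"
      and w: "w \<in> limiting_normal_cone (spectral_set Q \<inter> ?N) P \<inter> cball 0 1" for \<sigma> P R w
  proof -
    obtain U x v where U: "orthogonal_matrix U" "P = lift U x" "w = lift U v" "x \<in> Q"
      "v \<in> limiting_normal_cone Q x" "norm (x - z) < \<rho>"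
      using spectral_normal_near [OF Q U0 P] w by blast
    obtain W y where W: "orthogonal_matrix W" "R = lift W y" "y \<in> G"
      by (rule spectral_point_near [OF G U0 R])
    have "x \<in> N" using U(6) \<rho> by simp
    have v1: "norm v \<le> 1" using w U(3) by (simp add: norm_lift [OF U(1)])
    have abs: "\<bar>\<sigma>\<bar> = 1" using \<sigma> \<Sigma> by auto
    have "lift U (\<sigma> *\<^sub>R v) \<bullet> (lift W y - lift U x)
        \<le> 0 * norm (lift W y - lift U x) + (C + 1 / \<rho>) * (norm (lift W y - lift U x))\<^sup>2"
    proof (rule permuted_near_bound [OF U(1) W(1) \<rho>(1)])
      fix \<pi> :: "'n \<Rightarrow> 'n" assume \<pi>: "bij \<pi>" "norm (permute \<pi> y - x) < \<rho>"
      have "norm (permute \<pi> y - z) < \<rho> + \<rho>"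
        by (rule norm_diff_less_triangle [OF \<pi>(2) U(6)])
      then have "permute \<pi> y \<in> N" using \<rho> by simp
      moreover have "permute \<pi> y \<in> G" by (rule permutation_invariantD [OF G \<pi>(1) W(3)])
      ultimately show "\<sigma> *\<^sub>R v \<bullet> (permute \<pi> y - x)
          \<le> 0 * norm (permute \<pi> y - x) + C * (norm (permute \<pi> y - x))\<^sup>2"
        using C(2) [OF \<sigma>, of x "permute \<pi> y" v] \<open>x \<in> N\<close> U(4,5) v1
        by (simp add: limiting_normal_cone_Int_open [OF N(1)] norm_minus_commute)
    qed (use C(1) v1 abs in auto)
    then show ?thesis
      by (simp add: U(2,3) W(2) lift_scaleR norm_minus_commute)
  qed
  moreover have "0 < C + 1 / \<rho>" using C(1) \<rho>(1) by (simp add: add_pos_pos)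
  ultimately have "strong_signed_b \<Sigma> (spectral_set Q \<inter> ?N) (spectral_set G \<inter> ?N)"
    unfolding strong_signed_b_def by blast
  then show ?thesis
    unfolding holds_near_def using \<rho>(1) by (intro exI [of _ ?N]) simp
qed

text \<open>Each normal shares a frame with its base point, whose eigenvalues are matched to
  \<open>y\<close>. A convergent subsequence of these frames yields a frame of \<open>R\<close> in
  which the limit normal is the lift of a limit of normals to \<open>Q\<close>.\<close>

lemma reg_a_transfer:
  fixes Q G :: "((real ^ 'n::{finite, linorder}) \<times> real) set"
  assumes Q: "permutation_invariant Q" and G: "permutation_invariant G"
    and U0: "orthogonal_matrix U0" and a: "holds_near reg_a Q G z"
  shows "holds_near reg_a (spectral_set Q) (spectral_set G) (lift U0 z)"
proof -
  obtain N where N: "open N" "z \<in> N" "reg_a (Q \<inter> N) (G \<inter> N)"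
    using a unfolding holds_near_def by blast
  obtain \<rho> where \<rho>: "0 < \<rho>" "\<And>x. norm (x - z) < 3 * \<rho> \<Longrightarrow> x \<in> N"
    by (rule open_contains_ball_3 [OF N(1,2)]) (rule that)
  let ?N = "ball (lift U0 z) \<rho>"
  have "w \<in> limiting_normal_cone (spectral_set G \<inter> ?N) R"
    if Ps: "\<And>i. Ps i \<in> spectral_set Q \<inter> ?N"
      and ws: "\<And>i. ws i \<in> limiting_normal_cone (spectral_set Q \<inter> ?N) (Ps i)"
      and PR: "Ps \<longlonglongrightarrow> R" and R: "R \<in> spectral_set G \<inter> ?N"
      and q: "strict_mono q" "(ws \<circ> q) \<longlonglongrightarrow> w" for Ps ws R q w
  proof -
    obtain W y where W: "orthogonal_matrix W" "R = lift W y" "y \<in> G" "norm (y - z) < \<rho>"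
      by (rule spectral_point_near [OF G U0 R])
    have "\<exists>U v x. orthogonal_matrix U \<and> Ps i = lift U x \<and> ws i = lift U v \<and> x \<in> Q \<inter> N \<and>
        v \<in> limiting_normal_cone (Q \<inter> N) x \<and> norm (x - y) \<le> norm (Ps i - R)" for i
    proof -
      obtain V x where V: "orthogonal_matrix V" "Ps i = lift V x" "norm (x - y) \<le> norm (Ps i - lift W y)"
        by (rule exists_lift_near [OF W(1)])
      have "ws i \<in> limiting_normal_cone (spectral_set Q) (lift V x)"
        using ws [of i] Ps [of i] limiting_normal_cone_Int_open [OF open_ball] V(2) by fastforce
      then obtain U v where U: "orthogonal_matrix U" "lift U x = lift V x" "ws i = lift U v"
        "v \<in> limiting_normal_cone Q x" by (rule limiting_normal_spectral_set [OF Q V(1)])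
      have "x \<in> Q" using Ps [of i] V(2) lift_mem_spectral_set [OF Q V(1)] by simp
      have "norm (Ps i - R) \<le> norm (Ps i - lift U0 z) + norm (lift U0 z - R)"
        using norm_triangle_ineq [of "Ps i - lift U0 z" "lift U0 z - R"] by simp
      also have "\<dots> < \<rho> + \<rho>"
        using Ps [of i] R by (intro add_strict_mono) (auto simp: dist_norm norm_minus_commute)
      finally have "norm (x - y) < 2 * \<rho>" using V(3) W(2) by simp
      then have "norm (x - z) < 2 * \<rho> + \<rho>" by (rule norm_diff_less_triangle [OF _ W(4)])
      then have "x \<in> N" using \<rho> by simp
      then show ?thesis
        using U V W(2) \<open>x \<in> Q\<close> limiting_normal_cone_Int_open [OF N(1) \<open>x \<in> N\<close>] by (metis IntI)
    qed
    then obtain Us vs xs where s: "\<And>i. orthogonal_matrix (Us i)" "\<And>i. Ps i = lift (Us i) (xs i)"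
        "\<And>i. ws i = lift (Us i) (vs i)" "\<And>i. xs i \<in> Q \<inter> N"
        "\<And>i. vs i \<in> limiting_normal_cone (Q \<inter> N) (xs i)" "\<And>i. norm (xs i - y) \<le> norm (Ps i - R)"
      by metis
    have xs: "xs \<longlonglongrightarrow> y"
    proof (rule Lim_null_comparison [THEN LIM_zero_cancel])
      show "(\<lambda>i. norm (Ps i - R)) \<longlonglongrightarrow> 0"
        using tendsto_norm [OF LIM_zero [OF PR]] by simp
    qed (simp add: s(6))
    have "(\<lambda>i. lift ((Us \<circ> q) i) ((vs \<circ> q) i)) \<longlonglongrightarrow> w"
      using q(2) by (simp add: comp_def flip: s(3))
    note lim = this
    have orth: "orthogonal_matrix ((Us \<circ> q) i)" for i by (simp add: s)
    obtain U v r where U: "strict_mono r" "orthogonal_matrix U" "((Us \<circ> q) \<circ> r) \<longlonglongrightarrow> U"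
        "((vs \<circ> q) \<circ> r) \<longlonglongrightarrow> v" "w = lift U v"
      by (rule convergent_lift_subsequence [OF orth lim])
    have qr: "strict_mono (q \<circ> r)" by (rule strict_mono_o [OF q(1) U(1)])
    have "(\<lambda>i. lift ((Us \<circ> q \<circ> r) i) ((xs \<circ> (q \<circ> r)) i)) \<longlonglongrightarrow> lift U y"
      by (intro tendsto_lift U LIMSEQ_subseq_LIMSEQ [OF xs qr])
    moreover have "(\<lambda>i. lift ((Us \<circ> q \<circ> r) i) ((xs \<circ> (q \<circ> r)) i)) \<longlonglongrightarrow> R"
      using LIMSEQ_subseq_LIMSEQ [OF PR qr] by (simp add: comp_def flip: s(2))
    ultimately have RU: "R = lift U y" by (rule LIMSEQ_unique [symmetric])
    have "y \<in> N" using W(4) \<rho> by simp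
    have "v \<in> limiting_normal_cone (G \<inter> N) y"
      using N(3) [unfolded reg_a_def, rule_format, of y xs vs v] W(3) \<open>y \<in> N\<close> s(4,5) xs qr U(4)
      by (auto simp: comp_assoc)
    then have "v \<in> limiting_normal_cone G y"
      by (simp add: limiting_normal_cone_Int_open [OF N(1) \<open>y \<in> N\<close>])
    then have "w \<in> limiting_normal_cone (spectral_set G) R"
      unfolding RU U(5) by (rule lift_limiting_normal [OF G U(2)])
    then show ?thesis
      using R limiting_normal_cone_Int_open [OF open_ball] by fastforce
  qed
  then have "reg_a (spectral_set Q \<inter> ?N) (spectral_set G \<inter> ?N)"
    unfolding reg_a_def by blast
  then show ?thesis
    unfolding holds_near_def using \<rho>(1) by (intro exI [of _ ?N]) simp
qed

section \<open>Sets with Lipschitz normals\<close>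

text \<open>Both endpoints of the chord are free because the chord between a point and its mirror
  image can be far shorter than its distance to \<open>y\<close>, and this short chord is what
  measures a coordinate difference of \<open>w\<close>.\<close>

definition curved_normals :: "'a::euclidean_space set \<Rightarrow> 'a \<Rightarrow> bool" where
  "curved_normals G z \<longleftrightarrow> (\<exists>C\<ge>0. \<exists>r>0. \<forall>y \<in> G \<inter> ball z r. \<forall>p \<in> G \<inter> ball z r. \<forall>q \<in> G \<inter> ball z r.
     \<forall>w \<in> limiting_normal_cone G y.
       \<bar>w \<bullet> (p - q)\<bar> \<le> C * norm w * norm (p - q) * (norm (p - y) + norm (q - y)))"

text \<open>A normal vector of the hyperplane where the two coordinates agree; the transposition of
  \<open>i\<close> and \<open>j\<close> is the reflection in that hyperplane.\<close>

definition coord_diff :: "'n \<Rightarrow> 'n \<Rightarrow> (real ^ 'n::finite) \<times> real" where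
  "coord_diff i j = (axis i 1 - axis j 1, 0)"

lemma inner_coord_diff: "p \<bullet> coord_diff i j = fst p $ i - fst p $ j"
  by (cases p) (simp add: coord_diff_def inner_diff_right inner_axis)

lemma norm_coord_diff: "i \<noteq> j \<Longrightarrow> norm (coord_diff i j) = sqrt 2"
  using inner_coord_diff [of "coord_diff i j" i j]
  by (simp add: norm_eq_sqrt_inner) (simp add: coord_diff_def axis_def)

lemma permute_transpose:
  assumes "i \<noteq> j"
  shows "permute (Transposition.transpose i j) p = p - (fst p $ i - fst p $ j) *\<^sub>R coord_diff i j"
  using assms
  by (auto simp: permute_def coord_diff_def prod_eq_iff vec_eq_iff axis_def Transposition.transpose_def)

lemma norm_permute:
  assumes "bij \<pi>"
  shows "norm (permute \<pi> p) = norm p"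
proof -
  have "(\<chi> i. fst p $ \<pi> i) \<bullet> (\<chi> i. fst p $ \<pi> i) = fst p \<bullet> fst p"
    using sum.reindex_bij_betw [OF assms, of "\<lambda>i. fst p $ i * fst p $ i"] by (simp add: inner_vec_def)
  then show ?thesis by (simp add: norm_eq_sqrt_inner inner_prod_def permute_def)
qed

lemma norm_permute_transpose_diff:
  assumes "i \<noteq> j" "fst y $ i = fst y $ j"
  shows "norm (permute (Transposition.transpose i j) p - y) = norm (p - y)"
proof -
  have "permute (Transposition.transpose i j) p - y = permute (Transposition.transpose i j) (p - y)"
    using assms by (simp add: permute_transpose)
  then show ?thesis by (simp add: norm_permute)
qed

lemma abs_coord_le_norm: "\<bar>fst p $ i\<bar> \<le> norm (p :: (real ^ 'n::finite) \<times> real)"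
  using component_le_norm_cart [of "fst p" i] norm_fst_le [of "fst p" "snd p"] by simp

text \<open>The chord from \<open>p\<close> to its mirror image is a multiple of
  \<open>coord_diff i j\<close>, so the curvature bound isolates a coordinate difference of
  \<open>w\<close>. The image stays in the ball because \<open>z\<close> lies on the mirror.\<close>

lemma curved_normals_swap:
  fixes G :: "((real ^ 'n::finite) \<times> real) set"
  assumes G: "permutation_invariant G" and "i \<noteq> j" "fst z $ i = fst z $ j"
    and C: "\<And>y p q w. \<lbrakk>y \<in> G \<inter> ball z r; p \<in> G \<inter> ball z r; q \<in> G \<inter> ball z r; w \<in> limiting_normal_cone G y\<rbrakk> \<Longrightarrow>
       \<bar>w \<bullet> (p - q)\<bar> \<le> C * norm w * norm (p - q) * (norm (p - y) + norm (q - y))"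
    and y: "y \<in> G \<inter> ball z r" and p: "p \<in> G \<inter> ball z r" and w: "w \<in> limiting_normal_cone G y"
  shows "\<bar>fst p $ i - fst p $ j\<bar> * \<bar>fst w $ i - fst w $ j\<bar>
    \<le> C * norm w * (sqrt 2 * \<bar>fst p $ i - fst p $ j\<bar>)
      * (norm (p - y) + norm (permute (Transposition.transpose i j) p - y))"
proof -
  let ?s = "permute (Transposition.transpose i j) p"
  have "?s \<in> G" using p by (intro permutation_invariantD [OF G]) auto
  moreover have "?s \<in> ball z r"
    using norm_permute_transpose_diff [of i j z p] assms(2,3) p by (auto simp: dist_norm norm_minus_commute)
  ultimately have "\<bar>w \<bullet> (p - ?s)\<bar> \<le> C * norm w * norm (p - ?s) * (norm (p - y) + norm (?s - y))"
    using y p w by (intro C) auto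
  moreover have "p - ?s = (fst p $ i - fst p $ j) *\<^sub>R coord_diff i j"
    using \<open>i \<noteq> j\<close> by (simp add: permute_transpose)
  ultimately show ?thesis
    by (simp add: inner_coord_diff norm_coord_diff \<open>i \<noteq> j\<close> abs_mult ac_simps)
qed

text \<open>
  If a normal distinguishes two coordinates at points arbitrarily near \<open>z\<close> where these coordinates
  agree, then \<open>coord_diff i j\<close> is normal at \<open>z\<close>, and the set cannot separate the two coordinates
  near \<open>z\<close>.
\<close>

lemma coordinate_dichotomy:
  fixes G :: "((real ^ 'n::finite) \<times> real) set"
  assumes G: "permutation_invariant G" and curved: "curved_normals G z" and "z \<in> G"
    and "i \<noteq> j" and z: "fst z $ i = fst z $ j"
  shows "(\<forall>\<^sub>F y in nhds z. y \<in> G \<longrightarrow> fst y $ i = fst y $ j) \<or>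
    (\<forall>\<^sub>F y in nhds z. y \<in> G \<longrightarrow> fst y $ i = fst y $ j \<longrightarrow>
      (\<forall>w \<in> limiting_normal_cone G y. fst w $ i = fst w $ j))"
proof (rule disjCI)
  assume neg: "\<not> (\<forall>\<^sub>F y in nhds z. y \<in> G \<longrightarrow> fst y $ i = fst y $ j \<longrightarrow>
      (\<forall>w \<in> limiting_normal_cone G y. fst w $ i = fst w $ j))"
  obtain C r where "0 \<le> C" "0 < r" and C: "\<And>y p q w. \<lbrakk>y \<in> G \<inter> ball z r; p \<in> G \<inter> ball z r; q \<in> G \<inter> ball z r;
      w \<in> limiting_normal_cone G y\<rbrakk> \<Longrightarrow>
      \<bar>w \<bullet> (p - q)\<bar> \<le> C * norm w * norm (p - q) * (norm (p - y) + norm (q - y))"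
    using curved unfolding curved_normals_def by blast
  have swap: "\<bar>fst p $ i - fst p $ j\<bar> * \<bar>fst w $ i - fst w $ j\<bar>
    \<le> C * norm w * (sqrt 2 * \<bar>fst p $ i - fst p $ j\<bar>)
      * (norm (p - y) + norm (permute (Transposition.transpose i j) p - y))"
    if "y \<in> G \<inter> ball z r" "p \<in> G \<inter> ball z r" "w \<in> limiting_normal_cone G y" for y p w
    by (rule curved_normals_swap [OF G \<open>i \<noteq> j\<close> z _ that]) (rule C)
  let ?e = "coord_diff i j :: (real ^ 'n) \<times> real"
  \<comment> \<open>One such \<open>w\<close> controls \<open>fst p $ i - fst p $ j\<close> to
    second order, but with a constant that depends on \<open>w\<close> and may grow as
    \<open>y\<close> tends to \<open>z\<close>. The fixed vector \<open>?e\<close>, normal at every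
    such \<open>y\<close>, survives the limit.\<close>
  have normal: "?e \<in> frechet_normal_cone G y"
    if y: "y \<in> G" "dist z y < r" "fst y $ i = fst y $ j"
      and w: "w \<in> limiting_normal_cone G y" "fst w $ i \<noteq> fst w $ j" for y w
  proof (rule frechet_normal_cone_quadraticI)
    define \<mu> where "\<mu> = \<bar>fst w $ i - fst w $ j\<bar>"
    define K where "K = C * norm w * sqrt 2 * 2"
    have "0 < \<mu>" using w(2) by (simp add: \<mu>_def)
    have "0 \<le> K" using \<open>0 \<le> C\<close> by (simp add: K_def)
    show "0 < r - dist z y" using y by simp
    show "?e \<bullet> (p - y) \<le> K / \<mu> * sqrt 2 * (norm (p - y))\<^sup>2" if p: "p \<in> G" "norm (p - y) < r - dist z y" for p
    proof -
      let ?d = "\<bar>fst p $ i - fst p $ j\<bar>"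
      have "dist z p < r" using p(2) dist_triangle [of z p y] by (simp add: dist_norm norm_minus_commute)
      have ey: "?e \<bullet> (p - y) = fst p $ i - fst p $ j"
        using inner_coord_diff [of "p - y" i j] y(3) by (simp add: inner_commute)
      have "\<bar>?e \<bullet> (p - y)\<bar> \<le> norm ?e * norm (p - y)" by (rule Cauchy_Schwarz_ineq2)
      then have d: "?d \<le> sqrt 2 * norm (p - y)" by (simp add: ey norm_coord_diff \<open>i \<noteq> j\<close>)
      have "?d * \<mu> \<le> K * norm (p - y) * ?d"
        using swap [of y p w] y p(1) \<open>dist z p < r\<close> w(1) norm_permute_transpose_diff [OF \<open>i \<noteq> j\<close> y(3), of p]
        by (simp add: \<mu>_def K_def ac_simps)
      also have "\<dots> \<le> K * norm (p - y) * (sqrt 2 * norm (p - y))"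
        using d \<open>0 \<le> K\<close> by (intro mult_left_mono) auto
      finally have "?d \<le> K / \<mu> * sqrt 2 * (norm (p - y))\<^sup>2"
        using \<open>0 < \<mu>\<close> by (simp add: field_simps power2_eq_square)
      then show ?thesis using ey by linarith
    qed
  qed
  have "\<exists>y. y \<in> G \<and> dist y z < d \<and> ?e \<in> frechet_normal_cone G y" if "0 < d" for d
  proof -
    have "0 < min d r" using that \<open>0 < r\<close> by simp
    then obtain y w where "dist y z < min d r" "y \<in> G" "fst y $ i = fst y $ j"
        "w \<in> limiting_normal_cone G y" "fst w $ i \<noteq> fst w $ j"
      using neg unfolding eventually_nhds_metric by meson
    then show ?thesis using normal [of y w] by (intro exI [of _ y]) (simp add: dist_commute)
  qed
  then have "\<exists>y. y \<in> G \<and> dist y z < inverse (real (Suc n)) \<and> ?e \<in> frechet_normal_cone G y" for n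
    by simp
  then obtain ys where ys: "\<And>n. ys n \<in> G" "\<And>n. dist (ys n) z < inverse (real (Suc n))"
      "\<And>n. ?e \<in> frechet_normal_cone G (ys n)"
    by metis
  have "ys \<longlonglongrightarrow> z"
  proof (rule Lim_null_comparison [THEN LIM_zero_cancel])
    show "(\<lambda>n. inverse (real (Suc n))) \<longlonglongrightarrow> 0" by (rule LIMSEQ_inverse_real_of_nat)
  qed (use ys(2) in \<open>auto simp: dist_norm intro!: always_eventually less_imp_le\<close>)
  then have ez: "?e \<in> limiting_normal_cone G z"
    by (intro limiting_normal_coneI [of ys G "\<lambda>_. ?e"]) (simp_all add: ys)
  \<comment> \<open>For \<open>w = ?e\<close> at \<open>z\<close> the coordinate difference is 2 and
    the norm is \<open>sqrt 2\<close>, so the swap estimate allows a nonzero \<open>?d\<close> only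
    if \<open>1 \<le> 2 * C * norm (y - z)\<close>. The summand 1 covers
    \<open>C = 0\<close>.\<close>
  define d where "d = min r (1 / (2 * C + 1))"
  have "fst y $ i = fst y $ j" if y: "y \<in> G" "dist y z < d" for y
  proof (rule ccontr)
    assume ne: "fst y $ i \<noteq> fst y $ j"
    let ?d = "\<bar>fst y $ i - fst y $ j\<bar>"
    have "?d * 2 \<le> C * sqrt 2 * (sqrt 2 * ?d) * (2 * norm (y - z))"
      using swap [of z y ?e] \<open>z \<in> G\<close> \<open>0 < r\<close> y ez norm_permute_transpose_diff [OF \<open>i \<noteq> j\<close> z, of y] \<open>i \<noteq> j\<close>
      by (simp add: d_def dist_commute norm_coord_diff) (simp add: coord_diff_def axis_def)
    also have "\<dots> = ?d * (4 * C * norm (y - z))" by simp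
    finally have "1 \<le> 2 * C * norm (y - z)" using ne by simp
    also have "\<dots> \<le> (2 * C + 1) * norm (y - z)" by (simp add: algebra_simps)
    also have "\<dots> < 1" using y(2) \<open>0 \<le> C\<close> by (simp add: d_def dist_norm field_simps)
    finally show False by simp
  qed
  moreover have "0 < d" using \<open>0 < r\<close> \<open>0 \<le> C\<close> by (simp add: d_def)
  ultimately show "\<forall>\<^sub>F y in nhds z. y \<in> G \<longrightarrow> fst y $ i = fst y $ j"
    unfolding eventually_nhds_metric by blast
qed

lemma limiting_normal_cone_add_orthogonal:
  assumes "\<And>p q. p \<in> S \<Longrightarrow> q \<in> S \<Longrightarrow> u \<bullet> (p - q) = 0" "v \<in> limiting_normal_cone S y"
  shows "v + u \<in> limiting_normal_cone S y"
proof -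
  obtain xs vs where *: "\<And>i. xs i \<in> S" "\<And>i. vs i \<in> frechet_normal_cone S (xs i)"
    "xs \<longlonglongrightarrow> y" "vs \<longlonglongrightarrow> v" by (rule limiting_normal_coneE [OF assms(2)]) (rule that)
  show ?thesis
  proof (rule limiting_normal_coneI [of xs _ "\<lambda>i. vs i + u"])
    show "vs i + u \<in> frechet_normal_cone S (xs i)" for i
      using *(1,2) assms(1) by (simp add: frechet_normal_cone_def inner_add_left)
    show "(\<lambda>i. vs i + u) \<longlonglongrightarrow> v + u" by (intro tendsto_add * tendsto_const)
  qed (use * in auto)
qed

section \<open>Dependence of diagonal matrices on the frame\<close>

lemma norm_symmat_le_qform:
  fixes V :: "'n::finite symmat"
  assumes W: "orthogonal_matrix W" and B: "\<And>i j. \<bar>qform V (W $ i) (W $ j)\<bar> \<le> B"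
  shows "norm V \<le> real CARD('n) ^ 3 * B"
proof -
  obtain R x where R: "orthogonal_matrix R" "V = spec R x" by (rule spectral_theorem_symmat)
  have 1: "\<bar>R $ k \<bullet> W $ i\<bar> \<le> 1" for i k by (rule abs_row_inner_le_1 [OF R(1) W])
  have "0 \<le> B" using B [of undefined undefined] by linarith
  \<comment> \<open>Each eigenvalue is a double sum of entries in the frame \<open>W\<close> with
    factors at most 1, whence two powers of the dimension; the third comes from bounding the norm of
    \<open>x\<close> by the sum of its absolute coordinates.\<close>
  have "\<bar>x $ k\<bar> \<le> real CARD('n) ^ 2 * B" for k
  proof -
    have "x $ k = qform V (R $ k) (R $ k)"
      by (simp add: R(2) qform_spec_same [OF R(1)])
    also have "\<dots> = (\<Sum>i\<in>UNIV. \<Sum>j\<in>UNIV. (W $ i \<bullet> R $ k) * ((W $ j \<bullet> R $ k) * qform V (W $ i) (W $ j)))"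
    proof -
      have "qform V (W $ i) (R $ k) = (\<Sum>j\<in>UNIV. (W $ j \<bullet> R $ k) * qform V (W $ i) (W $ j))" for i
      proof -
        have "qform V (W $ i) (R $ k) = qform V (R $ k) (W $ i)" by (rule qform_commute)
        also have "\<dots> = (\<Sum>j\<in>UNIV. (W $ j \<bullet> R $ k) * qform V (W $ j) (W $ i))"
          by (rule qform_expand [OF W])
        also have "\<dots> = (\<Sum>j\<in>UNIV. (W $ j \<bullet> R $ k) * qform V (W $ i) (W $ j))"
          by (intro sum.cong refl arg_cong2 [of _ _ _ _ "(*)"] qform_commute)
        finally show ?thesis .
      qed
      then show ?thesis
        unfolding qform_expand [OF W, of V "R $ k" "R $ k"] by (simp add: sum_distrib_left)
    qed
    finally have x: "x $ k = (\<Sum>i\<in>UNIV. \<Sum>j\<in>UNIV.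
      (W $ i \<bullet> R $ k) * ((W $ j \<bullet> R $ k) * qform V (W $ i) (W $ j)))" .
    have "\<bar>x $ k\<bar> \<le> (\<Sum>i\<in>(UNIV :: 'n set). \<Sum>j\<in>(UNIV :: 'n set). 1 * (1 * B))"
      unfolding x
    proof (intro order_trans [OF sum_abs] sum_mono)
      show "\<bar>(W $ i \<bullet> R $ k) * ((W $ j \<bullet> R $ k) * qform V (W $ i) (W $ j))\<bar> \<le> 1 * (1 * B)" for i j
        unfolding abs_mult using 1 [of k i] 1 [of k j] B [of i j] \<open>0 \<le> B\<close>
        by (intro mult_mono) (auto simp: inner_commute)
    qed
    then show ?thesis by (simp add: power2_eq_square)
  qed
  then have "(\<Sum>k\<in>UNIV. \<bar>x $ k\<bar>) \<le> (\<Sum>k\<in>(UNIV :: 'n set). real CARD('n) ^ 2 * B)"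
    by (intro sum_mono)
  then have "norm x \<le> real CARD('n) * (real CARD('n) ^ 2 * B)"
    using norm_le_l1_cart [of x] by simp
  then show ?thesis
    by (simp add: R(2) norm_spec [OF R(1)] power3_eq_cube power2_eq_square mult.assoc)
qed

text \<open>By \<open>norm_spec_diff\<close> both sides carry the same weights, which depend on the
  frames alone, so the comparison is term by term.\<close>

lemma norm_spec_diff_lipschitz:
  assumes U: "orthogonal_matrix U" and W: "orthogonal_matrix W" and "0 \<le> K"
    and x: "\<And>i j. \<bar>x $ i - x $ j\<bar> \<le> K * \<bar>y $ i - y $ j\<bar>"
  shows "norm (spec U x - spec W x) \<le> K * norm (spec U y - spec W y)"
proof (rule power2_le_imp_le)
  have "(x $ i - x $ j)\<^sup>2 \<le> K\<^sup>2 * (y $ i - y $ j)\<^sup>2" for i j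
    using power_mono [OF x [of i j] abs_ge_zero, of 2] by (simp add: power_mult_distrib)
  then have "(norm (spec U x - spec W x))\<^sup>2
      \<le> (\<Sum>i\<in>UNIV. \<Sum>j\<in>UNIV. (U $ i \<bullet> W $ j)\<^sup>2 * (K\<^sup>2 * (y $ i - y $ j)\<^sup>2))"
    unfolding norm_spec_diff [OF U W] by (intro sum_mono mult_left_mono) auto
  also have "\<dots> = (K * norm (spec U y - spec W y))\<^sup>2"
    unfolding power_mult_distrib norm_spec_diff [OF U W] by (simp add: sum_distrib_left ac_simps)
  finally show "(norm (spec U x - spec W x))\<^sup>2 \<le> (K * norm (spec U y - spec W y))\<^sup>2" .
qed (use \<open>0 \<le> K\<close> in simp)

text \<open>Blocks are the level sets of \<open>c\<close>. If \<open>A\<close> is a union of blocks,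
  this is the orthogonal projection onto the vectors that vanish off \<open>A\<close> and sum to 0
  on every block.\<close>

definition centered :: "('n \<Rightarrow> real) \<Rightarrow> 'n set \<Rightarrow> real ^ 'n::finite \<Rightarrow> real ^ 'n" where
  "centered c A x = (\<chi> i. if i \<in> A then x $ i - (\<Sum>k | c k = c i. x $ k) / card {k. c k = c i} else 0)"

lemma inner_centered:
  assumes sat: "\<And>i j. i \<in> A \<Longrightarrow> c i = c j \<Longrightarrow> j \<in> A"
    and u: "\<And>i j. i \<in> A \<Longrightarrow> c i = c j \<Longrightarrow> u $ i = u $ j"
  shows "centered c A x \<bullet> u = 0"
proof -
  \<comment> \<open>The matrix that averages over the blocks in \<open>A\<close>. It is symmetric
    with row sums 1 on \<open>A\<close>, so averaging \<open>x\<close> there does not change its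
    pairing with a vector that is constant on those blocks.\<close>
  define E where "E = (\<lambda>i k. if i \<in> A \<and> c i = c k then 1 / real (card {l. c l = c i}) else 0)"
  have E_commute: "E i k = E k i" for i k
    using sat [of i k] sat [of k i] by (auto simp: E_def)
  have row: "(\<Sum>k\<in>UNIV. E i k * f k) = (\<Sum>k | c k = c i. f k) / card {k. c k = c i}" if "i \<in> A" for i f
  proof -
    have "(\<Sum>k | c k = c i. f k) / card {k. c k = c i} = (\<Sum>k | c k = c i. E i k * f k)"
      unfolding sum_divide_distrib by (intro sum.cong) (auto simp: E_def that)
    also have "\<dots> = (\<Sum>k\<in>UNIV. E i k * f k)"
      by (intro sum.mono_neutral_left) (auto simp: E_def)
    finally show ?thesis by simp
  qed
  have one: "(\<Sum>k\<in>UNIV. E i k) = (if i \<in> A then 1 else 0)" for i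
  proof (cases "i \<in> A")
    case True
    then have "i \<in> {k. c k = c i}" by simp
    then have "card {k. c k = c i} \<noteq> 0" by (metis card_0_eq empty_iff finite)
    with True show ?thesis using row [OF True, of "\<lambda>_. 1"] by simp
  qed (simp add: E_def)
  have "(\<Sum>i\<in>UNIV. \<Sum>k\<in>UNIV. E i k * x $ k * u $ i) = (\<Sum>i\<in>UNIV. \<Sum>k\<in>UNIV. E k i * x $ k * u $ k)"
    by (intro sum.cong refl) (use u E_commute in \<open>auto simp: E_def\<close>)
  also have "\<dots> = (\<Sum>k\<in>UNIV. x $ k * u $ k * (\<Sum>i\<in>UNIV. E k i))"
    by (subst sum.swap) (simp add: sum_distrib_left ac_simps)
  also have "\<dots> = (\<Sum>i\<in>UNIV. if i \<in> A then x $ i * u $ i else 0)"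
    by (simp add: one if_distrib [of "\<lambda>t. _ * t"] cong: if_cong)
  finally have "(\<Sum>i\<in>UNIV. if i \<in> A then x $ i * u $ i else 0)
      = (\<Sum>i\<in>UNIV. (\<Sum>k\<in>UNIV. E i k * x $ k) * u $ i)" by (simp add: sum_distrib_right)
  moreover have "centered c A x $ i * u $ i
      = (if i \<in> A then x $ i * u $ i else 0) - (\<Sum>k\<in>UNIV. E i k * x $ k) * u $ i" for i
    by (cases "i \<in> A") (simp_all add: centered_def row left_diff_distrib, simp add: E_def)
  ultimately show ?thesis by (simp add: inner_vec_def sum_subtractf)
qed

lemma sum_level_centered:
  assumes "\<And>i j. i \<in> A \<Longrightarrow> c i = c j \<Longrightarrow> j \<in> A"
  shows "(\<Sum>k | c k = a. centered c A x $ k) = 0"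
proof -
  have "(\<Sum>k | c k = a. centered c A x $ k) = centered c A x \<bullet> (\<chi> k. if c k = a then 1 else 0)"
    by (simp add: inner_vec_def if_distrib [of "\<lambda>t. _ * t"] sum.If_cases cong: if_cong)
  also have "\<dots> = 0" by (rule inner_centered) (use assms in auto)
  finally show ?thesis .
qed

lemma abs_level_mean_le:
  fixes c :: "'n::finite \<Rightarrow> real"
  assumes "\<And>k. \<bar>f k\<bar> \<le> (B :: real)"
  shows "\<bar>(\<Sum>k | c k = c i. f k) / card {k. c k = c i}\<bar> \<le> B"
proof -
  have "i \<in> {k. c k = c i}" by simp
  then have "0 < card {k. c k = c i}" by (metis card_gt_0_iff empty_iff finite)
  moreover have "\<bar>\<Sum>k | c k = c i. f k\<bar> \<le> (\<Sum>k | c k = c i. B)"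
    by (intro order_trans [OF sum_abs] sum_mono assms)
  ultimately show ?thesis by (simp add: field_simps)
qed

text \<open>Split \<open>v = m + z\<close> with \<open>z\<close> centered on the blocks in
  \<open>A\<close>. The part \<open>m\<close> has bounded divided differences with respect to
  \<open>y\<close>, so a change of frame moves its matrix little. For \<open>z\<close> no such bound
  is available; instead \<open>spec U z\<close> is approximated by \<open>spec W' z'\<close> with
  \<open>z'\<close> again centered, and \<open>q = z' - z\<close>.\<close>

lemma transport_estimate:
  fixes U W :: "real ^ 'n::finite ^ 'n" and y v :: "real ^ 'n" and c :: "'n \<Rightarrow> real"
  assumes U: "orthogonal_matrix U" and W: "orthogonal_matrix W"
    and "0 < g" and gap: "\<And>i j. c i \<noteq> c j \<Longrightarrow> g \<le> \<bar>y $ i - y $ j\<bar>"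
    and sat: "\<And>i j. i \<in> A \<Longrightarrow> c i = c j \<Longrightarrow> j \<in> A"
    and A: "\<And>i j. i \<in> A \<Longrightarrow> c i = c j \<Longrightarrow> y $ i = y $ j"
    and K: "norm v \<le> K" and "0 \<le> L" and L: "\<And>i j. i \<notin> A \<Longrightarrow> c i = c j \<Longrightarrow> \<bar>v $ i - v $ j\<bar> \<le> L * K * \<bar>y $ i - y $ j\<bar>"
  obtains W' q where "orthogonal_matrix W'" "spec W' y = spec W y"
    "\<forall>u. (\<forall>i\<in>A. \<forall>j. c i = c j \<longrightarrow> u $ i = u $ j) \<longrightarrow> q \<bullet> u = 0"
    "norm (spec U v - spec W' (v + q))
      \<le> (L + 2 / g + 2 * real CARD('n) ^ 5 / g) * K * norm (spec U y - spec W y)"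
proof -
  define t where "t = norm (spec U y - spec W y)"
  define n where "n = real CARD('n)"
  have "1 \<le> n" by (simp add: n_def Suc_leI)
  have vle: "\<bar>v $ i\<bar> \<le> K" for i using component_le_norm_cart [of v i] K by linarith
  have "0 \<le> K" using norm_ge_zero [of v] K by linarith
  define z where "z = centered c A v"
  define m where "m = v - z"
  have m: "m $ i = (if i \<in> A then (\<Sum>k | c k = c i. v $ k) / card {k. c k = c i} else v $ i)" for i
    by (simp add: m_def z_def centered_def)
  have m_le: "\<bar>m $ i\<bar> \<le> K" for i
    using abs_level_mean_le [of "($) v", OF vle] vle by (simp add: m)
  have z_le: "\<bar>z $ i\<bar> \<le> 2 * K" for i
    using m_le [of i] vle [of i] by (simp add: m_def abs_le_iff)
  have z_out: "z $ i = 0" if "i \<notin> A" for i using that by (simp add: z_def centered_def)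
  \<comment> \<open>A frame of \<open>spec W y\<close> may be rotated inside the eigenspaces. This
    freedom is spent on removing the off-diagonal entries of \<open>spec U z\<close> there, in
    particular within the blocks in \<open>A\<close>.\<close>
  obtain W' where W': "orthogonal_matrix W'" "spec W' y = spec W y"
    and off: "\<And>i j. i \<noteq> j \<Longrightarrow> y $ i = y $ j \<Longrightarrow> qform (spec U z) (W' $ i) (W' $ j) = 0"
    by (rule diagonalize_in_eigenspaces [OF W, of y "spec U z"]) (rule that)
  define b :: "real ^ 'n" where "b = (\<chi> i. qform (spec U z) (W' $ i) (W' $ i))"
  define z' where "z' = centered c A b"
  have t: "norm (spec U y - spec W' y) = t" by (simp add: t_def W'(2))
  then have "0 \<le> t" by (metis norm_ge_zero)
  define \<tau> where "\<tau> = t / g"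
  have "0 \<le> \<tau>" using \<open>0 \<le> t\<close> \<open>0 < g\<close> by (simp add: \<tau>_def)
  define P where "P = (\<lambda>k i. U $ k \<bullet> W' $ i)"
  have P1: "\<bar>P k i\<bar> \<le> 1" for k i unfolding P_def by (rule abs_row_inner_le_1 [OF U W'(1)])
  \<comment> \<open>A single term of the double sum for the square of \<open>t\<close>: the gap
    \<open>g\<close> forces frame vectors of different blocks to be nearly orthogonal.\<close>
  have Ptau: "\<bar>P k i\<bar> \<le> \<tau>" if "c k \<noteq> c i" for k i
  proof -
    have "(P k i)\<^sup>2 * (y $ k - y $ i)\<^sup>2 \<le> (\<Sum>j\<in>UNIV. (P k j)\<^sup>2 * (y $ k - y $ j)\<^sup>2)"
      by (rule member_le_sum) auto
    also have "\<dots> \<le> (\<Sum>k\<in>UNIV. \<Sum>j\<in>UNIV. (P k j)\<^sup>2 * (y $ k - y $ j)\<^sup>2)"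
      by (rule member_le_sum [of k UNIV "\<lambda>k. \<Sum>j\<in>UNIV. (P k j)\<^sup>2 * (y $ k - y $ j)\<^sup>2"]) (auto intro: sum_nonneg)
    also have "\<dots> = t\<^sup>2" using norm_spec_diff [OF U W'(1), of y y] by (simp add: P_def t)
    finally have "\<bar>P k i * (y $ k - y $ i)\<bar> \<le> \<bar>t\<bar>"
      by (simp add: abs_le_square_iff power_mult_distrib)
    then have "\<bar>P k i\<bar> * \<bar>y $ k - y $ i\<bar> \<le> t" using \<open>0 \<le> t\<close> by (simp add: abs_mult)
    moreover have "\<bar>P k i\<bar> * g \<le> \<bar>P k i\<bar> * \<bar>y $ k - y $ i\<bar>"
      by (intro mult_left_mono gap that) simp
    ultimately show ?thesis using \<open>0 < g\<close> by (simp add: \<tau>_def field_simps)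
  qed
  have Psq: "(P k i)\<^sup>2 \<le> \<bar>P k i\<bar>" for k i
    using mult_left_mono [OF P1 [of k i] abs_ge_zero [of "P k i"]] by (simp add: power2_eq_square flip: abs_mult)
  have Pprod: "\<bar>P k i * P k j\<bar> \<le> \<tau>" if "c k \<noteq> c i \<or> c k \<noteq> c j" for k i j
    using that
  proof
    assume "c k \<noteq> c i"
    then show ?thesis
      using mult_mono [OF Ptau P1 [of k j]] \<open>0 \<le> \<tau>\<close> by (simp add: abs_mult)
  next
    assume "c k \<noteq> c j"
    then show ?thesis
      using mult_mono [OF P1 [of k i] Ptau] by (simp add: abs_mult)
  qed
  have qf: "qform (spec U z) (W' $ i) (W' $ j) = (\<Sum>k\<in>UNIV. z $ k * (P k i * P k j))" for i j
    by (simp add: qform_spec P_def)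
  have sum_le: "\<bar>\<Sum>k\<in>UNIV. z $ k * f k\<bar> \<le> n * (2 * K) * B"
    if "0 \<le> B" "\<And>k. z $ k \<noteq> 0 \<Longrightarrow> \<bar>f k\<bar> \<le> B" for f B
  proof -
    have "\<bar>\<Sum>k\<in>UNIV. z $ k * f k\<bar> \<le> (\<Sum>k\<in>(UNIV :: 'n set). 2 * K * B)"
    proof (intro order_trans [OF sum_abs] sum_mono)
      show "\<bar>z $ k * f k\<bar> \<le> 2 * K * B" for k
        using z_le [of k] that \<open>0 \<le> K\<close> by (cases "z $ k = 0") (auto simp: abs_mult intro!: mult_mono)
    qed
    then show ?thesis by (simp add: n_def)
  qed
  have small: "n * (2 * K) * \<tau> \<le> 2 * n ^ 2 * K * \<tau>"
  proof -
    have "n * (2 * K * \<tau>) \<le> n\<^sup>2 * (2 * K * \<tau>)"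
      using \<open>1 \<le> n\<close> \<open>0 \<le> \<tau>\<close> \<open>0 \<le> K\<close> by (intro mult_right_mono) (auto simp: power2_eq_square)
    then show ?thesis by (simp add: ac_simps)
  qed
  \<comment> \<open>Because \<open>z\<close> sums to 0 over the block, the weight of each
    \<open>k\<close> in the block may be lowered by 1. What remains is the mass that leaks between
    blocks, at most \<open>n * \<tau>\<close> for every \<open>k\<close>.\<close>
  have level_mean: "\<bar>(\<Sum>k | c k = c i. b $ k) / card {k. c k = c i}\<bar> \<le> 2 * n ^ 2 * K * \<tau>" for i
  proof -
    let ?I = "{k. c k = c i}"
    have "(\<Sum>l\<in>?I. b $ l) = (\<Sum>k\<in>UNIV. z $ k * (\<Sum>l\<in>?I. (P k l)\<^sup>2))"
      by (simp add: b_def qf power2_eq_square sum_distrib_left sum.swap [of _ UNIV])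
    also have "\<dots> = (\<Sum>k\<in>UNIV. z $ k * ((\<Sum>l\<in>?I. (P k l)\<^sup>2) - (if k \<in> ?I then 1 else 0)))"
    proof -
      have "(\<Sum>k\<in>UNIV. z $ k * (if k \<in> ?I then 1 else 0)) = (\<Sum>k\<in>?I. z $ k)"
        by (simp add: if_distrib [of "\<lambda>t. _ * t"] sum.If_cases cong: if_cong)
      also have "\<dots> = 0" unfolding z_def by (rule sum_level_centered [OF sat])
      finally show ?thesis by (simp add: right_diff_distrib sum_subtractf)
    qed
    also have "\<bar>\<dots>\<bar> \<le> n * (2 * K) * (n * \<tau>)"
    proof (rule sum_le)
      show "0 \<le> n * \<tau>" using \<open>1 \<le> n\<close> \<open>0 \<le> \<tau>\<close> by simp
      fix k
      have part: "(\<Sum>l\<in>S. (P k l)\<^sup>2) \<le> n * \<tau>" if "\<And>l. l \<in> S \<Longrightarrow> c k \<noteq> c l" for S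
      proof -
        have "(\<Sum>l\<in>S. (P k l)\<^sup>2) \<le> (\<Sum>l\<in>S. \<tau>)"
          by (intro sum_mono) (use that Psq Ptau order_trans in blast)
        also have "\<dots> \<le> n * \<tau>"
          using \<open>0 \<le> \<tau>\<close> card_mono [of UNIV S] by (auto simp: n_def intro: mult_right_mono)
        finally show ?thesis .
      qed
      show "\<bar>(\<Sum>l\<in>?I. (P k l)\<^sup>2) - (if k \<in> ?I then 1 else 0)\<bar> \<le> n * \<tau>"
      proof (cases "k \<in> ?I")
        case True
        have "(\<Sum>l\<in>UNIV. (P k l)\<^sup>2) = 1"
          unfolding P_def by (rule sum_row_squares(1) [OF U W'(1)])
        moreover have "(\<Sum>l\<in>UNIV. (P k l)\<^sup>2) = (\<Sum>l\<in>UNIV - ?I. (P k l)\<^sup>2) + (\<Sum>l\<in>?I. (P k l)\<^sup>2)"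
          by (rule sum.subset_diff) auto
        moreover have "(\<Sum>l\<in>UNIV - ?I. (P k l)\<^sup>2) \<le> n * \<tau>" using True by (intro part) auto
        moreover have "0 \<le> (\<Sum>l\<in>UNIV - ?I. (P k l)\<^sup>2)" by (intro sum_nonneg) simp
        ultimately show ?thesis using True by simp
      next
        case False
        have "0 \<le> (\<Sum>l\<in>?I. (P k l)\<^sup>2)" by (intro sum_nonneg) simp
        with False part [of ?I] show ?thesis by auto
      qed
    qed
    finally have "\<bar>\<Sum>l\<in>?I. b $ l\<bar> \<le> 2 * n ^ 2 * K * \<tau>"
      by (simp add: power2_eq_square ac_simps)
    moreover have "i \<in> ?I" by simp
    then have "0 < card ?I" by (metis card_gt_0_iff empty_iff finite)
    then have "\<bar>\<Sum>l\<in>?I. b $ l\<bar> / card ?I \<le> \<bar>\<Sum>l\<in>?I. b $ l\<bar> / 1"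
      by (intro divide_left_mono) auto
    ultimately show ?thesis by simp
  qed
  have entry: "\<bar>qform (spec U z - spec W' z') (W' $ i) (W' $ j)\<bar> \<le> 2 * n ^ 2 * K * \<tau>" for i j
  proof -
    have q: "qform (spec U z - spec W' z') (W' $ i) (W' $ j)
        = qform (spec U z) (W' $ i) (W' $ j) - (if i = j then z' $ i else 0)"
      by (simp add: qform_diff qform_spec_same [OF W'(1)])
    \<comment> \<open>Entries between blocks, and entries in a block off \<open>A\<close>, where
      \<open>z\<close> vanishes, involve only products with a factor across blocks. In a block in
      \<open>A\<close>, off-diagonal entries are 0 by the choice of \<open>W'\<close>, and on the
      diagonal the centering of \<open>b\<close> leaves just the block mean.\<close>
    consider "c i \<noteq> c j" | "c i = c j" "i \<in> A" "i \<noteq> j" | "i = j" "i \<in> A" | "c i = c j" "i \<notin> A" by blast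
    then show ?thesis
    proof cases
      case 1
      then have "\<bar>qform (spec U z) (W' $ i) (W' $ j)\<bar> \<le> n * (2 * K) * \<tau>"
        unfolding qf by (intro sum_le \<open>0 \<le> \<tau>\<close> Pprod) auto
      moreover have "i \<noteq> j" using 1 by blast
      ultimately show ?thesis using small q by simp
    next
      case 2
      then show ?thesis using off A \<open>0 \<le> \<tau>\<close> \<open>0 \<le> K\<close> by (simp add: q)
    next
      case 3
      then have "qform (spec U z) (W' $ i) (W' $ j) - (if i = j then z' $ i else 0)
          = (\<Sum>k | c k = c i. b $ k) / card {k. c k = c i}"
        by (simp add: z'_def centered_def b_def)
      with level_mean [of i] show ?thesis by (simp add: q)
    next
      case 4
      then have "z' $ i = 0" by (simp add: z'_def centered_def)
      have "\<bar>P k i * P k j\<bar> \<le> \<tau>" if "z $ k \<noteq> 0" for k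
        using that z_out [of k] sat [of k i] 4 by (intro Pprod) auto
      then have "\<bar>qform (spec U z) (W' $ i) (W' $ j)\<bar> \<le> n * (2 * K) * \<tau>"
        unfolding qf by (intro sum_le \<open>0 \<le> \<tau>\<close>)
      moreover have "(if i = j then z' $ i else 0) = 0" using \<open>z' $ i = 0\<close> by auto
      ultimately show ?thesis using small q by linarith
    qed
  qed
  have zz': "norm (spec U z - spec W' z') \<le> n ^ 3 * (2 * n ^ 2 * K * \<tau>)"
    unfolding n_def using norm_symmat_le_qform [OF W'(1) entry] by (simp add: n_def)
  have mm: "norm (spec U m - spec W' m) \<le> (L + 2 / g) * K * t"
    unfolding t [symmetric]
  proof (rule norm_spec_diff_lipschitz [OF U W'(1)])
    show "0 \<le> (L + 2 / g) * K" using \<open>0 \<le> K\<close> \<open>0 \<le> L\<close> \<open>0 < g\<close> by simp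
    fix i j
    have split: "(L + 2 / g) * K * \<bar>y $ i - y $ j\<bar>
        = L * K * \<bar>y $ i - y $ j\<bar> + 2 / g * K * \<bar>y $ i - y $ j\<bar>"
      by (simp add: algebra_simps)
    have nonneg: "0 \<le> L * K * \<bar>y $ i - y $ j\<bar>" "0 \<le> 2 / g * K * \<bar>y $ i - y $ j\<bar>"
      using \<open>0 \<le> K\<close> \<open>0 \<le> L\<close> \<open>0 < g\<close> by simp_all
    consider "c i \<noteq> c j" | "c i = c j" "i \<in> A" | "c i = c j" "i \<notin> A" by blast
    then show "\<bar>m $ i - m $ j\<bar> \<le> (L + 2 / g) * K * \<bar>y $ i - y $ j\<bar>"
    proof cases
      case 1
      have "\<bar>m $ i - m $ j\<bar> \<le> 2 / g * K * g"
        using m_le [of i] m_le [of j] \<open>0 < g\<close> by (simp add: abs_le_iff)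
      also have "\<dots> \<le> 2 / g * K * \<bar>y $ i - y $ j\<bar>"
        using gap [OF 1] \<open>0 < g\<close> \<open>0 \<le> K\<close> by (intro mult_left_mono) auto
      finally show ?thesis using nonneg split by linarith
    next
      case 2
      then have "m $ i = m $ j" using sat by (simp add: m)
      then show ?thesis using nonneg split by simp
    next
      case 3
      then have "j \<notin> A" using sat [of j i] by auto
      then have "\<bar>m $ i - m $ j\<bar> \<le> L * K * \<bar>y $ i - y $ j\<bar>"
        using L [of i j] 3 by (simp add: m)
      then show ?thesis using nonneg split by linarith
    qed
  qed
  show thesis
  proof (rule that [OF W', of "z' - z"])
    have "(z' - z) \<bullet> u = 0" if "\<And>i j. i \<in> A \<Longrightarrow> c i = c j \<Longrightarrow> u $ i = u $ j" for u
      using inner_centered [of A c u, OF sat that] by (simp add: inner_diff_left z_def z'_def)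
    then show "\<forall>u. (\<forall>i\<in>A. \<forall>j. c i = c j \<longrightarrow> u $ i = u $ j) \<longrightarrow> (z' - z) \<bullet> u = 0"
      by blast
    \<comment> \<open>As \<open>v + (z' - z) = m + z'\<close>, the two estimates add up. The fifth
      power of \<open>n\<close> consists of \<open>n ^ 3\<close> from the norm bound and
      \<open>n ^ 2\<close> from the entries.\<close>
    have "spec U v - spec W' (v + (z' - z)) = (spec U m - spec W' m) + (spec U z - spec W' z')"
      by (simp add: m_def spec_add spec_diff)
    then have "norm (spec U v - spec W' (v + (z' - z)))
        \<le> (L + 2 / g) * K * t + n ^ 3 * (2 * n ^ 2 * K * \<tau>)"
      using norm_triangle_mono [OF mm zz'] by simp
    also have "\<dots> = (L + 2 / g + 2 * n ^ 5 / g) * K * t"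
      by (simp add: \<tau>_def algebra_simps flip: power_add)
    finally show "norm (spec U v - spec W' (v + (z' - z)))
        \<le> (L + 2 / g + 2 * real CARD('n) ^ 5 / g) * K * norm (spec U y - spec W y)"
      by (simp add: n_def t_def)
  qed
qed

text \<open>Blocks are formed by equal coordinates of \<open>z\<close>, and \<open>A\<close>
  collects those whose coordinates agree along \<open>G\<close> near \<open>z\<close>. Off
  \<open>A\<close>, \<open>coordinate_dichotomy\<close> and the swap estimate bound the divided
  differences of normals; on \<open>A\<close>, a correction orthogonal to \<open>G\<close> is
  allowed.\<close>

lemma normal_transport:
  fixes G :: "((real ^ 'n::{finite, linorder}) \<times> real) set"
  assumes G: "permutation_invariant G" and curved: "curved_normals G z" and "z \<in> G"
  obtains D r where "0 \<le> D" "0 < r"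
    "\<And>U W y v. \<lbrakk>orthogonal_matrix U; orthogonal_matrix W; y \<in> G \<inter> ball z r; v \<in> limiting_normal_cone G y\<rbrakk> \<Longrightarrow>
      \<exists>w \<in> limiting_normal_cone (spectral_set G) (lift W y).
        norm (lift U v - w) \<le> D * norm v * norm (lift U y - lift W y)"
proof -
  obtain C r0 where "0 \<le> C" "0 < r0" and C: "\<And>y p q w. \<lbrakk>y \<in> G \<inter> ball z r0; p \<in> G \<inter> ball z r0;
      q \<in> G \<inter> ball z r0; w \<in> limiting_normal_cone G y\<rbrakk> \<Longrightarrow>
      \<bar>w \<bullet> (p - q)\<bar> \<le> C * norm w * norm (p - q) * (norm (p - y) + norm (q - y))"
    using curved unfolding curved_normals_def by blast
  define c where "c = ($) (fst z)"
  \<comment> \<open>Agreement with one partner \<open>j\<close> is asked for, and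
    \<open>j \<noteq> i\<close> keeps one-element blocks out. Invariance under the transposition of
    \<open>j\<close> and \<open>k\<close> extends the agreement to the whole block.\<close>
  define A where "A = {i. \<exists>j. j \<noteq> i \<and> c i = c j \<and> (\<forall>\<^sub>F y in nhds z. y \<in> G \<longrightarrow> fst y $ i = fst y $ j)}"
  have A_all: "\<forall>\<^sub>F y in nhds z. y \<in> G \<longrightarrow> fst y $ i = fst y $ k" if "i \<in> A" "c i = c k" for i k
  proof -
    obtain j where j: "j \<noteq> i" "c i = c j" "\<forall>\<^sub>F y in nhds z. y \<in> G \<longrightarrow> fst y $ i = fst y $ j"
      using \<open>i \<in> A\<close> unfolding A_def by blast
    consider "k = i" | "k = j" | "k \<noteq> i" "k \<noteq> j" by blast
    then show ?thesis
    proof cases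
      case 3
      obtain d where d: "0 < d" "\<And>y. dist y z < d \<Longrightarrow> y \<in> G \<Longrightarrow> fst y $ i = fst y $ j"
        using j(3) unfolding eventually_nhds_metric by blast
      have "fst y $ i = fst y $ k" if "dist y z < d" "y \<in> G" for y
      proof -
        let ?s = "permute (Transposition.transpose j k) y"
        have "fst z $ j = fst z $ k" using j(2) \<open>c i = c k\<close> by (simp add: c_def)
        then have "dist ?s z < d"
          using norm_permute_transpose_diff [of j k z y] 3 that(1) by (simp add: dist_norm)
        moreover have "?s \<in> G" by (rule permutation_invariantD [OF G _ that(2)]) simp
        ultimately have "fst ?s $ i = fst ?s $ j" by (rule d(2))
        then show ?thesis using j(1) 3 by (simp add: permute_def Transposition.transpose_def split: if_splits)
      qed
      then show ?thesis using d(1) unfolding eventually_nhds_metric by blast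
    qed (use j in auto)
  qed
  have sat: "k \<in> A" if "i \<in> A" "c i = c k" for i k
  proof (cases "k = i")
    case False
    have "\<forall>\<^sub>F y in nhds z. y \<in> G \<longrightarrow> fst y $ k = fst y $ i"
      using A_all [OF that] by (auto elim: eventually_mono)
    then show ?thesis using False that(2) unfolding A_def by auto
  qed (use that in simp)
  have B: "\<forall>\<^sub>F y in nhds z. y \<in> G \<longrightarrow> fst y $ i = fst y $ j \<longrightarrow>
      (\<forall>w \<in> limiting_normal_cone G y. fst w $ i = fst w $ j)" if "i \<notin> A" "c i = c j" for i j
  proof (cases "i = j")
    case False
    have "\<not> (\<forall>\<^sub>F y in nhds z. y \<in> G \<longrightarrow> fst y $ i = fst y $ j)"
      using that False unfolding A_def by auto
    then show ?thesis
      using coordinate_dichotomy [OF G curved \<open>z \<in> G\<close> False] that(2) unfolding c_def by simp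
  qed simp
  have ev: "\<forall>\<^sub>F y in nhds z. \<forall>i j. c i = c j \<longrightarrow>
      (i \<in> A \<longrightarrow> y \<in> G \<longrightarrow> fst y $ i = fst y $ j) \<and>
      (i \<notin> A \<longrightarrow> y \<in> G \<longrightarrow> fst y $ i = fst y $ j \<longrightarrow>
        (\<forall>w \<in> limiting_normal_cone G y. fst w $ i = fst w $ j))"
  proof (intro eventually_all_finite)
    show "\<forall>\<^sub>F y in nhds z. c i = c j \<longrightarrow>
      (i \<in> A \<longrightarrow> y \<in> G \<longrightarrow> fst y $ i = fst y $ j) \<and>
      (i \<notin> A \<longrightarrow> y \<in> G \<longrightarrow> fst y $ i = fst y $ j \<longrightarrow>
        (\<forall>w \<in> limiting_normal_cone G y. fst w $ i = fst w $ j))" for i j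
      using A_all [of i j] B [of i j] by (cases "c i = c j"; cases "i \<in> A") simp_all
  qed
  then obtain r1 where "0 < r1" and near: "\<And>y i j. \<lbrakk>dist y z < r1; y \<in> G; c i = c j\<rbrakk> \<Longrightarrow>
      (i \<in> A \<longrightarrow> fst y $ i = fst y $ j) \<and> (i \<notin> A \<longrightarrow> fst y $ i = fst y $ j \<longrightarrow>
        (\<forall>w \<in> limiting_normal_cone G y. fst w $ i = fst w $ j))"
    unfolding eventually_nhds_metric by blast
  \<comment> \<open>The element 1 covers the case that all coordinates of \<open>z\<close> agree.
    With \<open>g\<close> a quarter of the minimum, points within \<open>g\<close> of
    \<open>z\<close> keep coordinates of different blocks at least \<open>g\<close> apart.\<close>
  define gaps where "gaps = insert 1 ((\<lambda>(i, j). \<bar>c i - c j\<bar>) ` {(i, j). c i \<noteq> c j})"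
  define g where "g = Min gaps / 4"
  have "finite gaps" by (simp add: gaps_def)
  then have "Min gaps \<in> gaps" by (rule Min_in) (simp add: gaps_def)
  then have "0 < Min gaps" by (auto simp: gaps_def)
  then have "0 < g" by (simp add: g_def)
  have g: "4 * g \<le> \<bar>c i - c j\<bar>" if "c i \<noteq> c j" for i j
    unfolding g_def using that \<open>finite gaps\<close> by (auto simp: gaps_def intro!: Min_le)
  define r where "r = min (min r0 r1) g"
  define L where "L = 2 * C"
  define D where "D = L + 2 / g + 2 * real CARD('n) ^ 5 / g"
  show thesis
  proof (rule that)
    show "0 \<le> D" using \<open>0 \<le> C\<close> \<open>0 < g\<close> by (simp add: D_def L_def)
    show "0 < r" using \<open>0 < r0\<close> \<open>0 < r1\<close> \<open>0 < g\<close> by (simp add: r_def)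
    fix U W :: "real ^ 'n::{finite, linorder} ^ 'n::{finite, linorder}" and y v
    assume U: "orthogonal_matrix U" and W: "orthogonal_matrix W"
      and y: "y \<in> G \<inter> ball z r" and v: "v \<in> limiting_normal_cone G y"
    have yr: "dist y z < r0" "dist y z < r1" "norm (y - z) < g" "y \<in> G"
      using y by (auto simp: r_def dist_commute dist_norm norm_minus_commute)
    have gap: "g \<le> \<bar>fst y $ i - fst y $ j\<bar>" if "c i \<noteq> c j" for i j
      using g [OF that] abs_coord_le_norm [of "y - z" i] abs_coord_le_norm [of "y - z" j] yr(3)
      unfolding c_def by simp
    have fst_le: "norm (fst v) \<le> norm v" using norm_fst_le [of "fst v" "snd v"] by simp
    have lip: "\<bar>fst v $ i - fst v $ j\<bar> \<le> L * norm v * \<bar>fst y $ i - fst y $ j\<bar>"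
      if "i \<notin> A" "c i = c j" for i j
    proof (cases "fst y $ i = fst y $ j")
      case True
      then show ?thesis using near [OF yr(2,4) that(2)] that(1) v by auto
    next
      case False
      then have "i \<noteq> j" by blast
      let ?d = "\<bar>fst y $ i - fst y $ j\<bar>" and ?s = "permute (Transposition.transpose i j) y"
      have s: "norm (?s - y) = sqrt 2 * ?d"
        using \<open>i \<noteq> j\<close> by (simp add: permute_transpose norm_coord_diff)
      \<comment> \<open>The chord from \<open>y\<close> to its own mirror image has length
        \<open>sqrt 2 * ?d\<close>, which is also the distance term; the two factors
        \<open>sqrt 2\<close> give \<open>L = 2 * C\<close>.\<close>
      have "?d * \<bar>fst v $ i - fst v $ j\<bar> \<le> C * norm v * (sqrt 2 * ?d) * (norm (y - y) + norm (?s - y))"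
        by (rule curved_normals_swap [OF G \<open>i \<noteq> j\<close> _ C])
          (use that yr v in \<open>auto simp: c_def dist_commute\<close>)
      also have "\<dots> = ?d * (L * norm v * ?d)" by (simp add: s L_def)
      finally show ?thesis using False by simp
    qed
    have level: "fst p $ i = fst p $ j" if "p \<in> G \<inter> ball z r" "i \<in> A" "c i = c j" for p i j
      using near [of p i j] that by (auto simp: r_def dist_commute)
    obtain W' q where W': "orthogonal_matrix W'" "spec W' (fst y) = spec W (fst y)"
      and q: "\<forall>u. (\<forall>i\<in>A. \<forall>j. c i = c j \<longrightarrow> u $ i = u $ j) \<longrightarrow> q \<bullet> u = 0"
      and le: "norm (spec U (fst v) - spec W' (fst v + q))
        \<le> (L + 2 / g + 2 * real CARD('n) ^ 5 / g) * norm v * norm (spec U (fst y) - spec W (fst y))"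
    proof (rule transport_estimate [OF U W \<open>0 < g\<close>, where c = c and A = A and y = "fst y" and v = "fst v" and K = "norm v" and L = L])
      show "0 \<le> L" using \<open>0 \<le> C\<close> by (simp add: L_def)
      show "g \<le> \<bar>fst y $ i - fst y $ j\<bar>" if "c i \<noteq> c j" for i j by (rule gap [OF that])
      show "j \<in> A" and "fst y $ i = fst y $ j" if "i \<in> A" "c i = c j" for i j
        by (rule sat [OF that], rule level [OF y that])
      show "\<bar>fst v $ i - fst v $ j\<bar> \<le> L * norm v * \<bar>fst y $ i - fst y $ j\<bar>"
        if "i \<notin> A" "c i = c j" for i j by (rule lip [OF that])
    qed (rule fst_le)
    define u where "u = (q, 0 :: real)"
    \<comment> \<open>Near \<open>z\<close>, differences of points of \<open>G\<close> are constant
      on the blocks in \<open>A\<close>, hence orthogonal to \<open>q\<close>.\<close>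
    have "v + u \<in> limiting_normal_cone (G \<inter> ball z r) y"
    proof (rule limiting_normal_cone_add_orthogonal)
      show "u \<bullet> (p - p') = 0" if "p \<in> G \<inter> ball z r" "p' \<in> G \<inter> ball z r" for p p'
      proof -
        have "q \<bullet> (fst p - fst p') = 0"
          using level [OF that(1)] level [OF that(2)] q by simp
        then show ?thesis by (simp add: u_def inner_prod_def)
      qed
      show "v \<in> limiting_normal_cone (G \<inter> ball z r) y"
        using v y limiting_normal_cone_Int_open [OF open_ball] by fastforce
    qed
    then have "v + u \<in> limiting_normal_cone G y"
      using y limiting_normal_cone_Int_open [OF open_ball] by fastforce
    then have "lift W' (v + u) \<in> limiting_normal_cone (spectral_set G) (lift W' y)"
      by (rule lift_limiting_normal [OF G W'(1)])
    moreover have "lift W' y = lift W y" using W'(2) by (simp add: lift_def)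
    moreover have "norm (lift U v - lift W' (v + u)) = norm (spec U (fst v) - spec W' (fst v + q))"
      by (simp add: lift_def u_def norm_Pair)
    moreover have "norm (lift U y - lift W y) = norm (spec U (fst y) - spec W (fst y))"
      by (simp add: lift_def norm_Pair)
    ultimately show "\<exists>w \<in> limiting_normal_cone (spectral_set G) (lift W y).
        norm (lift U v - w) \<le> D * norm v * norm (lift U y - lift W y)"
      using le by (intro bexI [of _ "lift W' (v + u)"]) (simp_all add: D_def)
  qed
qed

text \<open>From \<open>P = lift U x\<close> the comparison goes to \<open>lift U y\<close>, where
  strong (a) for vectors applies within the frame \<open>U\<close>, and then to
  \<open>R = lift W y\<close>, which has the same eigenvalues, by
  \<open>normal_transport\<close>.\<close>

lemma strong_reg_a_transfer:
  fixes Q G :: "((real ^ 'n::{finite, linorder}) \<times> real) set"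
  assumes Q: "permutation_invariant Q" and G: "permutation_invariant G"
    and curved: "curved_normals G z" and "z \<in> G"
    and U0: "orthogonal_matrix U0" and a: "holds_near strong_reg_a Q G z"
  shows "holds_near strong_reg_a (spectral_set Q) (spectral_set G) (lift U0 z)"
proof -
  obtain N where N: "open N" "z \<in> N" "strong_reg_a (Q \<inter> N) (G \<inter> N)"
    using a unfolding holds_near_def by blast
  obtain C where C: "0 < C" "\<And>x y. x \<in> Q \<inter> N \<Longrightarrow> y \<in> G \<inter> N \<Longrightarrow>
      cone_gap (limiting_normal_cone (Q \<inter> N) x) (limiting_normal_cone (G \<inter> N) y) \<le> ennreal (C * norm (x - y))"
    using N(3) unfolding strong_reg_a_def by blast
  obtain D r where "0 \<le> D" "0 < r" and transport:
    "\<And>U W y v. \<lbrakk>orthogonal_matrix U; orthogonal_matrix W; y \<in> G \<inter> ball z r; v \<in> limiting_normal_cone G y\<rbrakk> \<Longrightarrow>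
      \<exists>w \<in> limiting_normal_cone (spectral_set G) (lift W y).
        norm (lift U v - w) \<le> D * norm v * norm (lift U y - lift W y)"
    by (rule normal_transport [OF G curved \<open>z \<in> G\<close>]) (rule that)
  have "open (N \<inter> ball z r)" "z \<in> N \<inter> ball z r" using N(1,2) \<open>0 < r\<close> by auto
  then obtain \<rho> where \<rho>: "0 < \<rho>" "\<And>x. norm (x - z) < 3 * \<rho> \<Longrightarrow> x \<in> N \<inter> ball z r"
    by (rule open_contains_ball_3) (rule that)
  let ?N = "ball (lift U0 z) \<rho>"
  \<comment> \<open>The summand \<open>C\<close> is the cost of changing eigenvalues. The other is
    the transport cost: \<open>lift U y\<close> and \<open>R\<close> are at most
    \<open>2 * t\<close> apart, and a nearly closest normal \<open>v'\<close> has norm at most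
    \<open>1 + 2 * C * \<rho>\<close> up to \<open>\<eta>\<close>.\<close>
  define E where "E = C + 2 * D * (1 + 2 * C * \<rho>)"
  have "0 < E" using C(1) \<open>0 \<le> D\<close> \<rho>(1) by (auto simp: E_def intro!: add_pos_nonneg)
  have dist_le: "infdist w (limiting_normal_cone (spectral_set G \<inter> ?N) R) \<le> E * norm (P - R)"
    if P: "P \<in> spectral_set Q \<inter> ?N" and R: "R \<in> spectral_set G \<inter> ?N"
      and w: "w \<in> limiting_normal_cone (spectral_set Q \<inter> ?N) P" "norm w = 1" for P R w
  proof -
    define t where "t = norm (P - R)"
    have "0 \<le> t" by (simp add: t_def)
    have "t < 2 * \<rho>"
      using norm_diff_less_triangle [of P "lift U0 z" \<rho> R \<rho>] P R by (auto simp: t_def dist_norm norm_minus_commute)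
    obtain U x v where U: "orthogonal_matrix U" "P = lift U x" "w = lift U v" "x \<in> Q"
      "v \<in> limiting_normal_cone Q x" "norm (x - z) < \<rho>"
      using spectral_normal_near [OF Q U0 P w(1)] .
    obtain W y where W: "orthogonal_matrix W" "R = lift W y" "norm (y - x) \<le> norm (R - lift U x)"
      by (rule exists_lift_near [OF U(1)])
    have yx: "norm (y - x) \<le> t" using W(3) U(2) by (simp add: t_def norm_minus_commute)
    have "y \<in> G" using R W(2) lift_mem_spectral_set [OF G W(1)] by blast
    have "norm (y - z) < 2 * \<rho> + \<rho>"
      using yx \<open>t < 2 * \<rho>\<close> by (intro norm_diff_less_triangle [OF _ U(6)]) simp
    then have "y \<in> N \<inter> ball z r" by (intro \<rho>(2)) simp
    have "x \<in> N \<inter> ball z r" using U(6) \<rho>(1) by (intro \<rho>(2)) simp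
    have v1: "norm v = 1" using w(2) U(3) norm_lift [OF U(1)] by simp
    let ?NG = "limiting_normal_cone G y"
    have "ennreal (infdist v ?NG) \<le> cone_gap (limiting_normal_cone Q x) ?NG"
      unfolding cone_gap_def using U(5) v1 by (intro SUP_upper) simp
    also have "\<dots> \<le> ennreal (C * norm (x - y))"
      using C(2) [of x y] \<open>x \<in> N \<inter> ball z r\<close> \<open>y \<in> N \<inter> ball z r\<close> \<open>y \<in> G\<close> U(4)
      by (simp add: limiting_normal_cone_Int_open [OF N(1)])
    finally have "infdist v ?NG \<le> C * norm (x - y)" using C(1) by (simp add: ennreal_le_iff)
    also have "\<dots> \<le> C * t" using yx C(1) by (intro mult_left_mono) (simp_all add: norm_minus_commute)
    finally have inf: "infdist v ?NG \<le> C * t" .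
    have eta: "infdist w (limiting_normal_cone (spectral_set G \<inter> ?N) R) \<le> E * t + \<eta> * (1 + 2 * D * t)"
      if "0 < \<eta>" for \<eta>
    proof -
      have "?NG \<noteq> {}" using zero_in_limiting_normal_cone [OF \<open>y \<in> G\<close>] by blast
      have "(INF a\<in>?NG. dist v a) < C * t + \<eta>"
        using inf that infdist_notempty [OF \<open>?NG \<noteq> {}\<close>, of v] by simp
      then obtain v' where v': "v' \<in> ?NG" "dist v v' < C * t + \<eta>"
        using cInf_lessD [of "dist v ` ?NG"] \<open>?NG \<noteq> {}\<close> by blast
      obtain w' where w': "w' \<in> limiting_normal_cone (spectral_set G) R"
          "norm (lift U v' - w') \<le> D * norm v' * norm (lift U y - R)"
        using transport [OF U(1) W(1) _ v'(1)] \<open>y \<in> G\<close> \<open>y \<in> N \<inter> ball z r\<close> unfolding W(2) by blast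
      have "norm (lift U y - R) \<le> norm (lift U y - lift U x) + norm (P - R)"
        using norm_triangle_ineq [of "lift U y - lift U x" "P - R"] by (simp add: U(2))
      also have "\<dots> \<le> 2 * t" using yx by (simp add: norm_lift_diff_same [OF U(1)] t_def)
      finally have yR: "norm (lift U y - R) \<le> 2 * t" .
      have "norm v' \<le> norm v + dist v v'"
        using norm_triangle_ineq4 [of v "v - v'"] by (simp add: dist_norm)
      also have "\<dots> \<le> 1 + 2 * C * \<rho> + \<eta>"
      proof -
        have "C * t \<le> C * (2 * \<rho>)" using \<open>t < 2 * \<rho>\<close> C(1) by (intro mult_left_mono) auto
        then show ?thesis using v'(2) v1 by simp
      qed
      finally have nv': "norm v' \<le> 1 + 2 * C * \<rho> + \<eta>" .
      have "norm (lift U v' - w') \<le> D * norm v' * norm (lift U y - R)" by (rule w'(2))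
      also have "\<dots> \<le> D * (1 + 2 * C * \<rho> + \<eta>) * (2 * t)"
        using nv' yR \<open>0 \<le> D\<close> order_trans [OF norm_ge_zero nv']
        by (intro mult_mono mult_left_mono) auto
      finally have vw: "norm (lift U v' - w') \<le> D * (1 + 2 * C * \<rho> + \<eta>) * (2 * t)" .
      have "dist w w' \<le> norm (lift U v - lift U v') + norm (lift U v' - w')"
        using norm_triangle_ineq [of "lift U v - lift U v'" "lift U v' - w'"] by (simp add: dist_norm U(3))
      also have "\<dots> \<le> (C * t + \<eta>) + D * (1 + 2 * C * \<rho> + \<eta>) * (2 * t)"
        using vw v'(2) by (intro add_mono) (simp_all add: norm_lift_diff_same [OF U(1)] dist_norm)
      also have "\<dots> = E * t + \<eta> * (1 + 2 * D * t)" by (simp add: E_def algebra_simps)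
      finally have "dist w w' \<le> E * t + \<eta> * (1 + 2 * D * t)" .
      moreover have "w' \<in> limiting_normal_cone (spectral_set G \<inter> ?N) R"
        using w'(1) R limiting_normal_cone_Int_open [OF open_ball] by fastforce
      ultimately show ?thesis by (intro infdist_le2)
    qed
    have "0 < 1 + 2 * D * t" using \<open>0 \<le> D\<close> \<open>0 \<le> t\<close> by (simp add: add_pos_nonneg)
    have "infdist w (limiting_normal_cone (spectral_set G \<inter> ?N) R) \<le> E * t + e" if "0 < e" for e
      using eta [of "e / (1 + 2 * D * t)"] that \<open>0 < 1 + 2 * D * t\<close> by simp
    then show ?thesis unfolding t_def by (rule field_le_epsilon)
  qed
  have "cone_gap (limiting_normal_cone (spectral_set Q \<inter> ?N) P) (limiting_normal_cone (spectral_set G \<inter> ?N) R)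
      \<le> ennreal (E * norm (P - R))"
    if "P \<in> spectral_set Q \<inter> ?N" "R \<in> spectral_set G \<inter> ?N" for P R
    unfolding cone_gap_def
    by (intro SUP_least ennreal_leI) (use dist_le [OF that] in blast)
  then have "strong_reg_a (spectral_set Q \<inter> ?N) (spectral_set G \<inter> ?N)"
    unfolding strong_reg_a_def using \<open>0 < E\<close> by blast
  then show ?thesis
    unfolding holds_near_def using \<rho>(1) by (intro exI [of _ ?N]) simp
qed

section \<open>Normals of regular zero sets\<close>

lemma has_derivative_littleo:
  assumes "(f has_derivative f') (at y)" "0 < e"
  obtains d where "0 < d" "\<And>x. norm (x - y) < d \<Longrightarrow> norm (f x - f y - f' (x - y)) \<le> e * norm (x - y)"
  using assms(1) \<open>0 < e\<close> that unfolding has_derivative_at_alt by meson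

text \<open>
  \<open>\<Phi> x = x + \<Sum>i (H i x - DH i (x - y)) b i\<close> has the identity as its derivative at \<open>y\<close>, so it is
  locally onto, and it maps onto \<open>y + ker DH\<close> only points of the zero set.
\<close>

lemma frechet_normal_vanishes_on_kernel:
  fixes H :: "nat \<Rightarrow> 'a::euclidean_space \<Rightarrow> real"
  assumes "open U" "y \<in> U"
    and cont: "\<And>i. i < k \<Longrightarrow> continuous_on U (H i)"
    and der: "\<And>i. i < k \<Longrightarrow> (H i has_derivative DH i) (at y)"
    and b: "\<And>i j. i < k \<Longrightarrow> j < k \<Longrightarrow> DH j (b i) = (if i = j then 1 else 0)"
    and zero: "\<And>i. i < k \<Longrightarrow> H i y = 0"
    and S: "\<And>x. x \<in> U \<Longrightarrow> (\<And>i. i < k \<Longrightarrow> H i x = 0) \<Longrightarrow> x \<in> S"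
    and w: "w \<in> frechet_normal_cone S y" and h: "\<And>i. i < k \<Longrightarrow> DH i h = 0"
  shows "w \<bullet> h \<le> 0"
proof -
  define \<Phi> where "\<Phi> = (\<lambda>x. x + (\<Sum>i<k. (H i x - DH i (x - y)) *\<^sub>R b i))"
  have lin: "bounded_linear (DH i)" if "i < k" for i using der [OF that] by (rule has_derivative_bounded_linear)
  have D: "(\<Phi> has_derivative id) (at y)"
  proof -
    have "((\<lambda>x. (H i x - DH i (x - y)) *\<^sub>R b i) has_derivative (\<lambda>h. (DH i h - DH i h) *\<^sub>R b i)) (at y)"
      if "i \<in> {..<k}" for i
    proof -
      have i: "i < k" using that by simp
      have "((\<lambda>x. x - y) has_derivative (\<lambda>h. h - 0)) (at y)"
        by (rule has_derivative_diff [OF has_derivative_ident has_derivative_const])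
      from bounded_linear.has_derivative [OF lin [OF i] this]
      have "((\<lambda>x. DH i (x - y)) has_derivative DH i) (at y)" by simp
      from has_derivative_scaleR_left [OF has_derivative_diff [OF der [OF i] this]] show ?thesis .
    qed
    from has_derivative_add [OF has_derivative_ident has_derivative_sum [OF this]]
    have "(\<Phi> has_derivative (\<lambda>h. h + (\<Sum>i<k. (DH i h - DH i h) *\<^sub>R b i))) (at y)"
      unfolding \<Phi>_def .
    then show ?thesis by (simp add: id_def)
  qed
  have contPhi: "continuous_on U \<Phi>"
    unfolding \<Phi>_def
  proof (intro continuous_on_add continuous_on_id continuous_on_sum continuous_on_scaleR
      continuous_on_diff continuous_on_const)
    show "continuous_on U (H i)" if "i \<in> {..<k}" for i using cont that by simp
    show "continuous_on U (\<lambda>x. DH i (x - y))" if "i \<in> {..<k}" for i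
      by (rule bounded_linear.continuous_on [OF lin]) (use that in \<open>auto intro!: continuous_intros\<close>)
  qed
  have \<Phi>y: "\<Phi> y = y"
    using zero linear_0 [OF bounded_linear.linear [OF lin]] by (simp add: \<Phi>_def)
  have in_S: "x \<in> S" if "x \<in> U" "\<Phi> x = y + t *\<^sub>R h" for x t
  proof (rule S [OF that(1)])
    fix j assume j: "j < k"
    interpret DH: bounded_linear "DH j" by (rule lin [OF j])
    have "(\<Sum>i<k. (H i x - DH i (x - y)) * (if i = j then 1 else 0)) = H j x - DH j (x - y)"
      using j by (simp add: if_distrib [of "\<lambda>t. _ * t"] cong: if_cong)
    moreover have "DH j (\<Phi> x) = DH j x + (\<Sum>i<k. (H i x - DH i (x - y)) * (if i = j then 1 else 0))"
      using b [OF _ j] by (simp add: \<Phi>_def DH.add DH.sum DH.scaleR)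
    ultimately have "DH j (\<Phi> x) = DH j y + H j x" by (simp add: DH.diff)
    moreover have "DH j (\<Phi> x) = DH j y" using h [OF j] by (simp add: that(2) DH.add DH.scaleR)
    ultimately show "H j x = 0" by simp
  qed
  have bound: "w \<bullet> h \<le> (1 + norm w) * e * (2 * norm h)" if e: "0 < e" "e < 1 / 2" for e
  proof -
    obtain d1 where d1: "0 < d1" "\<And>x. x \<in> S \<Longrightarrow> norm (x - y) < d1 \<Longrightarrow> w \<bullet> (x - y) \<le> e * norm (x - y)"
      by (rule frechet_normal_coneD [OF w e(1)]) (rule that)
    obtain d2 where d2: "0 < d2" "\<And>x. norm (x - y) < d2 \<Longrightarrow> norm (\<Phi> x - \<Phi> y - id (x - y)) \<le> e * norm (x - y)"
      by (rule has_derivative_littleo [OF D e(1)]) (rule that)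
    obtain d3 where d3: "0 < d3" "ball y d3 \<subseteq> U" using assms(1,2) openE by blast
    define d where "d = min d1 (min d2 d3)"
    have "0 < d" using d1 d2 d3 by (simp add: d_def)
    have "\<Phi> y \<in> interior (\<Phi> ` ball y d)"
    proof (rule sussmann_open_mapping [OF assms(1) contPhi assms(2) D bounded_linear_ident])
      show "ball y d \<subseteq> U" using d3(2) by (auto simp: d_def)
      show "y \<in> interior (ball y d)" using \<open>0 < d\<close> by simp
    qed (simp add: id_def comp_def)
    then obtain s where s: "0 < s" "ball y s \<subseteq> \<Phi> ` ball y d"
      unfolding \<Phi>y mem_interior by blast
    define a where "a = norm h + 1"
    have "0 < a" by (simp add: a_def add_nonneg_pos)
    define t where "t = s / (2 * a)"
    have "0 < t" using s(1) \<open>0 < a\<close> by (simp add: t_def)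
    have "norm (t *\<^sub>R h) < s"
    proof -
      have "t * norm h \<le> t * a" using \<open>0 < t\<close> by (simp add: a_def)
      also have "\<dots> = s / 2" using \<open>0 < a\<close> by (simp add: t_def)
      finally show ?thesis using s(1) \<open>0 < t\<close> by simp
    qed
    then have "y + t *\<^sub>R h \<in> \<Phi> ` ball y d" using s(2) by (auto simp: dist_norm)
    then obtain x where "x \<in> ball y d" "y + t *\<^sub>R h = \<Phi> x" by blast
    \<comment> \<open>This point of the set misses \<open>y + t *\<^sub>R h\<close> by at most
      \<open>e * norm (x - y)\<close>, so the normal inequality at \<open>x\<close> becomes one for
      \<open>h\<close> after division by \<open>t\<close>.\<close>
    then have x: "norm (x - y) < d" "\<Phi> x = y + t *\<^sub>R h"
      by (simp_all add: dist_norm norm_minus_commute)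
    have "x \<in> U" using x(1) d3(2) by (auto simp: d_def dist_norm norm_minus_commute)
    then have "x \<in> S" using x(2) by (rule in_S)
    let ?n = "norm (x - y)"
    have err: "norm (t *\<^sub>R h - (x - y)) \<le> e * ?n"
      using d2(2) [of x] x \<Phi>y by (simp add: d_def)
    have "?n \<le> norm (t *\<^sub>R h) + norm (t *\<^sub>R h - (x - y))"
      using norm_triangle_ineq4 [of "t *\<^sub>R h" "t *\<^sub>R h - (x - y)"] by simp
    also have "\<dots> \<le> t * norm h + ?n / 2"
      using err mult_right_mono [of e "1 / 2" ?n] e \<open>0 < t\<close> by simp
    finally have n: "?n \<le> t * (2 * norm h)" by simp
    have "t * (w \<bullet> h) = w \<bullet> (x - y) + w \<bullet> (t *\<^sub>R h - (x - y))" by (simp add: inner_diff_right)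
    also have "\<dots> \<le> e * ?n + norm w * (e * ?n)"
      using d1(2) [OF \<open>x \<in> S\<close>] x(1) order_trans [OF norm_cauchy_schwarz mult_left_mono [OF err norm_ge_zero [of w]]]
      by (intro add_mono) (auto simp: d_def)
    also have "\<dots> = (1 + norm w) * e * ?n" by (simp add: algebra_simps)
    also have "\<dots> \<le> (1 + norm w) * e * (t * (2 * norm h))"
      using n e by (intro mult_left_mono) auto
    finally show ?thesis using \<open>0 < t\<close> by (simp add: ac_simps)
  qed
  show ?thesis
  proof (rule ccontr)
    assume "\<not> w \<bullet> h \<le> 0"
    define K where "K = (1 + norm w) * (2 * norm h) + 1"
    have "0 < K" by (simp add: K_def add_nonneg_pos)
    define e where "e = min (1 / 4) (w \<bullet> h / (2 * K))"
    have "0 < e" using \<open>\<not> w \<bullet> h \<le> 0\<close> \<open>0 < K\<close> by (simp add: e_def)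
    have "w \<bullet> h \<le> (1 + norm w) * e * (2 * norm h)" using \<open>0 < e\<close> by (intro bound) (auto simp: e_def)
    also have "\<dots> \<le> e * K" using \<open>0 < e\<close> by (simp add: K_def algebra_simps)
    also have "\<dots> \<le> w \<bullet> h / (2 * K) * K" using \<open>0 < K\<close> by (intro mult_right_mono) (auto simp: e_def)
    finally show False using \<open>\<not> w \<bullet> h \<le> 0\<close> \<open>0 < K\<close> by simp
  qed
qed

text \<open>A Frechet normal annihilates the common kernel of the derivatives, so it is a
  combination of them with multipliers \<open>a i\<close>. Each \<open>H i\<close> vanishes at
  \<open>p\<close> and \<open>q\<close>, which makes \<open>DH i y (p - q)\<close> of second order;
  bounded multipliers give the estimate, and it passes to limiting normals.\<close>

lemma zero_set_curved_normals:
  fixes H :: "nat \<Rightarrow> 'a::euclidean_space \<Rightarrow> real"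
  assumes "0 < r" "0 \<le> L" "z \<in> S"
    and der: "\<And>i y. i < k \<Longrightarrow> y \<in> ball z r \<Longrightarrow> (H i has_derivative DH i y) (at y)"
    and est: "\<And>i y p q. i < k \<Longrightarrow> y \<in> ball z r \<Longrightarrow> p \<in> ball z r \<Longrightarrow> q \<in> ball z r \<Longrightarrow>
      \<bar>H i p - H i q - DH i y (p - q)\<bar> \<le> L * norm (p - q) * (norm (p - y) + norm (q - y))"
    and lip: "\<And>i y h. i < k \<Longrightarrow> y \<in> ball z r \<Longrightarrow> \<bar>DH i y h - DH i z h\<bar> \<le> L * norm h * norm (y - z)"
    and surj: "\<And>y c. y \<in> ball z r \<Longrightarrow> \<exists>h. \<forall>i<k. DH i y h = c i"
    and S: "S \<inter> ball z r = {y \<in> ball z r. \<forall>i<k. H i y = 0}"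
  shows "curved_normals S z"
proof -
  have lin: "bounded_linear (DH i y)" if "i < k" "y \<in> ball z r" for i y
    using der [OF that] by (rule has_derivative_bounded_linear)
  have dual: "\<exists>b. \<forall>i<k. \<forall>j<k. DH j y (b i) = (if i = j then 1 else 0)" if "y \<in> ball z r" for y
    using surj [OF that, of "\<lambda>j. if _ = j then 1 else 0"] by metis
  have "z \<in> ball z r" using \<open>0 < r\<close> by simp
  from dual [OF this] obtain bz where bz: "\<And>i j. i < k \<Longrightarrow> j < k \<Longrightarrow> DH j z (bz i) = (if i = j then 1 else 0)"
    by blast
  define B where "B = (\<Sum>i<k. norm (bz i))"
  have "0 \<le> B" by (simp add: B_def sum_nonneg)
  \<comment> \<open>So small that \<open>real k * L * B * s \<le> 1 / 2\<close>: the multiplier sum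
    \<open>T\<close> reappears on the right of its own estimate with factor at most 1/2.\<close>
  define s where "s = min r (1 / (2 * (real k * L * B + 1)))"
  have den: "0 < real k * L * B + 1" using \<open>0 \<le> L\<close> \<open>0 \<le> B\<close> by (intro add_nonneg_pos) auto
  then have "0 < s" using \<open>0 < r\<close> by (simp add: s_def)
  have repr: "\<bar>w \<bullet> (p - q)\<bar> \<le> 2 * B * L * norm w * norm (p - q) * (norm (p - y) + norm (q - y))"
    if y: "y \<in> S \<inter> ball z s" and w: "w \<in> frechet_normal_cone S y"
      and p: "p \<in> S \<inter> ball z r" and q: "q \<in> S \<inter> ball z r" for y w p q
  proof -
    have yr: "y \<in> S \<inter> ball z r" using y by (auto simp: s_def)
    obtain b where b: "\<And>i j. i < k \<Longrightarrow> j < k \<Longrightarrow> DH j y (b i) = (if i = j then 1 else 0)"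
      using dual yr by blast
    have zero: "\<And>i. i < k \<Longrightarrow> H i y = 0" using yr S by blast
    have cont: "continuous_on (ball z r) (H i)" if "i < k" for i
      using der [OF that] by (auto intro!: continuous_at_imp_continuous_on has_derivative_continuous)
    have ker: "w \<bullet> h \<le> 0" if "\<And>i. i < k \<Longrightarrow> DH i y h = 0" for h
    proof (rule frechet_normal_vanishes_on_kernel [OF open_ball, of y z r k H "\<lambda>i. DH i y" b S])
      show "x \<in> S" if "x \<in> ball z r" "\<And>i. i < k \<Longrightarrow> H i x = 0" for x using that S by blast
    qed (use yr cont der b zero w that in auto)
    define a where "a = (\<lambda>i. w \<bullet> b i)"
    have wh: "w \<bullet> h = (\<Sum>i<k. a i * DH i y h)" for h
    proof -
      define h' where "h' = h - (\<Sum>i<k. DH i y h *\<^sub>R b i)"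
      have "DH j y h' = 0" if "j < k" for j
      proof -
        interpret DH: bounded_linear "DH j y" using lin [OF that] yr by blast
        have "(\<Sum>i<k. DH i y h * (if i = j then 1 else 0)) = DH j y h"
          using that by (simp add: if_distrib [of "\<lambda>t. _ * t"] cong: if_cong)
        then show ?thesis using b [OF _ that] by (simp add: h'_def DH.diff DH.sum DH.scaleR)
      qed
      moreover have "DH j y (- h') = - DH j y h'" if "j < k" for j
        using linear_neg [OF bounded_linear.linear [OF lin [OF that]]] yr by blast
      ultimately have "w \<bullet> h' = 0" using ker [of h'] ker [of "- h'"] by simp
      then show ?thesis by (simp add: h'_def a_def inner_diff_right inner_sum_right ac_simps)
    qed
    define T where "T = (\<Sum>i<k. \<bar>a i\<bar>)"
    have "0 \<le> T" by (simp add: T_def sum_nonneg)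
    \<comment> \<open>The multipliers are tested on the dual vectors \<open>bz\<close> at the fixed
      point \<open>z\<close>, because the dual vectors at \<open>y\<close> come without a bound
      uniform in \<open>y\<close>.\<close>
    have ai: "\<bar>a i\<bar> \<le> norm w * norm (bz i) + L * B * s * T" if i: "i < k" for i
    proof -
      have diff: "\<bar>DH j y (bz i) - DH j z (bz i)\<bar> \<le> L * B * s" if "j < k" for j
      proof -
        have "\<bar>DH j y (bz i) - DH j z (bz i)\<bar> \<le> L * norm (bz i) * norm (y - z)"
          using lip [OF that] yr by blast
        also have "\<dots> \<le> L * B * s"
        proof (intro mult_mono mult_left_mono)
          show "norm (bz i) \<le> B" unfolding B_def using i by (intro member_le_sum) auto
          show "norm (y - z) \<le> s" using y by (auto simp: dist_norm norm_minus_commute)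
        qed (use \<open>0 \<le> L\<close> \<open>0 \<le> B\<close> in auto)
        finally show ?thesis .
      qed
      have "(\<Sum>j<k. a j * DH j z (bz i)) = (\<Sum>j<k. if j = i then a i else 0)"
        by (intro sum.cong) (use bz i in auto)
      then have "w \<bullet> bz i = a i + (\<Sum>j<k. a j * (DH j y (bz i) - DH j z (bz i)))"
        using i by (simp add: wh right_diff_distrib sum_subtractf)
      moreover have "\<bar>\<Sum>j<k. a j * (DH j y (bz i) - DH j z (bz i))\<bar> \<le> (\<Sum>j<k. \<bar>a j\<bar> * (L * B * s))"
        by (intro order_trans [OF sum_abs] sum_mono) (auto simp: abs_mult diff intro!: mult_left_mono)
      moreover have "(\<Sum>j<k. \<bar>a j\<bar> * (L * B * s)) = L * B * s * T"
        by (simp add: T_def sum_distrib_left sum_distrib_right ac_simps)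
      moreover have "\<bar>w \<bullet> bz i\<bar> \<le> norm w * norm (bz i)" by (rule Cauchy_Schwarz_ineq2)
      ultimately show ?thesis by linarith
    qed
    have "T \<le> (\<Sum>i<k. norm w * norm (bz i) + L * B * s * T)"
      unfolding T_def by (intro sum_mono) (use ai in \<open>simp add: T_def\<close>)
    also have "\<dots> = norm w * B + (real k * L * B * s) * T"
      by (simp add: sum.distrib B_def sum_distrib_left ac_simps)
    also have "\<dots> \<le> norm w * B + 1 / 2 * T"
    proof -
      have "real k * L * B * s \<le> (real k * L * B + 1) * s" using \<open>0 < s\<close> by simp
      also have "\<dots> \<le> (real k * L * B + 1) * (1 / (2 * (real k * L * B + 1)))"
        using den by (intro mult_left_mono) (auto simp: s_def)
      also have "\<dots> = 1 / 2" using den by (simp add: field_simps)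
      finally show ?thesis using \<open>0 \<le> T\<close> by (intro add_left_mono mult_right_mono)
    qed
    finally have "T \<le> 2 * (norm w * B)" by simp
    then have T: "T \<le> 2 * B * norm w" by (simp add: ac_simps)
    let ?R = "L * norm (p - q) * (norm (p - y) + norm (q - y))"
    have "0 \<le> ?R" using \<open>0 \<le> L\<close> by simp
    have DHpq: "\<bar>DH i y (p - q)\<bar> \<le> ?R" if "i < k" for i
    proof -
      have "H i p = 0" "H i q = 0" using p q S that by blast+
      with est [OF that, of y p q] yr p q show ?thesis by auto
    qed
    have "\<bar>w \<bullet> (p - q)\<bar> \<le> (\<Sum>i<k. \<bar>a i\<bar> * ?R)"
      unfolding wh by (intro order_trans [OF sum_abs] sum_mono) (auto simp: abs_mult DHpq intro!: mult_left_mono)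
    also have "\<dots> = T * ?R" by (simp add: T_def sum_distrib_right)
    also have "\<dots> \<le> 2 * B * norm w * ?R" by (rule mult_right_mono [OF T \<open>0 \<le> ?R\<close>])
    finally show ?thesis by (simp add: algebra_simps)
  qed
  have "\<bar>w \<bullet> (p - q)\<bar> \<le> 2 * B * L * norm w * norm (p - q) * (norm (p - y) + norm (q - y))"
    if y: "y \<in> S \<inter> ball z s" and p: "p \<in> S \<inter> ball z s" and q: "q \<in> S \<inter> ball z s"
      and w: "w \<in> limiting_normal_cone S y" for y p q w
  proof -
    have "w \<in> limiting_normal_cone (S \<inter> ball z s) y"
      using w y limiting_normal_cone_Int_open [OF open_ball] by fastforce
    then obtain ys ws where *: "\<And>n. ys n \<in> S \<inter> ball z s" "\<And>n. ws n \<in> frechet_normal_cone (S \<inter> ball z s) (ys n)"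
      "ys \<longlonglongrightarrow> y" "ws \<longlonglongrightarrow> w" by (rule limiting_normal_coneE) (rule that)
    have "ws n \<in> frechet_normal_cone S (ys n)" for n
      using *(1,2) [of n] frechet_normal_cone_Int_open [OF open_ball] by fastforce
    then have le: "\<bar>ws n \<bullet> (p - q)\<bar> \<le> 2 * B * L * norm (ws n) * norm (p - q) * (norm (p - ys n) + norm (q - ys n))" for n
      using *(1) p q by (intro repr) (auto simp: s_def)
    have "(\<lambda>n. \<bar>ws n \<bullet> (p - q)\<bar>) \<longlonglongrightarrow> \<bar>w \<bullet> (p - q)\<bar>"
      by (intro tendsto_intros *)
    moreover have "(\<lambda>n. 2 * B * L * norm (ws n) * norm (p - q) * (norm (p - ys n) + norm (q - ys n)))
        \<longlonglongrightarrow> 2 * B * L * norm w * norm (p - q) * (norm (p - y) + norm (q - y))"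
      by (intro tendsto_intros *)
    ultimately show ?thesis using le by (intro LIMSEQ_le) auto
  qed
  moreover have "0 \<le> 2 * B * L" using \<open>0 \<le> B\<close> \<open>0 \<le> L\<close> by simp
  ultimately show ?thesis unfolding curved_normals_def using \<open>0 < s\<close> by blast
qed

section \<open>Graphs over smooth manifolds\<close>

definition C11_on_ball ::
    "('a::euclidean_space \<Rightarrow> real) \<Rightarrow> ('a \<Rightarrow> 'a \<Rightarrow> real) \<Rightarrow> 'a \<Rightarrow> real \<Rightarrow> real \<Rightarrow> bool" where
  "C11_on_ball F DF z r L \<longleftrightarrow> (\<forall>y\<in>ball z r. (F has_derivative DF y) (at y) \<and>
     (\<forall>y'\<in>ball z r. \<forall>h. \<bar>DF y h - DF y' h\<bar> \<le> L * norm h * norm (y - y')))"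

lemma C11_on_ball_mono:
  assumes "C11_on_ball F DF z r L" "r' \<le> r" "L \<le> L'"
  shows "C11_on_ball F DF z r' L'"
proof -
  have "\<bar>DF y h - DF y' h\<bar> \<le> L' * norm h * norm (y - y')" if "y \<in> ball z r'" "y' \<in> ball z r'" for y y' h
  proof -
    have "\<bar>DF y h - DF y' h\<bar> \<le> L * norm h * norm (y - y')"
      using assms(1,2) that unfolding C11_on_ball_def by auto
    also have "\<dots> \<le> L' * norm h * norm (y - y')"
      using assms(3) by (intro mult_right_mono) auto
    finally show ?thesis .
  qed
  then show ?thesis using assms(1,2) unfolding C11_on_ball_def by auto
qed

text \<open>The mean value inequality for \<open>F - DF y\<close> on the segment from
  \<open>p\<close> to \<open>q\<close>, whose points are within
  \<open>norm (p - y) + norm (q - y)\<close> of \<open>y\<close>.\<close>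

lemma C11_on_ball_estimate:
  assumes F: "C11_on_ball F DF z r L" and "0 \<le> L"
    and y: "y \<in> ball z r" and p: "p \<in> ball z r" and q: "q \<in> ball z r"
  shows "\<bar>F p - F q - DF y (p - q)\<bar> \<le> L * norm (p - q) * (norm (p - y) + norm (q - y))"
proof -
  define K where "K = L * (norm (p - y) + norm (q - y))"
  have DFy: "(F has_derivative DF y) (at y)" using F y unfolding C11_on_ball_def by blast
  then have lin: "linear (DF y)" by (rule has_derivative_linear)
  have seg: "closed_segment p q \<subseteq> ball z r"
    using p q by (simp add: closed_segment_subset convex_ball)
  have "norm ((F p - DF y p) - (F q - DF y q)) \<le> K * norm (p - q)"
  proof (rule differentiable_bound [of "closed_segment p q" "\<lambda>x. F x - DF y x" "\<lambda>x h. DF x h - DF y h"])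
    fix x assume x: "x \<in> closed_segment p q"
    then have xb: "x \<in> ball z r" using seg by blast
    have "(F has_derivative DF x) (at x)" using F xb unfolding C11_on_ball_def by blast
    moreover have "(DF y has_derivative DF y) (at x)"
      by (rule bounded_linear_imp_has_derivative [OF has_derivative_bounded_linear [OF DFy]])
    ultimately show "((\<lambda>x. F x - DF y x) has_derivative (\<lambda>h. DF x h - DF y h)) (at x within closed_segment p q)"
      by (rule has_derivative_diff [OF has_derivative_at_withinI has_derivative_at_withinI])
    have "norm (x - y) \<le> norm (p - y) + norm (q - y)"
    proof -
      obtain u where u: "0 \<le> u" "u \<le> 1" "x = (1 - u) *\<^sub>R p + u *\<^sub>R q"
        using x unfolding closed_segment_def by blast
      have "x - y = (1 - u) *\<^sub>R (p - y) + u *\<^sub>R (q - y)" by (simp add: u(3) algebra_simps)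
      then have "norm (x - y) \<le> \<bar>1 - u\<bar> * norm (p - y) + \<bar>u\<bar> * norm (q - y)"
        using norm_triangle_ineq [of "(1 - u) *\<^sub>R (p - y)" "u *\<^sub>R (q - y)"] by simp
      also have "\<dots> \<le> 1 * norm (p - y) + 1 * norm (q - y)"
        using u(1,2) by (intro add_mono mult_right_mono) auto
      finally show ?thesis by simp
    qed
    then have le: "L * norm h * norm (x - y) \<le> L * norm h * (norm (p - y) + norm (q - y))" for h :: 'a
      using \<open>0 \<le> L\<close> by (intro mult_left_mono) auto
    have "\<bar>DF x h - DF y h\<bar> \<le> K * norm h" for h
    proof -
      have "\<bar>DF x h - DF y h\<bar> \<le> L * norm h * norm (x - y)"
        using F xb y unfolding C11_on_ball_def by blast
      also have "\<dots> \<le> L * norm h * (norm (p - y) + norm (q - y))" by (rule le)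
      also have "\<dots> = K * norm h" by (simp add: K_def)
      finally show ?thesis .
    qed
    then show "onorm (\<lambda>h. DF x h - DF y h) \<le> K"
      using \<open>0 \<le> L\<close> by (intro onorm_bound) (simp_all add: K_def)
  qed simp_all
  moreover have "F p - F q - DF y (p - q) = (F p - DF y p) - (F q - DF y q)"
    by (simp add: linear_diff [OF lin])
  moreover have "K * norm (p - q) = L * norm (p - q) * (norm (p - y) + norm (q - y))"
    by (simp add: K_def)
  ultimately show ?thesis by simp
qed

text \<open>\<open>Ck_on\<close> gives continuous second derivatives direction by direction.
  Compactness bounds each of them on a closed ball, and summing over pairs of basis vectors yields
  one Lipschitz constant for the derivative.\<close>

lemma Ck_on_2_C11_on_ball:
  assumes F: "Ck_on 2 F U" and "open U" "z \<in> U"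
  obtains r L where "0 < r" "0 \<le> L" "C11_on_ball F (\<lambda>y. frechet_derivative F (at y)) z r L"
proof -
  define D where "D = (\<lambda>y. frechet_derivative F (at y))"
  have diff: "F differentiable (at y)" if "y \<in> U" for y
    using F that by (simp add: numeral_2_eq_2)
  have D2: "(\<lambda>y. D y b) differentiable (at y)" if "y \<in> U" for y b
    using F that by (simp add: numeral_2_eq_2 D_def)
  have cont: "continuous_on U (\<lambda>y. frechet_derivative (\<lambda>y. D y b) (at y) c)" for b c
    using F by (simp add: numeral_2_eq_2 D_def)
  obtain r where r: "0 < r" "cball z r \<subseteq> U" using assms(2,3) open_contains_cball by blast
  have "\<exists>K. \<forall>y\<in>cball z r. \<bar>frechet_derivative (\<lambda>y. D y b) (at y) c\<bar> \<le> K" for b c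
  proof -
    have "compact ((\<lambda>y. frechet_derivative (\<lambda>y. D y b) (at y) c) ` cball z r)"
      by (intro compact_continuous_image continuous_on_subset [OF cont r(2)] compact_cball)
    from compact_imp_bounded [OF this] show ?thesis by (simp add: bounded_iff)
  qed
  then obtain K where K: "\<And>b c y. y \<in> cball z r \<Longrightarrow> \<bar>frechet_derivative (\<lambda>y. D y b) (at y) c\<bar> \<le> K b c"
    by metis
  have "z \<in> cball z r" using r(1) by simp
  then have K0: "0 \<le> K b c" for b c using K [of z b c] by linarith
  define L where "L = (\<Sum>b\<in>Basis. \<Sum>c\<in>Basis. K b c)"
  have "0 \<le> L" unfolding L_def by (intro sum_nonneg K0)
  have D_lip: "\<bar>D y b - D y' b\<bar> \<le> (\<Sum>c\<in>Basis. K b c) * norm (y - y')"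
    if "y \<in> ball z r" "y' \<in> ball z r" for y y' b
  proof -
    have "norm (D y b - D y' b) \<le> (\<Sum>c\<in>Basis. K b c) * norm (y - y')"
    proof (rule differentiable_bound [OF convex_ball [of z r]])
      fix x assume x: "x \<in> ball z r"
      then have "x \<in> U" using r(2) by auto
      from frechet_derivative_works [THEN iffD1, OF D2 [OF this, of b]]
      have der: "((\<lambda>y. D y b) has_derivative frechet_derivative (\<lambda>y. D y b) (at x)) (at x)" .
      then show "((\<lambda>y. D y b) has_derivative frechet_derivative (\<lambda>y. D y b) (at x)) (at x within ball z r)"
        by (rule has_derivative_at_withinI)
      have "onorm (frechet_derivative (\<lambda>y. D y b) (at x))
          \<le> (\<Sum>c\<in>Basis. norm (frechet_derivative (\<lambda>y. D y b) (at x) c))"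
        by (rule onorm_componentwise [OF has_derivative_bounded_linear [OF der]])
      also have "\<dots> \<le> (\<Sum>c\<in>Basis. K b c)" using K x by (intro sum_mono) auto
      finally show "onorm (frechet_derivative (\<lambda>y. D y b) (at x)) \<le> (\<Sum>c\<in>Basis. K b c)" .
    qed (use that in auto)
    then show ?thesis by simp
  qed
  have der: "(F has_derivative D y) (at y)" if "y \<in> ball z r" for y
  proof -
    have "y \<in> U" using that r(2) by auto
    from frechet_derivative_works [THEN iffD1, OF diff [OF this]] show ?thesis unfolding D_def .
  qed
  have "\<bar>D y h - D y' h\<bar> \<le> L * norm h * norm (y - y')" if y: "y \<in> ball z r" "y' \<in> ball z r" for y y' h
  proof -
    have lin: "bounded_linear (\<lambda>h. D y h - D y' h)"
      using der y by (intro bounded_linear_sub has_derivative_bounded_linear)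
    have "\<bar>D y h - D y' h\<bar> \<le> onorm (\<lambda>h. D y h - D y' h) * norm h"
      using onorm [OF lin] by simp
    also have "\<dots> \<le> (\<Sum>b\<in>Basis. norm (D y b - D y' b)) * norm h"
      by (intro mult_right_mono onorm_componentwise lin) simp
    also have "\<dots> \<le> (\<Sum>b\<in>Basis. (\<Sum>c\<in>Basis. K b c) * norm (y - y')) * norm h"
      using D_lip [OF y] by (intro mult_right_mono sum_mono) auto
    also have "\<dots> = (L * norm (y - y')) * norm h" by (simp add: L_def sum_distrib_right)
    also have "\<dots> = L * norm h * norm (y - y')" by simp
    finally show ?thesis .
  qed
  with der have "C11_on_ball F D z r L" unfolding C11_on_ball_def by blast
  with r(1) \<open>0 \<le> L\<close> show thesis using that unfolding D_def by blast
qed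

lemma uniform_C11_on_ball:
  assumes "\<And>i. i < (m :: nat) \<Longrightarrow> \<exists>r>0. \<exists>L\<ge>0. C11_on_ball (F i) (DF i) z r L"
  shows "\<exists>r>0. \<exists>L\<ge>0. \<forall>i<m. C11_on_ball (F i) (DF i) z r L"
  using assms
proof (induction m)
  case 0
  show ?case by (intro exI [of _ 1] conjI) simp_all
next
  case (Suc m)
  have "\<exists>r>0. \<exists>L\<ge>0. \<forall>i<m. C11_on_ball (F i) (DF i) z r L"
    by (rule Suc.IH) (simp add: Suc.prems)
  then obtain r L where r: "0 < r" "0 \<le> L" "\<And>i. i < m \<Longrightarrow> C11_on_ball (F i) (DF i) z r L"
    by blast
  obtain r' L' where r': "0 < r'" "0 \<le> L'" "C11_on_ball (F m) (DF m) z r' L'"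
    using Suc.prems [of m] by auto
  have "C11_on_ball (F i) (DF i) z (min r r') (max L L')" if "i < Suc m" for i
  proof (cases "i = m")
    case True
    with r'(3) show ?thesis by (auto intro: C11_on_ball_mono)
  next
    case False
    with that r(3) [of i] show ?thesis by (auto intro: C11_on_ball_mono)
  qed
  then show ?case using r r' by (intro exI [of _ "min r r'"] conjI exI [of _ "max L L'"]) auto
qed

text \<open>Near the point the graph is the zero set of the equations of \<open>M\<close> together
  with \<open>g (fst p) - snd p\<close>, which receives the index \<open>m\<close>.\<close>

lemma gph_on_curved_normals:
  fixes f :: "'a::euclidean_space \<Rightarrow> ereal"
  assumes M: "Ck_manifold 2 M" and "x \<in> M" and f: "Ck_restriction_near 2 f M x"
  shows "(x, real_of_ereal (f x)) \<in> gph_on f M"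
    and "curved_normals (gph_on f M) (x, real_of_ereal (f x))"
proof -
  obtain V g where V: "open V" "x \<in> V" "Ck_on 2 g V" "\<And>y. y \<in> M \<inter> V \<Longrightarrow> f y = ereal (g y)"
  proof -
    obtain V g where "open V" "x \<in> V" "Ck_on 2 g V" "\<forall>y \<in> M \<inter> V. f y = ereal (g y)"
      using f unfolding Ck_restriction_near_def by (elim exE conjE) (rule that)
    then show thesis by (intro that [of V g]) simp_all
  qed
  define z where "z = (x, real_of_ereal (f x))"
  show z: "(x, real_of_ereal (f x)) \<in> gph_on f M"
    using V(4) [of x] V(2) \<open>x \<in> M\<close> by (simp add: gph_on_def)
  obtain m where "\<forall>x\<in>M. \<exists>U (F :: nat \<Rightarrow> 'a \<Rightarrow> real). open U \<and> x \<in> U \<and> (\<forall>i<m. Ck_on 2 (F i) U) \<and>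
        (\<forall>y\<in>U. \<forall>c. \<exists>h. \<forall>i<m. frechet_derivative (F i) (at y) h = c i) \<and>
        M \<inter> U = {y \<in> U. \<forall>i<m. F i y = 0}"
    using M unfolding Ck_manifold_def by (elim exE conjE) (rule that)
  from bspec [OF this \<open>x \<in> M\<close>] obtain U and F :: "nat \<Rightarrow> 'a \<Rightarrow> real" where "open U" "x \<in> U"
    and UF: "\<forall>i<m. Ck_on 2 (F i) U"
    and "\<forall>y\<in>U. \<forall>c. \<exists>h. \<forall>i<m. frechet_derivative (F i) (at y) h = c i"
    and zero: "M \<inter> U = {y \<in> U. \<forall>i<m. F i y = 0}" by (elim exE conjE) (rule that)
  note UU = this
  have surj: "\<And>y c. y \<in> U \<Longrightarrow> \<exists>h. \<forall>i<m. frechet_derivative (F i) (at y) h = c i" using UU(4) by simp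
  have U: "open U" "x \<in> U" "\<And>i. i < m \<Longrightarrow> Ck_on 2 (F i) U" using \<open>open U\<close> \<open>x \<in> U\<close> UF by auto
  define DF where "DF = (\<lambda>i y. frechet_derivative (F i) (at y))"
  define Dg where "Dg = (\<lambda>y. frechet_derivative g (at y))"
  have "\<exists>r>0. \<exists>L\<ge>0. C11_on_ball (F i) (DF i) x r L" if i: "i < m" for i
  proof -
    obtain r L where "0 < r" "0 \<le> L" "C11_on_ball (F i) (DF i) x r L"
      unfolding DF_def by (rule Ck_on_2_C11_on_ball [OF U(3) [OF i] U(1,2)])
    then show ?thesis by blast
  qed
  then have "\<exists>r>0. \<exists>L\<ge>0. \<forall>i<m. C11_on_ball (F i) (DF i) x r L"
    by (rule uniform_C11_on_ball)
  then obtain r1 L1 where 1: "0 < r1" "0 \<le> L1" "\<And>i. i < m \<Longrightarrow> C11_on_ball (F i) (DF i) x r1 L1" by blast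
  obtain r2 L2 where 2: "0 < r2" "0 \<le> L2" "C11_on_ball g Dg x r2 L2"
    unfolding Dg_def by (rule Ck_on_2_C11_on_ball [OF V(3,1,2)])
  obtain r3 where r3: "0 < r3" "ball x r3 \<subseteq> U \<inter> V"
    using openE [OF open_Int [OF U(1) V(1)], of x] U(2) V(2) by blast
  define r where "r = min r1 (min r2 r3)"
  define L where "L = max L1 L2"
  have "0 < r" "0 \<le> L" using 1 2 r3 by (auto simp: r_def L_def)
  have F: "C11_on_ball (F i) (DF i) x r L" if "i < m" for i
    using 1(3) [OF that] by (rule C11_on_ball_mono) (auto simp: r_def L_def)
  have g: "C11_on_ball g Dg x r L"
    using 2(3) by (rule C11_on_ball_mono) (auto simp: r_def L_def)
  have rUV: "ball x r \<subseteq> U \<inter> V" using r3(2) by (auto simp: r_def)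
  define H where "H = (\<lambda>i p. if i < m then F i (fst p) else g (fst p) - snd p :: real)"
  define DH where "DH = (\<lambda>i (p :: 'a \<times> real) h. if i < m then DF i (fst p) (fst h) else Dg (fst p) (fst h) - snd h :: real)"
  have fst_ball: "fst p \<in> ball x r" if "p \<in> ball z r" for p
    using that dist_fst_le [of z p] by (simp add: z_def)
  have fst_le: "norm (fst p) \<le> norm p" for p :: "'a \<times> real"
    using norm_fst_le [of "fst p" "snd p"] by simp
  show "curved_normals (gph_on f M) (x, real_of_ereal (f x))"
    unfolding z_def [symmetric]
  proof (rule zero_set_curved_normals [of r L z _ "Suc m" H DH])
    show "z \<in> gph_on f M" using z by (simp add: z_def)
    show "(H i has_derivative DH i y) (at y)" if "i < Suc m" "y \<in> ball z r" for i y
    proof -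
      note fst = bounded_linear_imp_has_derivative [OF bounded_linear_fst, of "at y"]
        and snd = bounded_linear_imp_has_derivative [OF bounded_linear_snd, of "at y"]
      show ?thesis
      proof (cases "i < m")
        case True
        have "(F i has_derivative DF i (fst y)) (at (fst y))"
          using F [OF True] fst_ball [OF that(2)] unfolding C11_on_ball_def by blast
        from has_derivative_compose [OF fst this] show ?thesis using True by (simp add: H_def DH_def)
      next
        case False
        have "(g has_derivative Dg (fst y)) (at (fst y))"
          using g fst_ball [OF that(2)] unfolding C11_on_ball_def by blast
        from has_derivative_diff [OF has_derivative_compose [OF fst this] snd]
        show ?thesis using False by (simp add: H_def DH_def)
      qed
    qed
    show "\<bar>H i p - H i q - DH i y (p - q)\<bar> \<le> L * norm (p - q) * (norm (p - y) + norm (q - y))"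
      if "i < Suc m" "y \<in> ball z r" "p \<in> ball z r" "q \<in> ball z r" for i y p q
    proof -
      have "\<bar>H i p - H i q - DH i y (p - q)\<bar>
          \<le> L * norm (fst (p - q)) * (norm (fst (p - y)) + norm (fst (q - y)))"
      proof (cases "i < m")
        case True
        then show ?thesis
          using C11_on_ball_estimate [OF F [OF True] \<open>0 \<le> L\<close>, of "fst y" "fst p" "fst q"] fst_ball that
          by (simp add: H_def DH_def)
      next
        case False
        then show ?thesis
          using C11_on_ball_estimate [OF g \<open>0 \<le> L\<close>, of "fst y" "fst p" "fst q"] fst_ball that
          by (simp add: H_def DH_def)
      qed
      also have "\<dots> \<le> L * norm (p - q) * (norm (p - y) + norm (q - y))"
        using \<open>0 \<le> L\<close> by (intro mult_mono add_mono mult_left_mono fst_le) auto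
      finally show ?thesis .
    qed
    show "\<bar>DH i y h - DH i z h\<bar> \<le> L * norm h * norm (y - z)" if "i < Suc m" "y \<in> ball z r" for i y h
    proof -
      have "\<bar>DH i y h - DH i z h\<bar> \<le> L * norm (fst h) * norm (fst (y - z))"
        using F [of i] g fst_ball [OF that(2)] \<open>0 < r\<close> unfolding C11_on_ball_def
        by (cases "i < m") (auto simp: DH_def z_def)
      also have "\<dots> \<le> L * norm h * norm (y - z)"
        using \<open>0 \<le> L\<close> by (intro mult_mono mult_left_mono fst_le) auto
      finally show ?thesis .
    qed
    show "\<exists>h. \<forall>i<Suc m. DH i y h = c i" if "y \<in> ball z r" for y and c :: "nat \<Rightarrow> real"
    proof -
      have "fst y \<in> U" using fst_ball [OF that] rUV by blast
      then obtain h where "\<forall>i<m. DF i (fst y) h = c i" using surj unfolding DF_def by blast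
      \<comment> \<open>The last equation has derivative -1 in the height, so the height component
        solves it once the others are solved.\<close>
      then have "\<forall>i<Suc m. DH i y (h, Dg (fst y) h - c m) = c i"
        by (auto simp: DH_def less_Suc_eq)
      then show ?thesis by blast
    qed
    show "gph_on f M \<inter> ball z r = {y \<in> ball z r. \<forall>i<Suc m. H i y = 0}"
    proof -
      have "p \<in> gph_on f M \<longleftrightarrow> (\<forall>i<Suc m. H i p = 0)" if "p \<in> ball z r" for p
      proof -
        have p: "fst p \<in> U" "fst p \<in> V" using fst_ball [OF that] rUV by auto
        have "p \<in> gph_on f M \<longleftrightarrow> fst p \<in> M \<and> f (fst p) = ereal (snd p)"
          by (cases p) (simp add: gph_on_def)
        also have "\<dots> \<longleftrightarrow> fst p \<in> M \<and> g (fst p) = snd p" using V(4) [of "fst p"] p(2) by auto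
        also have "fst p \<in> M \<longleftrightarrow> (\<forall>i<m. F i (fst p) = 0)" using zero p(1) by blast
        finally show ?thesis by (auto simp: H_def less_Suc_eq)
      qed
      then show ?thesis by blast
    qed
  qed (use \<open>0 < r\<close> \<open>0 \<le> L\<close> in auto)
qed

section \<open>Epigraphs and graphs of symmetric functions\<close>

lemma permutation_invariant_epi:
  assumes "symmetric_fun f"
  shows "permutation_invariant (epi f)"
  using assms unfolding permutation_invariant_def symmetric_fun_def epi_def permute_def by auto

lemma permutation_invariant_gph_on:
  assumes "symmetric_fun f" "symmetric_set M"
  shows "permutation_invariant (gph_on f M)"
proof -
  have "(\<chi> i. a $ \<pi> i) \<in> M" if "bij \<pi>" "a \<in> M" for \<pi> and a :: "real ^ 'a"
    using imageI [OF that(2), of "\<lambda>x. \<chi> i. x $ \<pi> i"] assms(2) that(1) by (simp add: symmetric_set_def)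
  then show ?thesis
    using assms(1) unfolding permutation_invariant_def symmetric_fun_def gph_on_def permute_def by auto
qed

lemma holds_near_signed:
  fixes X Y :: "'a::euclidean_space set"
  shows "holds_near reg_b_le X Y z = holds_near (signed_b {1}) X Y z"
    and "holds_near reg_b_ge X Y z = holds_near (signed_b {- 1}) X Y z"
    and "holds_near reg_b_eq X Y z = holds_near (signed_b {1, - 1}) X Y z"
    and "holds_near strong_reg_b_le X Y z = holds_near (strong_signed_b {1}) X Y z"
    and "holds_near strong_reg_b_ge X Y z = holds_near (strong_signed_b {- 1}) X Y z"
    and "holds_near strong_reg_b_eq X Y z = holds_near (strong_signed_b {1, - 1}) X Y z"
  unfolding holds_near_def reg_b_signed strong_reg_b_signed by (rule refl)+

text \<open>Epigraph and graph of the composition are the spectral sets of those of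
  \<open>f\<close>, and \<open>X\<close> is a lift of its eigenvalues. \<open>P\<close> and
  \<open>P'\<close> stand for one condition at two types, vectors and matrices.\<close>

lemma fun_regular_spectral:
  fixes f :: "real ^ 'n::{finite, linorder} \<Rightarrow> ereal"
  assumes "\<And>U. orthogonal_matrix U \<Longrightarrow> holds_near P (epi f) (gph_on f M) (eigvals X, real_of_ereal (f (eigvals X))) \<Longrightarrow>
    holds_near P' (spectral_set (epi f)) (spectral_set (gph_on f M)) (lift U (eigvals X, real_of_ereal (f (eigvals X))))"
  shows "fun_regular P f M (eigvals X) \<longrightarrow> fun_regular P' (f \<circ> eigvals) (eigvals -` M) X"
proof
  assume reg: "fun_regular P f M (eigvals X)"
  obtain U where U: "orthogonal_matrix U" "X = spec U (eigvals X)" by (rule spec_eigvals)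
  have "spectral_set (epi f) = epi (f \<circ> eigvals)" "spectral_set (gph_on f M) = gph_on (f \<circ> eigvals) (eigvals -` M)"
    by (auto simp: spectral_set_def epi_def gph_on_def)
  moreover have "lift U (eigvals X, real_of_ereal (f (eigvals X))) = (X, real_of_ereal ((f \<circ> eigvals) X))"
    using U(2) by (simp add: lift_def)
  ultimately show "fun_regular P' (f \<circ> eigvals) (eigvals -` M) X"
    using assms [OF U(1)] reg unfolding fun_regular_def by simp
qed

theorem theorem3p25:
  fixes f :: "real ^ 'n::{finite, linorder} \<Rightarrow> ereal"
    and M :: "(real ^ 'n::{finite, linorder}) set"
    and xbar :: "real ^ 'n::{finite, linorder}"
    and Xbar :: "'n symmat"
  assumes "\<forall>x. f x \<noteq> - \<infinity>"
    and "symmetric_fun f"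
    and "symmetric_set M"
    and "Ck_manifold 2 M"
    and "xbar \<in> M"
    and "locally_lipschitz_around f xbar"
    and "Ck_restriction_near 2 f M xbar"
    and "xbar = eigvals Xbar"
  shows "(fun_regular reg_a f M xbar \<longrightarrow>
       fun_regular reg_a (f \<circ> eigvals) (eigvals -` M) Xbar)
    \<and> (fun_regular strong_reg_a f M xbar \<longrightarrow>
       fun_regular strong_reg_a (f \<circ> eigvals) (eigvals -` M) Xbar)
    \<and> (fun_regular reg_b_le f M xbar \<longrightarrow>
       fun_regular reg_b_le (f \<circ> eigvals) (eigvals -` M) Xbar)
    \<and> (fun_regular reg_b_eq f M xbar \<longrightarrow>
       fun_regular reg_b_eq (f \<circ> eigvals) (eigvals -` M) Xbar)
    \<and> (fun_regular reg_b_ge f M xbar \<longrightarrow>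
       fun_regular reg_b_ge (f \<circ> eigvals) (eigvals -` M) Xbar)
    \<and> (Ck_manifold 3 M \<longrightarrow>
      (fun_regular strong_reg_b_le f M xbar \<longrightarrow>
       fun_regular strong_reg_b_le (f \<circ> eigvals) (eigvals -` M) Xbar)
      \<and> (fun_regular strong_reg_b_eq f M xbar \<longrightarrow>
       fun_regular strong_reg_b_eq (f \<circ> eigvals) (eigvals -` M) Xbar)
      \<and> (fun_regular strong_reg_b_ge f M xbar \<longrightarrow>
       fun_regular strong_reg_b_ge (f \<circ> eigvals) (eigvals -` M) Xbar))"
proof -
  note Q = permutation_invariant_epi [OF assms(2)]
    and G = permutation_invariant_gph_on [OF assms(2,3)]
    and gph = gph_on_curved_normals [OF assms(4,5,7), unfolded assms(8)]
  note signed = signed_b_transfer [OF _ Q G] strong_signed_b_transfer [OF _ Q G]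
  have "fun_regular reg_a f M (eigvals Xbar) \<longrightarrow> fun_regular reg_a (f \<circ> eigvals) (eigvals -` M) Xbar"
    by (rule fun_regular_spectral) (rule reg_a_transfer [OF Q G])
  moreover have "fun_regular strong_reg_a f M (eigvals Xbar) \<longrightarrow>
      fun_regular strong_reg_a (f \<circ> eigvals) (eigvals -` M) Xbar"
    by (rule fun_regular_spectral) (rule strong_reg_a_transfer [OF Q G gph(2,1)])
  moreover have "fun_regular reg_b_le f M (eigvals Xbar) \<longrightarrow>
      fun_regular reg_b_le (f \<circ> eigvals) (eigvals -` M) Xbar"
    by (rule fun_regular_spectral) (unfold holds_near_signed, rule signed, simp_all)
  moreover have "fun_regular reg_b_eq f M (eigvals Xbar) \<longrightarrow>
      fun_regular reg_b_eq (f \<circ> eigvals) (eigvals -` M) Xbar"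
    by (rule fun_regular_spectral) (unfold holds_near_signed, rule signed, simp_all)
  moreover have "fun_regular reg_b_ge f M (eigvals Xbar) \<longrightarrow>
      fun_regular reg_b_ge (f \<circ> eigvals) (eigvals -` M) Xbar"
    by (rule fun_regular_spectral) (unfold holds_near_signed, rule signed, simp_all)
  moreover have "fun_regular strong_reg_b_le f M (eigvals Xbar) \<longrightarrow>
      fun_regular strong_reg_b_le (f \<circ> eigvals) (eigvals -` M) Xbar"
    by (rule fun_regular_spectral) (unfold holds_near_signed, rule signed, simp_all)
  moreover have "fun_regular strong_reg_b_eq f M (eigvals Xbar) \<longrightarrow>
      fun_regular strong_reg_b_eq (f \<circ> eigvals) (eigvals -` M) Xbar"
    by (rule fun_regular_spectral) (unfold holds_near_signed, rule signed, simp_all)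
  moreover have "fun_regular strong_reg_b_ge f M (eigvals Xbar) \<longrightarrow>
      fun_regular strong_reg_b_ge (f \<circ> eigvals) (eigvals -` M) Xbar"
    by (rule fun_regular_spectral) (unfold holds_near_signed, rule signed, simp_all)
  ultimately show ?thesis unfolding assms(8) by blast
qed

end
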